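(* Let $t>s\ge 2$ be integers. Then for every graph $G$, $$p_t(G)\ \ge\ F_t\bigl(F_s^{-1}(p_s(G))\bigr).$$
   Context: Graphs are finite, simple and have at least one vertex. For an integer $r\ge 2$ and a graph $G$, $k_r(G)$ is the number of copies of the clique $K_r$ in $G$ (i.e. the number of $r$-element vertex subsets that induce a complete graph), and $p_r(G)=k_r(G)/|V(G)|^r$; always $0\le p_r(G)<1/r!$. The functions $F_r:[0,1/2)\to[0,1/r!)$ ($r\ge 2$) are defined as follows. $F_r(0)=0$. For $\gamma\in(0,1/2)$ there are a unique integer $p\ge 1$ and a unique $\alpha\in[0,1/p)$ with $\gamma=\frac{p}{2(p+1)}(1-\alpha^2)$, and $$F_r(\gamma)=\frac{\binom{p+1}{r}}{(p+1)^r}(1+\alpha)^{r-1}\bigl(1-(r-1)\alpha\bigr),$$ where $\binom{p+1}{r}=0$ if $p+1<r$. (Equivalently, $F_r(\gamma)$ is the limit as $n\to\infty$ of $p_r$ of the $n$-vertex complete $(p+1)$-partite graph with $p$ classes of size $\frac{(1+\alpha)n}{p+1}$ and one class of size $\frac{(1-p\alpha)n}{p+1}$.) In particular $F_2(\gamma)=\gamma$. The function $F_r$ is identically $0$ on $[0,\frac{r-2}{2(r-1)}]$ and is continuous and strictly increasing on $[\frac{r-2}{2(r-1)},1/2)$, with image $[0,1/r!)$. The generalized inverse $F_r^{-1}:[0,1/r!)\to[0,1/2)$ is defined by $F_r^{-1}(0)=\frac{r-2}{2(r-1)}$ and, for $y\in(0,1/r!)$, $F_r^{-1}(y)$ is the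 unique $\gamma\in(\frac{r-2}{2(r-1)},1/2)$ with $F_r(\gamma)=y$. *)

theory Defs
  imports Complex_Main "HOL-Library.Ramsey"
begin

definition simple_graph :: "'a set \<Rightarrow> 'a set set \<Rightarrow> bool" where
  "simple_graph V E \<longleftrightarrow> finite V \<and> V \<noteq> {} \<and> E \<subseteq> [V]\<^bsup>2\<^esup>"

definition clique_count :: "nat \<Rightarrow> 'a set \<Rightarrow> 'a set set \<Rightarrow> nat" where
  "clique_count r V E = card {S \<in> [V]\<^bsup>r\<^esup>. clique S E}"

definition clique_density :: "nat \<Rightarrow> 'a set \<Rightarrow> 'a set set \<Rightarrow> real" where
  "clique_density r V E = real (clique_count r V E) / real (card V) ^ r"

definition edge_density_params :: "real \<Rightarrow> nat \<Rightarrow> real \<Rightarrow> bool" where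
  "edge_density_params \<gamma> p \<alpha> \<longleftrightarrow>
     1 \<le> p \<and> 0 \<le> \<alpha> \<and> \<alpha> < 1 / real p \<and>
     \<gamma> = real p / (2 * (real p + 1)) * (1 - \<alpha>\<^sup>2)"

text \<open>
  The function \<open>F\<^sub>r\<close> on \<open>[0, 1/2)\<close>; it is meaningful only there, since outside that interval the
  parameters \<open>p\<close> and \<open>\<alpha>\<close> do not exist.
\<close>
definition clique_F :: "nat \<Rightarrow> real \<Rightarrow> real" where
  "clique_F r \<gamma> =
     (if \<gamma> = 0 then 0
      else (let (p, \<alpha>) = (THE (p, \<alpha>). edge_density_params \<gamma> p \<alpha>) in
        real ((p + 1) choose r) / (real p + 1) ^ r
          * (1 + \<alpha>) ^ (r - 1) * (1 - (real r - 1) * \<alpha>)))"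

text \<open>The generalized inverse of \<open>F\<^sub>r\<close>, meaningful only on \<open>[0, 1/r!)\<close>.\<close>
definition clique_F_inv :: "nat \<Rightarrow> real \<Rightarrow> real" where
  "clique_F_inv r y =
     (if y = 0 then (real r - 2) / (2 * (real r - 1))
      else (THE \<gamma>. (real r - 2) / (2 * (real r - 1)) < \<gamma> \<and> \<gamma> < 1/2 \<and> clique_F r \<gamma> = y))"

lemma edge_density_params_bounds:
  assumes "edge_density_params \<gamma> p \<alpha>"
  shows "(real p - 1) / (2 * real p) < \<gamma>" "\<gamma> \<le> real p / (2 * (real p + 1))"
proof -
  have p: "real p \<ge> 1" and a: "0 \<le> \<alpha>" "\<alpha> < 1 / real p"
    and g: "\<gamma> = real p / (2 * (real p + 1)) * (1 - \<alpha>\<^sup>2)"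
    using assms by (auto simp: edge_density_params_def)
  have "\<alpha>\<^sup>2 < (1 / real p)\<^sup>2"
    using a by (intro power_strict_mono) auto
  then have "real p / (2 * (real p + 1)) * (1 - (1 / real p)\<^sup>2) < \<gamma>"
    unfolding g using p by (intro mult_strict_left_mono) auto
  also have "real p / (2 * (real p + 1)) * (1 - (1 / real p)\<^sup>2) = (real p - 1) / (2 * real p)"
    using p by (simp add: divide_simps power2_eq_square) (simp add: algebra_simps)
  finally show "(real p - 1) / (2 * real p) < \<gamma>" .
  show "\<gamma> \<le> real p / (2 * (real p + 1))"
    unfolding g using p by (intro mult_left_le) auto
qed

lemma edge_density_params_unique:
  assumes "edge_density_params \<gamma> p \<alpha>" "edge_density_params \<gamma> q \<beta>"
  shows "p = q \<and> \<alpha> = \<beta>"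
proof -
  have le: "False" if "p < q" "edge_density_params \<gamma> p \<alpha>" "edge_density_params \<gamma> q \<beta>"
    for p q \<alpha> \<beta>
  proof -
    have "real p / (2 * (real p + 1)) \<le> (real q - 1) / (2 * real q)"
      using that(1) by (simp add: divide_simps) (simp add: algebra_simps)
    then show False
      using edge_density_params_bounds[OF that(2)] edge_density_params_bounds[OF that(3)] by linarith
  qed
  then have pq: "p = q"
    using assms by (meson linorder_neqE_nat)
  have "\<alpha>\<^sup>2 = \<beta>\<^sup>2"
    using assms by (auto simp: edge_density_params_def pq)
  then have "\<alpha> = \<beta>"
    using assms by (auto simp: edge_density_params_def intro: power2_eq_imp_eq)
  with pq show ?thesis by simp
qed

lemma edge_density_params_exist:
  assumes "0 < \<gamma>" "\<gamma> < 1/2"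
  shows "\<exists>p \<alpha>. edge_density_params \<gamma> p \<alpha>"
proof -
  let ?P = "\<lambda>p::nat. 1 \<le> p \<and> \<gamma> \<le> real p / (2 * (real p + 1))"
  obtain n :: nat where n: "1 / (1 - 2 * \<gamma>) < real n"
    using reals_Archimedean2 by blast
  have "1 < real n * (1 - 2 * \<gamma>)"
    using n assms by (simp add: divide_simps)
  moreover have "n \<noteq> 0" using calculation by (intro notI) simp
  ultimately have "?P n"
    using assms by (simp add: divide_simps) (simp add: algebra_simps)
  define p where "p = (LEAST p. ?P p)"
  have P: "?P p" unfolding p_def using \<open>?P n\<close> by (rule LeastI)
  have low: "(real p - 1) / (2 * real p) < \<gamma>"
  proof (cases "p = 1")
    case True
    then show ?thesis using assms by simp
  next
    case False
    then have "\<not> ?P (p - 1)"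
      using P by (intro not_less_Least[of _ ?P, folded p_def]) auto
    then show ?thesis using P False by (auto simp: of_nat_diff not_le)
  qed
  define b where "b = 1 - 2 * (real p + 1) * \<gamma> / real p"
  have p1: "real p \<ge> 1" using P by simp
  have b0: "0 \<le> b"
    using P p1 by (simp add: b_def divide_simps) (simp add: algebra_simps)
  have "(real p - 1) / (2 * real p) * (2 * (real p + 1) / real p) < \<gamma> * (2 * (real p + 1) / real p)"
    using low p1 by (intro mult_strict_right_mono) auto
  moreover have "(real p - 1) / (2 * real p) * (2 * (real p + 1) / real p) = 1 - (1 / real p)\<^sup>2"
    using p1 by (simp add: divide_simps power2_eq_square) (simp add: algebra_simps)
  ultimately have "b < (1 / real p)\<^sup>2"
    by (simp add: b_def algebra_simps)
  then have "sqrt b < 1 / real p"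
    by (intro real_less_lsqrt) auto
  moreover have "\<gamma> = real p / (2 * (real p + 1)) * (1 - (sqrt b)\<^sup>2)"
    using b0 p1 by (simp add: b_def)
  ultimately have "edge_density_params \<gamma> p (sqrt b)"
    using P b0 by (simp add: edge_density_params_def)
  then show ?thesis by blast
qed

lemma clique_F_eq:
  assumes "\<gamma> \<noteq> 0" "edge_density_params \<gamma> p \<alpha>"
  shows "clique_F r \<gamma> = real ((p + 1) choose r) / (real p + 1) ^ r
           * (1 + \<alpha>) ^ (r - 1) * (1 - (real r - 1) * \<alpha>)"
proof -
  have "(THE (p, \<alpha>). edge_density_params \<gamma> p \<alpha>) = (p, \<alpha>)"
    using assms(2) edge_density_params_unique by (intro the_equality) fast+
  then show ?thesis using assms(1) by (simp add: clique_F_def)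
qed

end

theory Submission
  imports Defs "HOL-Analysis.Convex"
begin

text \<open>
  The proof works with finite graphs whose vertices carry nonnegative real weights; a clique
  counts with the product of its weights. With all weights \<open>1 / n\<close> the clique sums
  are the densities \<open>p\<^sub>r\<close>. The extremal graphs are complete multipartite with
  \<open>q\<close> parts of weight \<open>z\<close> and one part of weight \<open>w \<le>
  z\<close>. The triple \<open>(q, z, w)\<close> is called a profile; the value
  \<open>F\<^sub>j(\<gamma>)\<close> is the number of \<open>j\<close>-cliques of the profile of
  total weight 1 that belongs to \<open>\<gamma>\<close> (lemma
  \<open>profile_count_eq_clique_F\<close>). The theorem says that a graph with as many
  \<open>s\<close>-cliques as some profile has at least as many \<open>t\<close>-cliques. Since
  the profile stays the same, it suffices to pass from \<open>s\<close> to \<open>s + 1\<close>;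
  this is \<open>extension_bound_all\<close>, proved by induction on \<open>s\<close> and, inside,
  on the number \<open>q\<close> of equal parts.

  The induction step for \<open>q = p\<close> is a Lagrangian argument. Suppose the bound fails,
  and let \<open>\<epsilon>\<close> be the supremum of the violations over graphs \<open>G\<close>
  of total weight 1 and profiles \<open>(p, t, y)\<close> with as many \<open>s\<close>-cliques as
  \<open>G\<close>. Let \<open>\<lambda>\<close> be the slope at \<open>t\<close> of the curve
  formed by the \<open>s\<close>-clique and \<open>(s + 1)\<close>-clique counts of these
  profiles, and put \<open>f = K\<^sub>s\<^sub>+\<^sub>1 - \<lambda> K\<^sub>s\<close> and
  \<open>g = K\<^sub>s - \<lambda> K\<^sub>s\<^sub>-\<^sub>1\<close>, so that \<open>g\<close> of
  the neighbourhood of a vertex is the partial derivative of \<open>f\<close> with respect to its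
  weight. For a nearly worst \<open>G\<close>, adding a new vertex of tiny weight with an
  arbitrary neighbourhood \<open>S\<close> cannot increase the violation noticeably. Hence
  \<open>g(S) \<ge> \<mu>\<close> up to a small error for every vertex set \<open>S\<close>, where
  \<open>\<mu>\<close> is the average of \<open>g\<close> over the neighbourhoods of vertices
  (\<open>near_extremal_first_order\<close>). Two consequences are used. First, deleting vertices
  one at a time shows \<open>f(H) \<le> f(G) - \<mu> (1 - |H|)\<close> for every vertex set
  \<open>H\<close> of weight \<open>|H|\<close> (\<open>removal_bound\<close>). Secondly, some
  vertex has a neighbourhood \<open>H\<close> with \<open>|H| \<le> p t\<close> and
  \<open>g(H)\<close> almost equal to \<open>\<mu>\<close>; the Moon-Moser inequality is what
  makes the average degree small enough.

  For such an \<open>H\<close> a lower bound competes with the first consequence: with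
  \<open>\<sigma> = p t - |H|\<close>, the number \<open>f(H) + \<sigma> g(H)\<close> is at least
  the value of \<open>f\<close> for \<open>p\<close> parts of weight \<open>t\<close>
  (\<open>link_functional_bound\<close>). This number is \<open>f\<close> of \<open>H\<close>
  joined with one more vertex of weight \<open>\<sigma>\<close>. The Moon-Moser inequality shows
  that \<open>H\<close> has fewer \<open>s\<close>-cliques than \<open>p\<close> equal parts of
  the same total weight. If it has at most as many as \<open>p - 1\<close> equal parts, the
  induction on \<open>q\<close> applies to the join. Otherwise it applies to \<open>H\<close>
  itself, together with the induction on \<open>s\<close>, which bounds the number of \<open>(s -
  1)\<close>-cliques of \<open>H\<close> from above. What remains are inequalities between
  polynomials in one variable. Since \<open>\<mu>\<close> falls short of its value for the profile
  by \<open>(s + 1)\<epsilon>\<close>, the two bounds together give \<open>\<epsilon> (1 - (s + 1)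
  y) \<le> 0\<close> up to small errors, and this is false because \<open>y < 1 / (p + 1)\<close>
  and \<open>s \<le> p\<close>.
\<close>

section \<open>Clique sums of weighted graphs\<close>

definition cliques_of :: "('a \<Rightarrow> 'a \<Rightarrow> bool) \<Rightarrow> nat \<Rightarrow> 'a set \<Rightarrow> 'a set set" where
  "cliques_of A j U = {S. S \<subseteq> U \<and> card S = j \<and> pairwise A S}"

definition clique_sum :: "('a \<Rightarrow> 'a \<Rightarrow> bool) \<Rightarrow> ('a \<Rightarrow> real) \<Rightarrow> nat \<Rightarrow> 'a set \<Rightarrow> real" where
  "clique_sum A x j U = (\<Sum>S\<in>cliques_of A j U. \<Prod>i\<in>S. x i)"

definition nbhd :: "('a \<Rightarrow> 'a \<Rightarrow> bool) \<Rightarrow> 'a \<Rightarrow> 'a set \<Rightarrow> 'a set" where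
  "nbhd A v U = {u\<in>U. A v u}"

locale weighted_graph =
  fixes A :: "'a \<Rightarrow> 'a \<Rightarrow> bool" and x :: "'a \<Rightarrow> real" and U :: "'a set"
  assumes sym: "A u v \<Longrightarrow> A v u" and irr: "\<not> A u u"
    and fin: "finite U" and nonneg: "0 \<le> x u"

lemma finite_cliques_of [simp, intro]: "finite U \<Longrightarrow> finite (cliques_of A j U)"
  unfolding cliques_of_def by (rule finite_subset[of _ "Pow U"]) auto

lemma clique_sum_0 [simp]: "finite U \<Longrightarrow> clique_sum A x 0 U = 1"
proof -
  assume "finite U"
  then have "cliques_of A 0 U = {{}}"
    unfolding cliques_of_def using finite_subset[of _ U] by (auto simp: card_eq_0_iff pairwise_def)
  then show ?thesis unfolding clique_sum_def by simp
qed

lemma clique_sum_1: "clique_sum A x (Suc 0) U = sum x U"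
proof -
  have eq: "cliques_of A (Suc 0) U = (\<lambda>u. {u}) ` U"
    unfolding cliques_of_def by (auto simp: card_Suc_eq pairwise_def)
  show ?thesis unfolding clique_sum_def eq
    by (subst sum.reindex) auto
qed

lemma clique_sum_cong:
  assumes "\<And>u. u \<in> U \<Longrightarrow> x u = y u" "\<And>u v. u \<in> U \<Longrightarrow> v \<in> U \<Longrightarrow> A u v = B u v"
  shows "clique_sum A x j U = clique_sum B y j U"
proof -
  have "cliques_of A j U = cliques_of B j U"
    unfolding cliques_of_def
  proof (intro Collect_cong conj_cong refl)
    fix S assume "S \<subseteq> U"
    then show "pairwise A S = pairwise B S"
      unfolding pairwise_def using assms(2) by (intro ball_cong refl) auto
  qed
  moreover have "(\<Prod>i\<in>S. x i) = (\<Prod>i\<in>S. y i)" if "S \<in> cliques_of A j U" for S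
    using that assms(1) unfolding cliques_of_def by (intro prod.cong) auto
  ultimately show ?thesis unfolding clique_sum_def by (intro sum.cong) auto
qed

lemma clique_sum_scale:
  assumes "finite U"
  shows "clique_sum A (\<lambda>u. c * x u) j U = c ^ j * clique_sum A x j U"
  unfolding clique_sum_def sum_distrib_left
  by (intro sum.cong refl) (simp add: prod.distrib cliques_of_def)

text \<open>
  The cliques that contain the new vertex are the cliques of its neighbourhood with the vertex
  added. Almost every later computation with clique sums goes back to this recursion.
\<close>

lemma clique_sum_insert:
  assumes "finite U" "v \<notin> U" and sym: "\<And>u v. A u v \<Longrightarrow> A v u"
  shows "clique_sum A x (Suc j) (insert v U) = clique_sum A x (Suc j) U + x v * clique_sum A x j (nbhd A v U)"
proof -
  have 1: "cliques_of A (Suc j) (insert v U)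
      = cliques_of A (Suc j) U \<union> insert v ` cliques_of A j (nbhd A v U)" (is "?L = ?R1 \<union> ?R2")
  proof (intro equalityI subsetI)
    fix S assume S: "S \<in> ?L"
    then have fS: "finite S" using assms(1) by (auto simp: cliques_of_def dest: finite_subset)
    show "S \<in> ?R1 \<union> ?R2"
    proof (cases "v \<in> S")
      case True
      have "S - {v} \<in> cliques_of A j (nbhd A v U)"
        using S True fS assms(2) unfolding cliques_of_def nbhd_def pairwise_def by auto
      moreover have "S = insert v (S - {v})" using True by auto
      ultimately show ?thesis by blast
    next
      case False
      then show ?thesis using S unfolding cliques_of_def by auto
    qed
  next
    fix S assume "S \<in> ?R1 \<union> ?R2"
    then show "S \<in> ?L"
    proof
      assume "S \<in> ?R2"
      then obtain S' where S': "S' \<in> cliques_of A j (nbhd A v U)" "S = insert v S'" by blast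
      have "v \<notin> S'" "finite S'" using S' assms by (auto simp: cliques_of_def nbhd_def dest: finite_subset)
      then show ?thesis using S' sym unfolding cliques_of_def nbhd_def pairwise_def by auto
    qed (auto simp: cliques_of_def)
  qed
  have disj: "?R1 \<inter> ?R2 = {}" using assms(2) by (auto simp: cliques_of_def)
  have finN: "finite (nbhd A v U)" using assms(1) by (simp add: nbhd_def)
  have inj: "inj_on (insert v) (cliques_of A j (nbhd A v U))"
  proof (rule inj_onI)
    fix S T assume *: "S \<in> cliques_of A j (nbhd A v U)" "T \<in> cliques_of A j (nbhd A v U)"
      and **: "insert v S = insert v T"
    have "v \<notin> S" using *(1) assms(2) by (auto simp: cliques_of_def nbhd_def)
    moreover have "v \<notin> T" using *(2) assms(2) by (auto simp: cliques_of_def nbhd_def)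
    ultimately show "S = T" using ** by (metis Diff_insert_absorb)
  qed
  have "(\<Sum>S\<in>?R2. \<Prod>i\<in>S. x i) = (\<Sum>S\<in>cliques_of A j (nbhd A v U). \<Prod>i\<in>insert v S. x i)"
    using inj by (simp add: sum.reindex)
  also have "\<dots> = (\<Sum>S\<in>cliques_of A j (nbhd A v U). x v * (\<Prod>i\<in>S. x i))"
  proof (intro sum.cong refl)
    fix S assume "S \<in> cliques_of A j (nbhd A v U)"
    then have "v \<notin> S" "finite S" using assms by (auto simp: cliques_of_def nbhd_def dest: finite_subset)
    then show "(\<Prod>i\<in>insert v S. x i) = x v * (\<Prod>i\<in>S. x i)" by simp
  qed
  finally have r2: "(\<Sum>S\<in>?R2. \<Prod>i\<in>S. x i) = x v * clique_sum A x j (nbhd A v U)"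
    by (simp add: clique_sum_def sum_distrib_left)
  show ?thesis
    unfolding clique_sum_def[of A x "Suc j" "insert v U"] 1
    by (subst sum.union_disjoint) (use assms(1) finN disj r2 in \<open>auto simp: clique_sum_def\<close>)
qed

definition common_nbhd :: "('a \<Rightarrow> 'a \<Rightarrow> bool) \<Rightarrow> 'a set \<Rightarrow> 'a set \<Rightarrow> 'a set" where
  "common_nbhd A U S = {u\<in>U. \<forall>s\<in>S. A u s}"

context weighted_graph
begin

lemma clique_sum_nonneg: "0 \<le> clique_sum A x j W"
  unfolding clique_sum_def by (intro sum_nonneg prod_nonneg) (use nonneg in auto)

lemma subgraph: "W \<subseteq> U \<Longrightarrow> weighted_graph A x W"
  using sym irr nonneg fin by (unfold_locales) (auto dest: finite_subset)

lemma clique_sum_le: "clique_sum A x j U \<le> sum x U ^ j"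
proof -
  have "\<forall>j. clique_sum A x j W \<le> sum x W ^ j" if "card W = n" "finite W" for W n
    using that
  proof (induction n arbitrary: W rule: less_induct)
    case (less n)
    show ?case
    proof (cases "W = {}")
      case True
      have "cliques_of A j {} = (if j = 0 then {{}} else {})" for j
        by (auto simp: cliques_of_def pairwise_def)
      then show ?thesis using True by (simp add: clique_sum_def)
    next
      case False
      then obtain v V where W: "W = insert v V" "v \<notin> V" by (metis Set.set_insert ex_in_conv)
      have fV: "finite V" and cV: "card V < n" using less.prems W by auto
      have fN: "finite (nbhd A v V)" "nbhd A v V \<subseteq> V" using fV by (auto simp: nbhd_def)
      have cN: "card (nbhd A v V) < n" using cV card_mono[OF fV fN(2)] by simp
      show ?thesis
      proof
        fix j
        show "clique_sum A x j W \<le> sum x W ^ j"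
        proof (cases j)
          case 0 then show ?thesis using less.prems by simp
        next
          case (Suc i)
          have sN: "sum x (nbhd A v V) \<le> sum x V" "0 \<le> sum x (nbhd A v V)"
            using fN fV nonneg by (auto intro: sum_mono2 sum_nonneg)
          have "clique_sum A x j W = clique_sum A x (Suc i) V + x v * clique_sum A x i (nbhd A v V)"
            unfolding W(1) Suc using clique_sum_insert[OF fV W(2) sym] .
          also have "\<dots> \<le> sum x V ^ Suc i + x v * sum x V ^ i"
            using less.IH[OF cV refl fV] less.IH[OF cN refl fN(1)] nonneg[of v]
              power_mono[OF sN, of i]
            by (intro add_mono mult_left_mono) (meson order_trans)+
          also have "\<dots> = (x v + sum x V) * sum x V ^ i" by (simp add: algebra_simps)
          also have "\<dots> \<le> (x v + sum x V) * (x v + sum x V) ^ i"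
            using nonneg sum_nonneg[of V x] by (intro mult_left_mono power_mono) auto
          finally show ?thesis using W fV Suc by simp
        qed
      qed
    qed
  qed
  then show ?thesis using fin by blast
qed

section \<open>The Moon-Moser inequality\<close>

lemma finite_clique: "S \<in> cliques_of A j U \<Longrightarrow> finite S"
  using fin by (auto simp: cliques_of_def dest: finite_subset)

text \<open>
  Both sides run over the pairs of a clique of size \<open>j + 1\<close> and one of its vertices.
\<close>

lemma clique_extension_sum:
  fixes \<phi> :: "'a set \<Rightarrow> 'a \<Rightarrow> real"
  shows "(\<Sum>S\<in>cliques_of A j U. \<Sum>u\<in>common_nbhd A U S. \<phi> S u) = (\<Sum>T\<in>cliques_of A (Suc j) U. \<Sum>v\<in>T. \<phi> (T - {v}) v)"
proof -
  have f1: "finite (common_nbhd A U S)" for S using fin by (simp add: common_nbhd_def)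
  have "(\<Sum>S\<in>cliques_of A j U. \<Sum>u\<in>common_nbhd A U S. \<phi> S u) = (\<Sum>(S,u)\<in>Sigma (cliques_of A j U) (common_nbhd A U). \<phi> S u)"
    using fin f1 by (subst sum.Sigma) auto
  also have "\<dots> = (\<Sum>(T,v)\<in>Sigma (cliques_of A (Suc j) U) (\<lambda>T. T). \<phi> (T - {v}) v)"
  proof (rule sum.reindex_bij_witness[where i = "\<lambda>(T,v). (T - {v}, v)" and j = "\<lambda>(S,u). (insert u S, u)"])
    fix a assume "a \<in> Sigma (cliques_of A j U) (common_nbhd A U)"
    then obtain S u where a: "a = (S,u)" "S \<in> cliques_of A j U" "u \<in> common_nbhd A U S" by auto
    have uS: "u \<notin> S" using a(3) irr by (auto simp: common_nbhd_def)
    show "(case (case a of (S,u) \<Rightarrow> (insert u S, u)) of (T,v) \<Rightarrow> (T - {v}, v)) = a"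
      using a uS by auto
    show "(case a of (S,u) \<Rightarrow> (insert u S, u)) \<in> Sigma (cliques_of A (Suc j) U) (\<lambda>T. T)"
      using a uS finite_clique[OF a(2)] sym by (auto simp: cliques_of_def common_nbhd_def pairwise_def)
    show "(case (case a of (S,u) \<Rightarrow> (insert u S, u)) of (T,v) \<Rightarrow> \<phi> (T - {v}) v) = (case a of (S,u) \<Rightarrow> \<phi> S u)"
      using a uS by auto
  next
    fix b assume "b \<in> Sigma (cliques_of A (Suc j) U) (\<lambda>T. T)"
    then obtain T v where b: "b = (T,v)" "T \<in> cliques_of A (Suc j) U" "v \<in> T" by auto
    show "(case (case b of (T,v) \<Rightarrow> (T - {v}, v)) of (S,u) \<Rightarrow> (insert u S, u)) = b"
      using b by auto
    show "(case b of (T,v) \<Rightarrow> (T - {v}, v)) \<in> Sigma (cliques_of A j U) (common_nbhd A U)"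
      using b finite_clique[OF b(2)] by (auto simp: cliques_of_def common_nbhd_def pairwise_def)
  qed
  also have "\<dots> = (\<Sum>T\<in>cliques_of A (Suc j) U. \<Sum>v\<in>T. \<phi> (T - {v}) v)"
    using fin finite_clique by (subst sum.Sigma) auto
  finally show ?thesis .
qed

lemma clique_sum_codegree_sum:
  "(\<Sum>S\<in>cliques_of A j U. (\<Prod>i\<in>S. x i) * sum x (common_nbhd A U S)) = real (Suc j) * clique_sum A x (Suc j) U"
proof -
  have "(\<Sum>S\<in>cliques_of A j U. (\<Prod>i\<in>S. x i) * sum x (common_nbhd A U S))
      = (\<Sum>S\<in>cliques_of A j U. \<Sum>u\<in>common_nbhd A U S. (\<Prod>i\<in>S. x i) * x u)"
    by (simp add: sum_distrib_left)
  also have "\<dots> = (\<Sum>T\<in>cliques_of A (Suc j) U. \<Sum>v\<in>T. (\<Prod>i\<in>T-{v}. x i) * x v)"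
    by (rule clique_extension_sum)
  also have "\<dots> = (\<Sum>T\<in>cliques_of A (Suc j) U. \<Sum>v\<in>T. (\<Prod>i\<in>T. x i))"
    using finite_clique by (intro sum.cong refl) (simp add: prod.remove mult.commute)
  also have "\<dots> = (\<Sum>T\<in>cliques_of A (Suc j) U. real (Suc j) * (\<Prod>i\<in>T. x i))"
    by (intro sum.cong refl) (auto simp: cliques_of_def)
  finally show ?thesis by (simp add: clique_sum_def sum_distrib_left)
qed

lemma clique_sum_degree_sum:
  "(\<Sum>v\<in>U. x v * clique_sum A x j (nbhd A v U)) = real (Suc j) * clique_sum A x (Suc j) U"
proof -
  have "(\<Sum>v\<in>U. x v * clique_sum A x j (nbhd A v U))
      = (\<Sum>v\<in>U. \<Sum>S\<in>cliques_of A j (nbhd A v U). x v * (\<Prod>i\<in>S. x i))"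
    by (simp add: clique_sum_def sum_distrib_left)
  also have "\<dots> = (\<Sum>(v,S)\<in>Sigma U (\<lambda>v. cliques_of A j (nbhd A v U)). x v * (\<Prod>i\<in>S. x i))"
    using fin by (subst sum.Sigma) (auto simp: nbhd_def)
  also have "\<dots> = (\<Sum>(S,v)\<in>Sigma (cliques_of A j U) (common_nbhd A U). x v * (\<Prod>i\<in>S. x i))"
    by (rule sum.reindex_bij_witness[where i = "\<lambda>(S,v). (v,S)" and j = "\<lambda>(v,S). (S,v)"])
      (auto simp: cliques_of_def nbhd_def common_nbhd_def)
  also have "\<dots> = (\<Sum>S\<in>cliques_of A j U. \<Sum>v\<in>common_nbhd A U S. x v * (\<Prod>i\<in>S. x i))"
    using fin by (subst sum.Sigma) (auto simp: common_nbhd_def)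
  also have "\<dots> = real (Suc j) * clique_sum A x (Suc j) U"
    unfolding clique_sum_codegree_sum[symmetric] by (simp add: sum_distrib_left mult.commute)
  finally show ?thesis .
qed

text \<open>
  By \<open>clique_extension_sum\<close> the left-hand side is a sum over \<open>(j +
  1)\<close>-cliques \<open>T\<close> of the common neighbourhoods of the sets \<open>T -
  {v}\<close>. A vertex adjacent to all of \<open>T\<close> is counted \<open>j + 1\<close> times
  there, any other vertex at most once.
\<close>

lemma codegree_square_sum:
  "(\<Sum>S\<in>cliques_of A j U. (\<Prod>i\<in>S. x i) * (sum x (common_nbhd A U S))\<^sup>2)
     \<le> real j * real (j + 2) * clique_sum A x (j + 2) U + sum x U * clique_sum A x (Suc j) U"
proof -
  have "(\<Sum>S\<in>cliques_of A j U. (\<Prod>i\<in>S. x i) * (sum x (common_nbhd A U S))\<^sup>2)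
      = (\<Sum>S\<in>cliques_of A j U. \<Sum>u\<in>common_nbhd A U S. (\<Prod>i\<in>S. x i) * x u * sum x (common_nbhd A U S))"
    by (simp only: sum_distrib_left[symmetric] sum_distrib_right[symmetric] power2_eq_square mult.assoc)
  also have "\<dots> = (\<Sum>T\<in>cliques_of A (Suc j) U. \<Sum>v\<in>T. (\<Prod>i\<in>T-{v}. x i) * x v * sum x (common_nbhd A U (T-{v})))"
    by (rule clique_extension_sum)
  also have "\<dots> = (\<Sum>T\<in>cliques_of A (Suc j) U. (\<Prod>i\<in>T. x i) * (\<Sum>v\<in>T. sum x (common_nbhd A U (T-{v}))))"
    using finite_clique unfolding sum_distrib_left
    by (intro sum.cong refl) (simp add: prod.remove mult.commute)
  also have "\<dots> \<le> (\<Sum>T\<in>cliques_of A (Suc j) U. (\<Prod>i\<in>T. x i) * (sum x U + real j * sum x (common_nbhd A U T)))"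
  proof (intro sum_mono mult_left_mono)
    fix T assume T: "T \<in> cliques_of A (Suc j) U"
    have fT: "finite T" using finite_clique[OF T] .
    have cT: "card T = Suc j" using T by (simp add: cliques_of_def)
    have "(\<Sum>v\<in>T. sum x (common_nbhd A U (T-{v}))) = (\<Sum>v\<in>T. \<Sum>u\<in>U. if u \<in> common_nbhd A U (T-{v}) then x u else 0)"
      using fin by (intro sum.cong refl sum.mono_neutral_cong_left) (auto simp: common_nbhd_def)
    also have "\<dots> = (\<Sum>u\<in>U. \<Sum>v\<in>T. if u \<in> common_nbhd A U (T-{v}) then x u else 0)"
      by (rule sum.swap)
    also have "\<dots> = (\<Sum>u\<in>U. real (card {v\<in>T. u \<in> common_nbhd A U (T-{v})}) * x u)"
      using fT by (intro sum.cong refl) (simp add: sum.If_cases Collect_conj_eq[symmetric] Int_def)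
    also have "\<dots> \<le> (\<Sum>u\<in>U. x u + real j * (if u \<in> common_nbhd A U T then x u else 0))"
    proof (intro sum_mono)
      fix u assume u: "u \<in> U"
      show "real (card {v\<in>T. u \<in> common_nbhd A U (T-{v})}) * x u \<le> x u + real j * (if u \<in> common_nbhd A U T then x u else 0)"
      proof (cases "u \<in> common_nbhd A U T")
        case True
        have "card {v\<in>T. u \<in> common_nbhd A U (T-{v})} \<le> Suc j"
          unfolding cT[symmetric] using fT by (intro card_mono) auto
        then have "real (card {v\<in>T. u \<in> common_nbhd A U (T-{v})}) * x u \<le> real (Suc j) * x u"
          using nonneg by (intro mult_right_mono) auto
        then show ?thesis using True by (simp add: algebra_simps)
      next
        case False
        then obtain s where s: "s \<in> T" "\<not> A u s" using u by (auto simp: common_nbhd_def)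
        \<comment> \<open>a vertex with a non-neighbour \<open>s\<close> in \<open>T\<close> can be joined to \<open>T - {v}\<close> only for \<open>v = s\<close>\<close>
        have "{v\<in>T. u \<in> common_nbhd A U (T-{v})} \<subseteq> {s}" using s by (auto simp: common_nbhd_def)
        then have "card {v\<in>T. u \<in> common_nbhd A U (T-{v})} \<le> 1"
          using card_mono[of "{s}"] by fastforce
        then have "real (card {v\<in>T. u \<in> common_nbhd A U (T-{v})}) * x u \<le> 1 * x u"
          using nonneg by (intro mult_right_mono) auto
        then show ?thesis using False by simp
      qed
    qed
    also have "\<dots> = sum x U + real j * sum x (common_nbhd A U T)"
    proof -
      have "(\<Sum>u\<in>U. if u \<in> common_nbhd A U T then x u else 0) = sum x (common_nbhd A U T)"
        using fin by (intro sum.mono_neutral_cong_right) (auto simp: common_nbhd_def)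
      then show ?thesis by (simp add: sum.distrib sum_distrib_left[symmetric])
    qed
    finally show "(\<Sum>v\<in>T. sum x (common_nbhd A U (T-{v}))) \<le> sum x U + real j * sum x (common_nbhd A U T)" .
  qed (use nonneg in \<open>auto intro: prod_nonneg\<close>)
  also have "\<dots> = sum x U * clique_sum A x (Suc j) U + real j * (\<Sum>T\<in>cliques_of A (Suc j) U. (\<Prod>i\<in>T. x i) * sum x (common_nbhd A U T))"
    by (simp add: algebra_simps sum.distrib sum_distrib_left clique_sum_def)
  finally show ?thesis unfolding clique_sum_codegree_sum by (simp add: algebra_simps)
qed

text \<open>
  The Cauchy-Schwarz inequality turns the sum of the codegrees of \<open>j\<close>-cliques, which
  counts \<open>(j + 1)\<close>-cliques, into the sum of their squares.
\<close>

lemma moon_moser: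
  "(real (Suc j) * clique_sum A x (Suc j) U)\<^sup>2
     \<le> clique_sum A x j U * (real j * real (j + 2) * clique_sum A x (j + 2) U + sum x U * clique_sum A x (Suc j) U)"
proof -
  let ?C = "cliques_of A j U" and ?m = "\<lambda>S. \<Prod>i\<in>S. x i" and ?c = "\<lambda>S. sum x (common_nbhd A U S)"
  have m: "0 \<le> ?m S" for S using nonneg by (intro prod_nonneg) auto
  have "(real (Suc j) * clique_sum A x (Suc j) U)\<^sup>2 = (\<Sum>S\<in>?C. sqrt (?m S) * (sqrt (?m S) * ?c S))\<^sup>2"
    unfolding clique_sum_codegree_sum[symmetric] using m by (simp add: mult.assoc[symmetric])
  also have "\<dots> \<le> (\<Sum>S\<in>?C. (sqrt (?m S))\<^sup>2) * (\<Sum>S\<in>?C. (sqrt (?m S) * ?c S)\<^sup>2)"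
    by (rule Cauchy_Schwarz_ineq_sum)
  also have "\<dots> = clique_sum A x j U * (\<Sum>S\<in>?C. ?m S * (?c S)\<^sup>2)"
    using m by (simp add: power_mult_distrib clique_sum_def)
  also have "\<dots> \<le> clique_sum A x j U * (real j * real (j + 2) * clique_sum A x (j + 2) U + sum x U * clique_sum A x (Suc j) U)"
    using clique_sum_nonneg codegree_square_sum by (intro mult_left_mono) auto
  finally show ?thesis .
qed

lemma clique_sum_Suc_le: "real (Suc j) * clique_sum A x (Suc j) U \<le> sum x U * clique_sum A x j U"
proof -
  have "(\<Sum>S\<in>cliques_of A j U. (\<Prod>i\<in>S. x i) * sum x (common_nbhd A U S)) \<le> (\<Sum>S\<in>cliques_of A j U. (\<Prod>i\<in>S. x i) * sum x U)"
    using nonneg fin by (intro sum_mono mult_left_mono sum_mono2 prod_nonneg) (auto simp: common_nbhd_def)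
  then show ?thesis
    unfolding clique_sum_codegree_sum by (simp add: clique_sum_def sum_distrib_left mult.commute)
qed

end

section \<open>Turan-type bounds\<close>

text \<open>
  For \<open>d = m y\<close> this is the number of \<open>j\<close>-cliques in the complete graph
  with \<open>m\<close> parts of weight \<open>y\<close>, see \<open>turan_poly_binomial\<close>.
  The formula makes sense for every real part size \<open>y\<close>, which the limit arguments
  below need.
\<close>

definition turan_poly :: "real \<Rightarrow> real \<Rightarrow> nat \<Rightarrow> real" where
  "turan_poly d y j = (\<Prod>i<j. d - real i * y) / fact j"

lemma turan_poly_Suc: "real (Suc j) * turan_poly d y (Suc j) = (d - real j * y) * turan_poly d y j"
  by (simp add: turan_poly_def fact_Suc del: of_nat_Suc)

lemma turan_poly_nonneg:
  assumes "0 \<le> y" "real j * y \<le> d"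
  shows "0 \<le> turan_poly d y j"
proof -
  have "0 \<le> d - real i * y" if "i < j" for i
    using that assms mult_right_mono[of "real i" "real j" y] by auto
  then show ?thesis unfolding turan_poly_def by (intro divide_nonneg_nonneg prod_nonneg) auto
qed

lemma turan_poly_binomial: "turan_poly (real p * u) u j = real (p choose j) * u ^ j"
proof (induction j)
  case (Suc j)
  have "real (Suc j) * real (p choose Suc j) = (real p - real j) * real (p choose j)"
  proof (cases "j \<le> p")
    case True
    have "Suc j * (p choose Suc j) = (p - j) * (p choose j)"
      using binomial_absorb_comp[of p j] by (metis Suc_times_binomial_add True binomial_absorption binomial_symmetric mult.commute times_binomial_minus1_eq)
    then show ?thesis using True by (metis of_nat_diff of_nat_mult)
  qed (simp add: binomial_eq_0)
  then have e: "real (Suc j) * (real (p choose Suc j) * u ^ Suc j) = (real p - real j) * real (p choose j) * u ^ Suc j"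
    by simp
  have "real (Suc j) * turan_poly (real p * u) u (Suc j) = (real p * u - real j * u) * (real (p choose j) * u ^ j)"
    unfolding turan_poly_Suc Suc.IH ..
  also have "\<dots> = real (Suc j) * (real (p choose Suc j) * u ^ Suc j)"
    unfolding e by (simp add: algebra_simps)
  finally show ?case by simp
qed (simp add: turan_poly_def)

context weighted_graph
begin

abbreviation "K j \<equiv> clique_sum A x j U"
abbreviation "d \<equiv> sum x U"

lemma K_pos_antimono: "0 < K (Suc j) \<Longrightarrow> 0 < K j"
  using clique_sum_Suc_le[of j] clique_sum_nonneg[of j U] by (cases "K j = 0") (auto simp: mult_less_0_iff zero_less_mult_iff not_less[symmetric])

text \<open>
  The Moon-Moser inequality in terms of virtual part sizes: if \<open>y\<^sub>j\<close> is defined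
  by \<open>(j + 1) K\<^sub>j\<^sub>+\<^sub>1 = (d - j y\<^sub>j) K\<^sub>j\<close>, as for parts
  of equal weight \<open>y\<^sub>j\<close>, then \<open>y\<^sub>j\<close> does not increase with
  \<open>j\<close>.
\<close>

lemma mm_ratio:
  "real j * K j * ((d - real (Suc j) * y) * K (Suc j) - real (j + 2) * K (j + 2))
     \<le> K (Suc j) * (real (Suc j) * (K j * (d - real j * y) - real (Suc j) * K (Suc j)))"
  using moon_moser[of j] by (simp add: power2_eq_square algebra_simps)

lemma mm_down:
  assumes "0 < K (Suc j)" "real (j + 2) * K (j + 2) \<le> (d - real (Suc j) * y) * K (Suc j)"
  shows "real (Suc j) * K (Suc j) \<le> (d - real j * y) * K j"
proof -
  have "0 \<le> K (Suc j) * (real (Suc j) * (K j * (d - real j * y) - real (Suc j) * K (Suc j)))"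
    using mm_ratio[of j y] assms clique_sum_nonneg[of j U]
    by (meson diff_ge_0_iff_ge mult_nonneg_nonneg of_nat_0_le_iff order_trans)
  then show ?thesis using assms(1) by (simp add: zero_le_mult_iff mult.commute)
qed

lemma mm_down_strict:
  assumes "0 < j" "0 < K (Suc j)" "real (j + 2) * K (j + 2) < (d - real (Suc j) * y) * K (Suc j)"
  shows "real (Suc j) * K (Suc j) < (d - real j * y) * K j"
proof -
  have "0 < real j * K j * ((d - real (Suc j) * y) * K (Suc j) - real (j + 2) * K (j + 2))"
    using assms K_pos_antimono by (intro mult_pos_pos) auto
  then have "0 < K (Suc j) * (real (Suc j) * (K j * (d - real j * y) - real (Suc j) * K (Suc j)))"
    using mm_ratio[of j y] by linarith
  then show ?thesis using assms(2) by (simp add: zero_less_mult_iff mult.commute)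
qed

text \<open>
  If the virtual part size is at least \<open>y\<close> at some level, then it is so at all lower
  levels, and the resulting inequalities are multiplied.
\<close>

lemma turan_poly_chain:
  assumes "0 < K j" "real (Suc j) * K (Suc j) \<le> (d - real j * y) * K j"
  shows "K j \<le> turan_poly d y j"
  using assms
proof (induction j)
  case 0
  then show ?case using fin by (simp add: turan_poly_def)
next
  case (Suc j)
  have kj: "0 < K j" using K_pos_antimono Suc.prems(1) .
  have step: "real (Suc j) * K (Suc j) \<le> (d - real j * y) * K j"
    using mm_down Suc.prems by simp
  then have dj: "0 < d - real j * y"
    using Suc.prems(1) kj by (smt (verit) mult_nonpos_nonneg mult_pos_pos of_nat_0_less_iff zero_less_Suc)
  have "real (Suc j) * K (Suc j) \<le> (d - real j * y) * turan_poly d y j"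
    using step mult_left_mono[OF Suc.IH[OF kj step], of "d - real j * y"] dj by linarith
  then show ?case unfolding turan_poly_Suc[symmetric] by simp
qed

lemma turan_poly_down:
  assumes "K (Suc j) \<le> turan_poly d y (Suc j)" "0 \<le> y" "real j * y \<le> d"
  shows "K j \<le> turan_poly d y j"
proof (rule ccontr)
  assume neg: "\<not> K j \<le> turan_poly d y j"
  have t: "0 \<le> turan_poly d y j" using turan_poly_nonneg assms(2,3) .
  then have kj: "0 < K j" using neg by linarith
  have "(d - real j * y) * K j < real (Suc j) * K (Suc j)"
    using turan_poly_chain[OF kj, of y] neg by linarith
  moreover have "(d - real j * y) * turan_poly d y j \<le> (d - real j * y) * K j"
    using neg assms(3) by (intro mult_left_mono) auto
  ultimately show False
    using mult_left_mono[OF assms(1), of "real (Suc j)"] unfolding turan_poly_Suc[symmetric] by linarith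
qed

text \<open>
  If the virtual part size at level \<open>s\<close> exceeded \<open>y\<close>, it would do so at
  all lower levels, and the number of \<open>s\<close>-cliques would be too small.
\<close>

lemma turan_poly_up:
  assumes "2 \<le> s" "turan_poly d y s \<le> K s" "0 \<le> y" "real s * y \<le> d"
  shows "turan_poly d y (Suc s) \<le> K (Suc s)"
proof -
  obtain j where s: "s = j + 2" using assms(1) by (metis add.commute le_Suc_ex)
  have *: "(d - real s * y) * K s \<le> real (Suc s) * K (Suc s)" if ks: "0 < K s"
  proof (rule ccontr)
    assume "\<not> ?thesis"
    then have "real (Suc (Suc j)) * K (Suc (Suc j)) < (d - real (Suc j) * y) * K (Suc j)"
      using ks unfolding s by (intro mm_down_strict) (auto simp: add.commute)
    moreover have kj: "0 < K (Suc j)" using ks K_pos_antimono unfolding s by simp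
    ultimately have "K (Suc j) \<le> turan_poly d y (Suc j)" using turan_poly_chain[of "Suc j" y] by linarith
    moreover have "0 \<le> d - real (Suc j) * y"
      using assms(3,4) mult_right_mono[of "real (Suc j)" "real s" y] s by simp
    ultimately have "(d - real (Suc j) * y) * K (Suc j) \<le> (d - real (Suc j) * y) * turan_poly d y (Suc j)"
      by (intro mult_left_mono)
    with \<open>real (Suc (Suc j)) * K (Suc (Suc j)) < _\<close>
    have "real (Suc (Suc j)) * K (Suc (Suc j)) < real (Suc (Suc j)) * turan_poly d y (Suc (Suc j))"
      unfolding turan_poly_Suc by linarith
    then have "K s < turan_poly d y s"
      unfolding s by (simp del: of_nat_Suc)
    then show False using assms(2) by simp
  qed
  have nn: "0 \<le> d - real s * y" using assms(4) by simp
  show ?thesis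
  proof (cases "0 < K s")
    case True
    have "real (Suc s) * turan_poly d y (Suc s) \<le> (d - real s * y) * K s"
      unfolding turan_poly_Suc using assms(2) nn by (intro mult_left_mono)
    also have "\<dots> \<le> real (Suc s) * K (Suc s)" using * True by blast
    finally show ?thesis by simp
  next
    case False
    then have "turan_poly d y s \<le> 0" using assms(2) by linarith
    then have "real (Suc s) * turan_poly d y (Suc s) \<le> 0" unfolding turan_poly_Suc using nn by (simp add: mult_nonneg_nonpos)
    then show ?thesis using clique_sum_nonneg[of "Suc s" U] by (simp add: mult_le_0_iff)
  qed
qed

lemma turan_poly_up_iter:
  assumes "turan_poly d y 2 \<le> K 2" "2 \<le> s" "0 \<le> y" "real s * y \<le> d"
  shows "turan_poly d y s \<le> K s"
  using assms(2,4)
proof (induction s rule: dec_induct)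
  case base then show ?case using assms(1) by simp
next
  case (step s)
  have "real s * y \<le> real (Suc s) * y" using assms(3) by (intro mult_right_mono) auto
  then show ?case using turan_poly_up[of s y] step assms(3) by simp
qed

end

text \<open>
  The left-hand side is maximal at \<open>t = 1\<close>.
\<close>

lemma power_mult_max:
  fixes t :: real
  assumes "0 \<le> t"
  shows "(real n + 1) * t ^ n - real n * t ^ Suc n \<le> 1"
proof (induction n)
  case 0
  then show ?case by simp
next
  case (Suc n)
  have "0 \<le> (t - 1) * (t ^ Suc n - 1)"
  proof (cases "1 \<le> t")
    case True
    then show ?thesis using one_le_power[of t "Suc n"] by simp
  next
    case False
    then show ?thesis using assms power_le_one[of t "Suc n"]
      by (intro mult_nonpos_nonpos) auto
  qed
  moreover have "t * ((real n + 1) * t ^ n - real n * t ^ Suc n) \<le> t * 1"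
    using Suc.IH assms by (intro mult_left_mono) auto
  ultimately show ?case by (simp add: algebra_simps)
qed

context weighted_graph
begin

text \<open>
  A graph that is at least as dense as \<open>p\<close> equal parts cannot have a small value of
  \<open>K\<^sub>n\<^sub>+\<^sub>1 - L K\<^sub>n\<close>: by the Moon-Moser inequality it is no
  worse than some number of at least \<open>p\<close> equal parts, and among these the functional
  is smallest for \<open>p\<close> parts of weight \<open>X\<close>. The slope \<open>L\<close> is
  chosen so that \<open>X\<close> is the minimiser.
\<close>

lemma dense_link_bound:
  fixes p n :: nat and L :: real
  assumes n: "1 \<le> n" "n < p" and d: "0 < d" and X: "0 < X"
    and lam: "L = X * (real p - real n) / real n"
    and K: "turan_poly d (d / real p) (Suc n) \<le> K (Suc n)"
  shows "real (p choose Suc n) * X ^ Suc n - L * (real (p choose n) * X ^ n) \<le> K (Suc n) - L * K n"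
proof -
  have p: "0 < real p" using n by simp
  have tn: "turan_poly d (d / real p) j = real (p choose j) * (d / real p) ^ j" for j
    using turan_poly_binomial[of p "d / real p" j] p by simp
  have kS: "0 < K (Suc n)"
  proof -
    have "0 < turan_poly d (d / real p) (Suc n)" unfolding tn using n d p by (simp add: Suc_le_eq)
    then show ?thesis using K by linarith
  qed
  have kn: "0 < K n" using kS K_pos_antimono by blast
  \<comment> \<open>\<open>y\<close> is the virtual part size: the ratio \<open>K (Suc n) / K n\<close> is that of parts of size \<open>y\<close>\<close>
  define a where "a = real (Suc n) * K (Suc n) / K n"
  define y where "y = (d - a) / real n"
  have any: "d - real n * y = a" using n by (simp add: y_def)
  have aK: "real (Suc n) * K (Suc n) = a * K n" using kn by (simp add: a_def)
  have a0: "0 < a" using kS kn by (simp add: a_def)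
  have kle: "K n \<le> turan_poly d y n" using turan_poly_chain[OF kn, of y] aK any by simp
  have yle: "y \<le> d / real p"
  proof (rule ccontr)
    assume c: "\<not> ?thesis"
    then have "real n * (d / real p) < real n * y" using n by (intro mult_strict_left_mono) auto
    then have lt: "a < d - real n * (d / real p)" using any by linarith
    have "real (Suc n) * K (Suc n) \<le> (d - real n * (d / real p)) * K n"
      unfolding aK using lt kn by (intro mult_right_mono) auto
    then have "K n \<le> turan_poly d (d / real p) n" using turan_poly_chain[OF kn] by blast
    moreover have nn: "0 \<le> d - real n * (d / real p)" using lt a0 by linarith
    ultimately have "(d - real n * (d / real p)) * K n \<le> real (Suc n) * turan_poly d (d / real p) (Suc n)"
      unfolding turan_poly_Suc by (intro mult_left_mono)
    moreover have "a * K n < (d - real n * (d / real p)) * K n" using lt kn by (intro mult_strict_right_mono)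
    ultimately show False using aK K by (smt (verit) mult_left_mono of_nat_0_le_iff)
  qed
  have pn: "0 < real p - real n" using n by simp
  have ya: "y * (real p - real n) \<le> a"
    using yle p unfolding any[symmetric] by (simp add: field_simps)
  define b where "b = real (p choose n) / (real p - real n) ^ n"
  have b0: "0 \<le> b" using pn by (simp add: b_def)
  have turle: "turan_poly d y n \<le> b * a ^ n"
  proof -
    have "(\<Prod>i<n. d - real i * y) \<le> (\<Prod>i<n. (real p - real i) / (real p - real n) * a)"
    proof (intro prod_mono conjI)
      fix i assume i: "i \<in> {..<n}"
      have e: "d - real i * y = a + (real n - real i) * y" using any by (simp add: algebra_simps)
      have "(real n - real i) * (y * (real p - real n)) \<le> (real n - real i) * a"
        using ya i by (intro mult_left_mono) auto
      then have "(real p - real n) * (d - real i * y) \<le> (real p - real i) * a"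
        unfolding e by (simp add: algebra_simps)
      then show "d - real i * y \<le> (real p - real i) / (real p - real n) * a"
        using pn by (simp add: field_simps)
      show "0 \<le> d - real i * y"
      proof (cases "0 \<le> y")
        case True then show ?thesis using e a0 i by (simp add: add_nonneg_nonneg)
      next
        case False then show ?thesis using d mult_nonneg_nonpos[of "real i" y] by linarith
      qed
    qed
    also have "\<dots> = (\<Prod>i<n. real p - real i) * (a / (real p - real n)) ^ n"
      by (simp add: prod.distrib[symmetric] flip: prod_constant) (simp add: prod_dividef prod.distrib power_divide)
    also have "(\<Prod>i<n. real p - real i) = fact n * real (p choose n)"
      using turan_poly_binomial[of p 1 n] by (simp add: turan_poly_def field_simps)
    finally show ?thesis by (simp add: turan_poly_def b_def field_simps)
  qed
  show ?thesis
  proof (cases "L \<le> a / real (Suc n)")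
    case True
    have "K (Suc n) - L * K n = (a / real (Suc n) - L) * K n"
      using aK by (simp add: field_simps)
    then have "0 \<le> K (Suc n) - L * K n" using True kn by simp
    moreover have "real (p choose Suc n) * X ^ Suc n - L * (real (p choose n) * X ^ n) \<le> 0"
    proof -
      have "real (Suc n) * real (p choose Suc n) = (real p - real n) * real (p choose n)"
        using turan_poly_Suc[of n "real p" 1] turan_poly_binomial[of p 1] by simp
      then have e: "real (p choose Suc n) = (real p - real n) * real (p choose n) / real (Suc n)"
        by (simp add: field_simps)
      have "real (p choose Suc n) * X ^ Suc n - L * (real (p choose n) * X ^ n)
        = real (p choose n) * X ^ Suc n * (real p - real n) * (1 / real (Suc n) - 1 / real n)"
        unfolding e lam using n by (simp add: algebra_simps diff_divide_distrib)
      also have "\<dots> \<le> 0" using X pn n by (intro mult_nonneg_nonpos) (auto simp: field_simps)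
      finally show ?thesis .
    qed
    ultimately show ?thesis by linarith
  next
    case False
    define r where "r = X * (real p - real n)"
    have r: "0 < r" and Lr: "L = r / real n" using X pn lam by (simp_all add: r_def)
    define t where "t = a / r"
    have at: "a = t * r" using r by (simp add: t_def)
    have t0: "0 \<le> t" using a0 r by (simp add: t_def)
    define c where "c = b * r ^ Suc n / (real n * real (Suc n))"
    have c0: "0 \<le> c" using b0 r by (simp add: c_def)
    have "(L - a / real (Suc n)) * K n \<le> (L - a / real (Suc n)) * (b * a ^ n)"
      using False kle turle by (intro mult_left_mono) auto
    also have "\<dots> = c * ((real n + 1) * t ^ n - real n * t ^ Suc n)"
      unfolding c_def Lr at power_mult_distrib using n by (simp add: field_simps)
    also have "\<dots> \<le> c * 1" using power_mult_max[OF t0] c0 by (intro mult_left_mono)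
    also have "c * 1 = L * (real (p choose n) * X ^ n) - real (p choose Suc n) * X ^ Suc n"
    proof -
      have e: "real (p choose Suc n) = (real p - real n) * real (p choose n) / real (Suc n)"
        using turan_poly_Suc[of n "real p" 1] turan_poly_binomial[of p 1] by (simp add: field_simps)
      have "c = real (p choose n) * X ^ Suc n * (real p - real n) / (real n * real (Suc n))"
        using pn by (simp add: c_def b_def r_def power_mult_distrib)
      also have "\<dots> = L * (real (p choose n) * X ^ n) - real (p choose Suc n) * X ^ Suc n"
        unfolding e lam using n by (simp add: field_simps)
      finally show ?thesis by simp
    qed
    finally have "(L - a / real (Suc n)) * K n \<le> L * (real (p choose n) * X ^ n) - real (p choose Suc n) * X ^ Suc n" .
    moreover have "(L - a / real (Suc n)) * K n = L * K n - K (Suc n)"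
      using aK by (simp add: field_simps)
    ultimately show ?thesis by linarith
  qed
qed

end

section \<open>Profiles\<close>

text \<open>
  The number of \<open>j\<close>-cliques in the complete multipartite graph with \<open>q\<close>
  parts of weight \<open>z\<close> and one part of weight \<open>w\<close>.
\<close>

definition profile_count :: "nat \<Rightarrow> nat \<Rightarrow> real \<Rightarrow> real \<Rightarrow> real" where
  "profile_count j q z w = real (q choose j) * z ^ j + (if j = 0 then 0 else real (q choose (j - 1)) * z ^ (j - 1) * w)"

lemma profile_count_Suc: "profile_count (Suc j) q z w = real (q choose Suc j) * z ^ Suc j + real (q choose j) * z ^ j * w"
  by (simp add: profile_count_def)

lemma profile_count_1: "profile_count (Suc 0) q z w = real q * z + w"
  by (simp add: profile_count_def)

lemma profile_count_0_right: "profile_count j q z 0 = real (q choose j) * z ^ j"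
  by (simp add: profile_count_def)

lemma profile_count_same: "profile_count j q z z = real (Suc q choose j) * z ^ j"
  by (cases j) (simp_all add: profile_count_def algebra_simps)

lemma binomial_Suc_real: "real (Suc k) * real (n choose Suc k) = (real n - real k) * real (n choose k)"
  using turan_poly_Suc[of k "real n" 1] turan_poly_binomial[of n 1] by simp

text \<open>
  Along profiles of fixed total weight, the counts for all \<open>j\<close> change proportionally
  to \<open>(w - z)\<close> times the number of \<open>(j - 2)\<close>-cliques in \<open>q -
  1\<close> equal parts. All comparisons between profiles below rest on this common factor.
\<close>

lemma profile_count_deriv:
  "((\<lambda>z. profile_count (Suc (Suc j)) (Suc m) z (S - real (Suc m) * z)) has_real_derivative
      real (Suc m) * (S - real (Suc m) * z - z) * (real (m choose j) * z ^ j)) (at z)"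
proof -
  have e1: "real (Suc (Suc j)) * real (Suc m choose Suc (Suc j)) = real (Suc m) * real (m choose Suc j)"
    by (simp only: of_nat_mult[symmetric] Suc_times_binomial)
  have e2: "real (Suc j) * real (Suc m choose Suc j) = real (Suc m) * real (m choose j)"
    by (simp only: of_nat_mult[symmetric] Suc_times_binomial)
  have e3: "real (Suc m choose Suc j) = real (m choose j) + real (m choose Suc j)" by simp
  let ?w = "S - real (Suc m) * z"
  have "((\<lambda>z. profile_count (Suc (Suc j)) (Suc m) z (S - real (Suc m) * z)) has_real_derivative
      real (Suc m choose Suc (Suc j)) * (real (Suc (Suc j)) * z ^ Suc j)
      + (real (Suc m choose Suc j) * (real (Suc j) * z ^ j) * ?w
         + real (Suc m choose Suc j) * z ^ Suc j * (- real (Suc m)))) (at z)"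
    unfolding profile_count_Suc
    by (auto intro!: derivative_eq_intros simp del: of_nat_Suc binomial_Suc_Suc power_Suc)
  also have "real (Suc m choose Suc (Suc j)) * (real (Suc (Suc j)) * z ^ Suc j)
      + (real (Suc m choose Suc j) * (real (Suc j) * z ^ j) * ?w
         + real (Suc m choose Suc j) * z ^ Suc j * (- real (Suc m)))
    = (real (Suc (Suc j)) * real (Suc m choose Suc (Suc j))) * z ^ Suc j
      + (real (Suc j) * real (Suc m choose Suc j)) * z ^ j * ?w
      - real (Suc m choose Suc j) * z ^ Suc j * real (Suc m)"
    by (simp only: mult_ac)
  also have "\<dots> = real (Suc m) * (?w - z) * (real (m choose j) * z ^ j)"
    unfolding e1 e2 unfolding e3 by (simp add: algebra_simps)
  finally show ?thesis .
qed

lemma profile_count_cont: "continuous_on A (\<lambda>z. profile_count j q z (S - real q * z))"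
  unfolding profile_count_def by (cases j) (auto intro!: continuous_intros)

lemma profile_count_antimono:
  assumes "0 \<le> z1" "z1 \<le> z2" "S - real (Suc m) * z1 \<le> z1"
  shows "profile_count (Suc j) (Suc m) z2 (S - real (Suc m) * z2) \<le> profile_count (Suc j) (Suc m) z1 (S - real (Suc m) * z1)"
proof (cases j)
  case 0
  then show ?thesis by (simp add: profile_count_1)
next
  case (Suc i)
  show ?thesis unfolding Suc
  proof (rule DERIV_nonpos_imp_nonincreasing[OF assms(2)])
    fix t assume t: "z1 \<le> t" "t \<le> z2"
    have "real (Suc m) * z1 \<le> real (Suc m) * t" using t by (intro mult_left_mono) auto
    then have "S - real (Suc m) * t - t \<le> 0" using assms(3) t by linarith
    then have "real (Suc m) * (S - real (Suc m) * t - t) * (real (m choose i) * t ^ i) \<le> 0"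
      using assms(1) t by (intro mult_nonpos_nonneg mult_nonneg_nonpos) auto
    then show "\<exists>y. ((\<lambda>z. profile_count (Suc (Suc i)) (Suc m) z (S - real (Suc m) * z)) has_real_derivative y) (at t) \<and> y \<le> 0"
      using profile_count_deriv by blast
  qed
qed

lemma profile_count_mono_left:
  assumes "0 \<le> z1" "z1 \<le> z2" "z2 \<le> S - real (Suc m) * z2"
  shows "profile_count (Suc j) (Suc m) z1 (S - real (Suc m) * z1) \<le> profile_count (Suc j) (Suc m) z2 (S - real (Suc m) * z2)"
proof (cases j)
  case 0
  then show ?thesis by (simp add: profile_count_1)
next
  case (Suc i)
  show ?thesis unfolding Suc
  proof (rule DERIV_nonneg_imp_nondecreasing[OF assms(2)])
    fix t assume t: "z1 \<le> t" "t \<le> z2"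
    have "real (Suc m) * t \<le> real (Suc m) * z2" using t by (intro mult_left_mono) auto
    then have "0 \<le> S - real (Suc m) * t - t" using assms(3) t by linarith
    then have "0 \<le> real (Suc m) * (S - real (Suc m) * t - t) * (real (m choose i) * t ^ i)"
      using assms(1) t by (intro mult_nonneg_nonneg) auto
    then show "\<exists>y. ((\<lambda>z. profile_count (Suc (Suc i)) (Suc m) z (S - real (Suc m) * z)) has_real_derivative y) (at t) \<and> 0 \<le> y"
      using profile_count_deriv by blast
  qed
qed

text \<open>
  The count is largest when the remainder has the same weight as the other parts.
\<close>

lemma profile_count_le_balanced:
  assumes "1 \<le> q" "0 \<le> u" "0 \<le> X" "real q * u + \<sigma> = real (Suc q) * X"
  shows "profile_count (Suc j) q u \<sigma> \<le> real (Suc q choose Suc j) * X ^ Suc j"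
proof -
  obtain m where m: "q = Suc m" using assms(1) by (cases q) auto
  let ?S = "real (Suc q) * X"
  have s: "\<sigma> = ?S - real (Suc m) * u" using assms(4) m by simp
  have X: "?S - real (Suc m) * X = X" using m by (simp add: algebra_simps)
  have "profile_count (Suc j) (Suc m) u (?S - real (Suc m) * u) \<le> profile_count (Suc j) (Suc m) X (?S - real (Suc m) * X)"
  proof (cases "u \<le> X")
    case True then show ?thesis using profile_count_mono_left[of u X ?S m j] assms X by simp
  next
    case False then show ?thesis using profile_count_antimono[of X u ?S m j] assms X by simp
  qed
  then have "profile_count (Suc j) (Suc m) u \<sigma> \<le> profile_count (Suc j) (Suc m) X X"
    unfolding X s[symmetric] .
  then show ?thesis by (simp only: profile_count_same m)
qed

lemma profile_count_strict_antimono: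
  assumes "0 \<le> z1" "z1 < z2" "S - real (Suc m) * z1 \<le> z1" "j \<le> m"
  shows "profile_count (Suc (Suc j)) (Suc m) z2 (S - real (Suc m) * z2) < profile_count (Suc (Suc j)) (Suc m) z1 (S - real (Suc m) * z1)"
proof (rule DERIV_neg_imp_decreasing_open[OF assms(2)])
  fix t assume t: "z1 < t" "t < z2"
  have "real (Suc m) * z1 \<le> real (Suc m) * t" using t by (intro mult_left_mono) auto
  then have "S - real (Suc m) * t - t < 0" using assms(3) t by linarith
  then have "real (Suc m) * (S - real (Suc m) * t - t) * (real (m choose j) * t ^ j) < 0"
    using assms(1,4) t by (intro mult_neg_pos mult_pos_neg mult_pos_pos) auto
  then show "\<exists>y. ((\<lambda>z. profile_count (Suc (Suc j)) (Suc m) z (S - real (Suc m) * z)) has_real_derivative y) (at t) \<and> y < 0"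
    using profile_count_deriv by blast
qed (rule profile_count_cont)

text \<open>
  The profiles with \<open>q\<close> equal parts interpolate between \<open>q\<close> and \<open>q
  + 1\<close> equal parts of the same total weight.
\<close>

lemma profile_count_ivt:
  assumes "0 < S" "1 \<le> q"
    and "real (q choose s) * (S / real q) ^ s \<le> c" "c \<le> real (Suc q choose s) * (S / real (Suc q)) ^ s"
  obtains z where "S / real (Suc q) \<le> z" "z \<le> S / real q" "profile_count s q z (S - real q * z) = c"
proof -
  have le: "S / real (Suc q) \<le> S / real q" using assms by (intro divide_left_mono) auto
  have z1: "S - real q * (S / real (Suc q)) = S / real (Suc q)"
    by (simp add: field_simps)
  have z2: "S - real q * (S / real q) = 0" using assms by simp
  have v1: "profile_count s q (S / real (Suc q)) (S - real q * (S / real (Suc q))) = real (Suc q choose s) * (S / real (Suc q)) ^ s"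
    unfolding z1 by (rule profile_count_same)
  have v2: "profile_count s q (S / real q) (S - real q * (S / real q)) = real (q choose s) * (S / real q) ^ s"
    unfolding z2 by (rule profile_count_0_right)
  obtain z where "S / real (Suc q) \<le> z" "z \<le> S / real q" "profile_count s q z (S - real q * z) = c"
    using IVT2'[OF assms(3)[folded v2] assms(4)[folded v1] le profile_count_cont] by auto
  then show ?thesis by (rule that)
qed

lemma profile_bounds:
  assumes "1 \<le> q" "S / real (Suc q) \<le> z" "z \<le> S / real q"
  shows "0 \<le> S - real q * z" "S - real q * z \<le> z"
  using assms by (simp_all add: field_simps)

lemma profile_count_exists:
  assumes "0 < S" "2 \<le> s" "0 < c" "c \<le> real (n choose s) * (S / real n) ^ s"
  obtains q z where "s - 1 \<le> q" "q < n" "S / real (Suc q) \<le> z" "z < S / real q" "profile_count s q z (S - real q * z) = c"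
proof -
  let ?P = "\<lambda>m. c \<le> real (m choose s) * (S / real m) ^ s"
  define m where "m = (LEAST m. ?P m)"
  have P: "?P m" unfolding m_def using assms(4) by (rule LeastI)
  have mn: "m \<le> n" unfolding m_def using assms(4) by (rule Least_le)
  have ms: "s \<le> m" using P assms(3) by (rule_tac ccontr) (simp add: binomial_eq_0)
  define q where "q = m - 1"
  have q: "m = Suc q" "1 \<le> q" "s - 1 \<le> q" "q < n" using ms mn assms(2) by (auto simp: q_def)
  have nP: "\<not> ?P q" using q(1) not_less_Least[of q ?P] unfolding m_def[symmetric] by simp
  then obtain z where z: "S / real (Suc q) \<le> z" "z \<le> S / real q" "profile_count s q z (S - real q * z) = c"
    using profile_count_ivt[of S q s c] P assms(1) q by (metis linear)
  have "z \<noteq> S / real q"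
  proof
    assume e: "z = S / real q"
    have z0: "S - real q * (S / real q) = 0" using q by simp
    show False using nP z(3) unfolding e z0 profile_count_0_right by simp
  qed
  then show ?thesis using that[of q z] z q by force
qed

section \<open>Linear functionals along the profiles\<close>

lemma turan_functional_piece:
  fixes k p m :: nat and X z1 z2 L S :: real
  assumes p: "k + 2 \<le> p" "Suc m \<le> p" and X: "0 < X" and S: "S = real p * X"
    and L: "L = X * (real p - real k - 1) / real (Suc k)"
    and z: "0 \<le> z1" "z1 \<le> z2" "S - real (Suc m) * z1 \<le> z1" "real (Suc m) * z2 \<le> S"
  defines "\<phi> \<equiv> \<lambda>z. profile_count (k + 3) (Suc m) z (S - real (Suc m) * z) - L * profile_count (k + 2) (Suc m) z (S - real (Suc m) * z)"
  shows "\<phi> z1 \<le> \<phi> z2"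
proof (rule DERIV_nonneg_imp_nondecreasing[OF z(2)])
  fix t assume t: "z1 \<le> t" "t \<le> z2"
  let ?D = "real (Suc m) * (S - real (Suc m) * t - t) * (real (m choose Suc k) * t ^ Suc k)
     - L * (real (Suc m) * (S - real (Suc m) * t - t) * (real (m choose k) * t ^ k))"
  have der: "(\<phi> has_real_derivative ?D) (at t)"
    using DERIV_diff[OF profile_count_deriv[of "Suc k" m S t] DERIV_cmult[OF profile_count_deriv[of k m S t], of L]]
    unfolding \<phi>_def by (simp add: numeral_3_eq_3)
  have t0: "0 \<le> t" using t z by linarith
  have mt: "real (Suc m) * t \<le> S"
    using z(4) mult_left_mono[OF t(2), of "real (Suc m)"] by linarith
  have neg: "S - real (Suc m) * t - t \<le> 0"
    using z(3) t mult_left_mono[OF t(1), of "real (Suc m)"] by linarith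
  have key: "(real m - real k) * t \<le> X * (real p - real k - 1)"
  proof (cases "k \<le> m")
    case True
    have "(real m - real k) * (real (Suc m) * t) \<le> (real m - real k) * (real p * X)"
      using True mt S by (intro mult_left_mono) auto
    moreover have "(real m - real k) * (real p * X) \<le> (real p - real k - 1) * real (Suc m) * X"
    proof -
      have "(real m - real k) * real p \<le> (real p - real k - 1) * real (Suc m)"
        using mult_left_mono[of "real (Suc m)" "real p" "real k + 1"] p by (simp add: algebra_simps)
      then show ?thesis using X by (simp add: mult_right_mono mult.assoc[symmetric])
    qed
    ultimately have "real (Suc m) * ((real m - real k) * t) \<le> real (Suc m) * (X * (real p - real k - 1))"
      by (simp add: algebra_simps)
    then show ?thesis by (simp del: of_nat_Suc)
  next
    case False
    then have "(real m - real k) * t \<le> 0" using t0 by (intro mult_nonpos_nonneg) auto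
    moreover have "0 \<le> X * (real p - real k - 1)" using X p by simp
    ultimately show ?thesis by linarith
  qed
  have b: "real (m choose Suc k) * t ^ Suc k - L * (real (m choose k) * t ^ k) \<le> 0"
  proof -
    have "real (Suc k) * (real (m choose Suc k) * t ^ Suc k - L * (real (m choose k) * t ^ k))
      = (real (Suc k) * real (m choose Suc k)) * t ^ Suc k - real (Suc k) * L * (real (m choose k) * t ^ k)"
      by (simp only: algebra_simps)
    also have "real (Suc k) * L = X * (real p - real k - 1)" unfolding L by simp
    also have "(real (Suc k) * real (m choose Suc k)) * t ^ Suc k - X * (real p - real k - 1) * (real (m choose k) * t ^ k)
       = real (m choose k) * t ^ k * ((real m - real k) * t - X * (real p - real k - 1))"
      unfolding binomial_Suc_real by (simp add: algebra_simps)
    also have "\<dots> \<le> 0" using key t0 by (intro mult_nonneg_nonpos) auto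
    finally show ?thesis by (simp add: mult_le_0_iff)
  qed
  have "?D = real (Suc m) * (S - real (Suc m) * t - t) * (real (m choose Suc k) * t ^ Suc k - L * (real (m choose k) * t ^ k))"
    by (simp add: algebra_simps)
  also have "\<dots> \<ge> 0" using neg b by (intro mult_nonpos_nonpos mult_nonneg_nonpos) auto
  finally show "\<exists>y. (\<phi> has_real_derivative y) (at t) \<and> 0 \<le> y" using der by blast
qed

text \<open>
  The slope \<open>L\<close> is that of the piece starting at \<open>p\<close> parts
  \<open>X\<close>. It is larger than the slopes of all pieces with fewer parts, so the functional
  decreases through these pieces until \<open>p\<close> equal parts are reached.
\<close>

lemma turan_functional_min:
  fixes k p q :: nat and X z L S :: real
  assumes p: "k + 2 \<le> p" "1 \<le> q" "Suc q \<le> p" and X: "0 < X" and S: "S = real p * X"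
    and L: "L = X * (real p - real k - 1) / real (Suc k)"
    and z: "S / real (Suc q) \<le> z" "z \<le> S / real q"
  shows "real (p choose (k + 3)) * X ^ (k + 3) - L * (real (p choose (k + 2)) * X ^ (k + 2))
     \<le> profile_count (k + 3) q z (S - real q * z) - L * profile_count (k + 2) q z (S - real q * z)"
proof -
  define v where "v = (\<lambda>m. real (m choose (k + 3)) * (S / real m) ^ (k + 3) - L * (real (m choose (k + 2)) * (S / real m) ^ (k + 2)))"
  have S0: "0 < S" using S X p by simp
  have piece: "v (Suc q) \<le> profile_count (k + 3) q z (S - real q * z) - L * profile_count (k + 2) q z (S - real q * z)"
    if q: "1 \<le> q" "q \<le> p" and z: "S / real (Suc q) \<le> z" "z \<le> S / real q" for q z
  proof -
    obtain m where m: "q = Suc m" using q(1) by (cases q) auto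
    have z1: "S - real q * (S / real (Suc q)) = S / real (Suc q)" by (simp add: field_simps)
    have "profile_count (k + 3) q (S / real (Suc q)) (S - real q * (S / real (Suc q))) - L * profile_count (k + 2) q (S / real (Suc q)) (S - real q * (S / real (Suc q)))
      \<le> profile_count (k + 3) q z (S - real q * z) - L * profile_count (k + 2) q z (S - real q * z)"
      unfolding m
      by (rule turan_functional_piece[OF p(1) _ X S L])
        (use q z S0 z1 in \<open>auto simp: m field_simps\<close>)
    then show ?thesis unfolding z1 profile_count_same v_def .
  qed
  have step: "v (Suc n) \<le> v n" if "Suc q \<le> n" "n < p" for n
  proof -
    have le: "S / real (Suc n) \<le> S / real n" using that S0 by (intro divide_left_mono) auto
    have z0: "S - real n * (S / real n) = 0" using that by simp
    show ?thesis using piece[OF _ _ le order_refl] that unfolding z0 profile_count_0_right v_def by simp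
  qed
  have "v p \<le> v (Suc q)" using p(3) step
  proof (induction p rule: dec_induct)
    case (step n)
    then show ?case by (meson Suc_leD Suc_le_lessD less_SucI order.trans order.strict_trans2 lessI)
  qed simp
  also have "v (Suc q) \<le> profile_count (k + 3) q z (S - real q * z) - L * profile_count (k + 2) q z (S - real q * z)"
    using piece p z by simp
  finally show ?thesis using S p by (simp add: v_def)
qed

lemma binomial_ratio: 
  fixes X :: real
  assumes "L = X * (real p - real k - 1) / real (Suc k)" "p = Suc m"
  shows "X * real (m choose Suc k) = L * real (m choose k)"
proof -
  have "real (Suc k) * (X * real (m choose Suc k)) = X * (real (Suc k) * real (m choose Suc k))" by simp
  also have "\<dots> = real (Suc k) * (L * real (m choose k))"
    unfolding binomial_Suc_real assms by simp
  finally show ?thesis by (simp del: of_nat_Suc)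
qed

text \<open>
  The expression is the coefficient of the product of two part weights in the functional for
  \<open>k + 3\<close> against \<open>k + 2\<close>, when the other parts are \<open>M\<close>
  parts of weight \<open>z\<close> and one of weight \<open>\<sigma>\<close>. It vanishes when all
  these parts are equal to \<open>X\<close>, and in general the proof reduces its sign to that of
  \<open>-(z - \<sigma>)\<^sup>2\<close>.
\<close>

lemma second_coefficient_nonpos:
  fixes k M :: nat and z \<sigma> X L :: real
  assumes k: "k \<le> M" and z: "0 \<le> z" and \<sigma>: "0 \<le> \<sigma>" and tot: "real M * z + \<sigma> \<le> real (Suc M) * X"
    and L: "L = X * (real M + 1 - real k) / real (Suc k)"
  shows "real (M choose Suc k) * z ^ Suc k + (\<sigma> - L) * (real (M choose k) * z ^ k)
     - L * \<sigma> * (if k = 0 then 0 else real (M choose (k - 1)) * z ^ (k - 1)) \<le> 0"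
proof (cases k)
  case 0
  then show ?thesis using tot by (simp add: L algebra_simps)
next
  case (Suc i)
  define c where "c = real (M choose i)"
  define r where "r = real M - real i"
  have r: "1 \<le> r" using k Suc by (simp add: r_def)
  have c0: "0 \<le> c" by (simp add: c_def)
  have k0: "0 < real k" using Suc by simp
  have Mr: "real M = r + real k - 1" using Suc by (simp add: r_def)
  have e1: "real k * real (M choose k) = r * c"
    using binomial_Suc_real[of i M] Suc by (simp add: c_def r_def)
  have e2: "real (Suc k) * real (M choose Suc k) = (r - 1) * real (M choose k)"
    using binomial_Suc_real[of k M] Mr by simp
  define T where "T = real M * z + \<sigma>"
  have M1: "0 < real (Suc M)" by simp
  have Lr: "L * real (Suc k) = X * r" unfolding L r_def Suc by simp
  have TL: "T * r \<le> L * real (Suc k) * real (Suc M)"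
    unfolding Lr using mult_right_mono[OF tot, of r] r unfolding T_def by (simp add: mult_ac)
  let ?Q = "real (M choose Suc k) * z\<^sup>2 + \<sigma> * real (M choose k) * z - L * (real (M choose k) * z + \<sigma> * c)"
  have "real k * real (Suc k) * real (Suc M) * ?Q
     = real (Suc M) * (real k * (real (Suc k) * real (M choose Suc k)) * z\<^sup>2 + real (Suc k) * (real k * real (M choose k)) * \<sigma> * z)
       - L * real (Suc k) * real (Suc M) * ((real k * real (M choose k)) * z + real k * \<sigma> * c)"
    by (simp only: algebra_simps)
  also have "\<dots> = real (Suc M) * ((r - 1) * (r * c) * z\<^sup>2 + real (Suc k) * (r * c) * \<sigma> * z)
       - L * real (Suc k) * real (Suc M) * (r * c * z + real k * \<sigma> * c)"
    unfolding e2 e1[symmetric] by (simp only: algebra_simps)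
  also have "\<dots> \<le> real (Suc M) * ((r - 1) * (r * c) * z\<^sup>2 + real (Suc k) * (r * c) * \<sigma> * z)
       - T * r * (r * c * z + real k * \<sigma> * c)"
    using mult_right_mono[OF TL, of "r * c * z + real k * \<sigma> * c"] r c0 z \<sigma> k0 by simp
  also have "\<dots> = - (r * c * real k * (z - \<sigma>)\<^sup>2)"
    unfolding T_def of_nat_Suc Mr by (simp add: power2_eq_square algebra_simps)
  also have "\<dots> \<le> 0" using r c0 k0 by simp
  finally have Q: "?Q \<le> 0" using k0 by (simp add: mult_le_0_iff)
  have "real (M choose Suc k) * z ^ Suc k + (\<sigma> - L) * (real (M choose k) * z ^ k)
     - L * \<sigma> * (if k = 0 then 0 else real (M choose (k - 1)) * z ^ (k - 1)) = z ^ i * ?Q"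
    by (simp add: Suc c_def power2_eq_square algebra_simps)
  also have "\<dots> \<le> 0" using Q z by (simp add: mult_nonneg_nonpos)
  finally show ?thesis .
qed

text \<open>
  The right-hand side is the functional of the complete multipartite graph with \<open>m\<close>
  parts \<open>z\<close>, one part \<open>S - m z\<close> and one part \<open>\<sigma>\<close>. At
  \<open>z = X\<close> the two small parts enter through their sum only, which gives the left-hand
  side; from there on it increases with \<open>z\<close>.
\<close>

lemma join_functional_mono:
  fixes k m p :: nat and X z \<sigma> L S :: real
  assumes km: "k + 1 \<le> m" and p: "p = Suc m" and X: "0 < X"
    and L: "L = X * (real p - real k - 1) / real (Suc k)"
    and S: "S = real p * X - \<sigma>" and \<sigma>: "0 \<le> \<sigma>" and z: "X \<le> z" "real m * z \<le> S"
  shows "real (p choose (k + 3)) * X ^ (k + 3) - L * (real (p choose (k + 2)) * X ^ (k + 2))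
     \<le> profile_count (k + 3) m z (S - real m * z) + (\<sigma> - L) * profile_count (k + 2) m z (S - real m * z)
        - L * \<sigma> * profile_count (k + 1) m z (S - real m * z)"
proof -
  obtain M where m: "m = Suc M" using km by (cases m) auto
  define \<psi> where "\<psi> = (\<lambda>z. profile_count (k + 3) m z (S - real m * z) + (\<sigma> - L) * profile_count (k + 2) m z (S - real m * z)
        - L * \<sigma> * profile_count (k + 1) m z (S - real m * z))"
  have mX: "real m * X \<le> S" using mult_left_mono[OF z(1), of "real m"] z(2) by linarith
  then have \<sigma>X: "\<sigma> \<le> X" using S p by (simp add: algebra_simps)
  have "\<psi> X \<le> \<psi> z"
  proof (rule DERIV_nonneg_imp_nondecreasing[OF z(1)])
    fix t assume t: "X \<le> t" "t \<le> z"
    define e where "e = real m * (S - real m * t - t)"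
    define D where "D = (if k = 0 then 0 else e * (real (M choose (k - 1)) * t ^ (k - 1)))"
    have d3: "((\<lambda>z. profile_count (k + 1) m z (S - real m * z)) has_real_derivative D) (at t)"
    proof (cases k)
      case 0
      then show ?thesis by (simp add: profile_count_1 D_def)
    next
      case (Suc i)
      then show ?thesis using profile_count_deriv[of i M S t] by (simp add: D_def e_def m)
    qed
    have d1: "((\<lambda>z. profile_count (k + 3) m z (S - real m * z)) has_real_derivative e * (real (M choose Suc k) * t ^ Suc k)) (at t)"
      using profile_count_deriv[of "Suc k" M S t] by (simp only: m e_def numeral_3_eq_3 add_Suc_right add_0_right)
    have d2: "((\<lambda>z. profile_count (k + 2) m z (S - real m * z)) has_real_derivative e * (real (M choose k) * t ^ k)) (at t)"
      using profile_count_deriv[of k M S t] by (simp only: m e_def numeral_2_eq_2 add_Suc_right add_0_right)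
    have der: "(\<psi> has_real_derivative e * (real (M choose Suc k) * t ^ Suc k) + (\<sigma> - L) * (e * (real (M choose k) * t ^ k)) - L * \<sigma> * D) (at t)"
      unfolding \<psi>_def by (intro DERIV_add DERIV_diff DERIV_cmult d1 d2 d3)
    have mt: "real m * t \<le> S" using mult_left_mono[OF t(2), of "real m"] z(2) by linarith
    have "real M * t + \<sigma> \<le> real (Suc M) * X"
    proof -
      have "real M * (real m * t) + real m * \<sigma> \<le> real M * S + real m * \<sigma>" using mt by (simp add: mult_left_mono)
      also have "\<dots> = real M * (real p * X) + \<sigma>" unfolding S m by (simp add: algebra_simps)
      also have "\<dots> \<le> real M * (real p * X) + X" using \<sigma>X by simp
      also have "\<dots> = real m * (real (Suc M) * X)" unfolding p m by (simp add: algebra_simps)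
      finally have "real m * (real M * t + \<sigma>) \<le> real m * (real (Suc M) * X)" by (simp add: algebra_simps)
      then show ?thesis unfolding m by (simp del: of_nat_Suc)
    qed
    then have c: "real (M choose Suc k) * t ^ Suc k + (\<sigma> - L) * (real (M choose k) * t ^ k)
     - L * \<sigma> * (if k = 0 then 0 else real (M choose (k - 1)) * t ^ (k - 1)) \<le> 0"
      using km t X \<sigma> by (intro second_coefficient_nonpos) (auto simp: L p m)
    have "S - real m * t - t \<le> 0"
      using mult_left_mono[OF t(1), of "real m"] t(1) \<sigma> unfolding S p by (simp add: algebra_simps)
    then have "e \<le> 0" unfolding e_def by (simp add: mult_nonneg_nonpos)
    then have "0 \<le> e * (real (M choose Suc k) * t ^ Suc k + (\<sigma> - L) * (real (M choose k) * t ^ k)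
     - L * \<sigma> * (if k = 0 then 0 else real (M choose (k - 1)) * t ^ (k - 1)))"
      using c by (rule mult_nonpos_nonpos)
    also have "\<dots> = e * (real (M choose Suc k) * t ^ Suc k) + (\<sigma> - L) * (e * (real (M choose k) * t ^ k)) - L * \<sigma> * D"
      by (simp add: D_def algebra_simps)
    finally show "\<exists>y. (\<psi> has_real_derivative y) (at t) \<and> 0 \<le> y" using der by blast
  qed
  moreover have "\<psi> X = real (p choose (k + 3)) * X ^ (k + 3) - L * (real (p choose (k + 2)) * X ^ (k + 2))"
  proof -
    have w: "S - real m * X = X - \<sigma>" unfolding S p by (simp add: algebra_simps)
    have kpX: "profile_count (Suc j) m X (X - \<sigma>) = real (p choose Suc j) * X ^ Suc j - \<sigma> * (real (m choose j) * X ^ j)" for j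
      unfolding profile_count_Suc p by (simp add: algebra_simps)
    have k3: "profile_count (k + 3) m X (X - \<sigma>) = real (p choose (k + 3)) * X ^ (k + 3) - \<sigma> * (real (m choose (k + 2)) * X ^ (k + 2))"
      using kpX[of "k + 2"] by (simp only: numeral_3_eq_3 numeral_2_eq_2 add_Suc_right add_0_right)
    have k2: "profile_count (k + 2) m X (X - \<sigma>) = real (p choose (k + 2)) * X ^ (k + 2) - \<sigma> * (real (m choose (k + 1)) * X ^ (k + 1))"
      using kpX[of "k + 1"] by (simp only: numeral_2_eq_2 One_nat_def add_Suc_right add_0_right)
    have k1: "profile_count (k + 1) m X (X - \<sigma>) = real (p choose (k + 1)) * X ^ (k + 1) - \<sigma> * (real (m choose k) * X ^ k)"
      using kpX[of k] by (simp only: One_nat_def add_Suc_right add_0_right)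
    have b2: "real (p choose (k + 2)) = real (m choose (k + 1)) + real (m choose (k + 2))"
      and b1: "real (p choose (k + 1)) = real (m choose k) + real (m choose (k + 1))"
      by (simp_all add: p)
    have "\<psi> X - (real (p choose (k + 3)) * X ^ (k + 3) - L * (real (p choose (k + 2)) * X ^ (k + 2)))
      = \<sigma> * (X - \<sigma>) * X ^ k * (X * real (m choose Suc k) - L * real (m choose k))"
      unfolding \<psi>_def w k3 k2 k1 unfolding b2 b1 by (simp add: power_add power2_eq_square algebra_simps)
    also have "\<dots> = 0" using binomial_ratio[OF L p] by simp
    finally show ?thesis by simp
  qed
  ultimately show ?thesis unfolding \<psi>_def by simp
qed

lemma power_mult_max_strict:
  fixes t :: real
  assumes "0 < t" "t < 1" "1 \<le> n" "n < p"
  shows "t ^ n * ((real p - real n) / real n - (real p - 1 - real n) / real (Suc n) * t)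
     < (real p - real n) / real n - (real p - 1 - real n) / real (Suc n)"
proof -
  have n: "0 < real n" using assms by simp
  define b where "b = (real p - 1 - real n) / real (Suc n)"
  have b: "0 \<le> b" using assms by (simp add: b_def)
  have c: "(real p - real n) / real n = b * (real n + 1) / real n + 1 / real n"
  proof -
    have "b * real (Suc n) = real p - 1 - real n" by (simp add: b_def del: of_nat_Suc)
    then have "b * (real n + 1) = real p - 1 - real n" by (simp add: add.commute)
    then have "(real p - real n) / real n = (b * (real n + 1) + 1) / real n" by simp
    then show ?thesis by (simp add: add_divide_distrib)
  qed
  have tn: "t ^ n < 1" using assms by (simp add: power_Suc_less_one power_less_one_iff)
  have "t ^ n * ((real p - real n) / real n - b * t)
     = b / real n * ((real n + 1) * t ^ n - real n * t ^ Suc n) + 1 / real n * t ^ n"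
    unfolding c using n by (simp add: field_simps)
  also have "\<dots> < b / real n * 1 + 1 / real n * 1"
  proof (rule add_le_less_mono)
    show "b / real n * ((real n + 1) * t ^ n - real n * t ^ Suc n) \<le> b / real n * 1"
      using power_mult_max[of t n] assms b n by (intro mult_left_mono) auto
    show "1 / real n * t ^ n < 1 / real n * 1" using tn n by (intro mult_strict_left_mono) auto
  qed
  also have "\<dots> = (real p - real n) / real n - b" unfolding c using n by (simp add: field_simps)
  finally show ?thesis by (simp only: b_def)
qed

text \<open>
  For fixed \<open>z < X\<close> the functional is affine in \<open>w\<close> and exceeds the
  right-hand side for all \<open>w\<close> below \<open>z\<close>.
\<close>

lemma sparse_link_part_size:
  fixes n m p :: nat and X z w L :: real
  assumes n: "1 \<le> n" "n \<le> m" and p: "p = Suc m" and X: "0 < X"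
    and L: "L = X * (real p - real n) / real n"
    and w: "0 \<le> w" "w < z"
    and g: "profile_count (Suc n) m z w - L * profile_count n m z w \<le> real (p choose Suc n) * X ^ Suc n - L * (real (p choose n) * X ^ n)"
  shows "X \<le> z"
proof (rule ccontr)
  assume "\<not> X \<le> z"
  then have zX: "z < X" by simp
  have z0: "0 < z" using w by linarith
  define t where "t = z / X"
  have t: "0 < t" "t < 1" "z = t * X" using z0 zX X by (simp_all add: t_def)
  define \<mu> where "\<mu> = real (p choose Suc n) * X ^ Suc n - L * (real (p choose n) * X ^ n)"
  have n0: "0 < real n" using n by simp
  obtain n' where n': "n = Suc n'" using n by (cases n) auto
  have em: "real (m choose Suc n) = (real p - 1 - real n) / real (Suc n) * real (m choose n)"
    using binomial_Suc_real[of n m] p by (simp add: field_simps)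
  have ep: "real (p choose Suc n) = (real p - real n) / real (Suc n) * real (p choose n)"
    using binomial_Suc_real[of n p] by (simp add: field_simps)
  \<comment> \<open>for fixed \<open>z\<close> the functional is affine in \<open>w\<close>; its values at \<open>w = 0\<close> and \<open>w = z\<close> are both at least \<open>\<mu>\<close>, the first one strictly\<close>
  define g0 where "g0 = real (m choose Suc n) * z ^ Suc n - L * (real (m choose n) * z ^ n)"
  define g1 where "g1 = real (p choose Suc n) * z ^ Suc n - L * (real (p choose n) * z ^ n)"
  have \<mu>0: "\<mu> = real (m choose Suc n) * X ^ Suc n - L * (real (m choose n) * X ^ n)"
  proof -
    have "X * real (m choose n) = L * real (m choose n')"
      using binomial_ratio[of L X p n' m] L p n' by simp
    then show ?thesis unfolding \<mu>_def p n' by (simp add: algebra_simps)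
  qed
  have g0: "\<mu> < g0"
  proof -
    have "g0 - \<mu> = real (m choose n) * X ^ Suc n * (((real p - real n) / real n - (real p - 1 - real n) / real (Suc n))
       - t ^ n * ((real p - real n) / real n - (real p - 1 - real n) / real (Suc n) * t))"
      unfolding g0_def \<mu>0 em L t(3) by (simp add: power_mult_distrib algebra_simps)
    also have "\<dots> > 0"
      using power_mult_max_strict[of t n p] t n p X by (intro mult_pos_pos) auto
    finally show ?thesis by simp
  qed
  have g1: "\<mu> \<le> g1"
  proof -
    have "g1 - \<mu> = real (p choose n) * X ^ Suc n * (real p - real n) / (real n * real (Suc n))
        * (1 - ((real n + 1) * t ^ n - real n * t ^ Suc n))"
    proof -
      define A where "A = real (p choose n) * X ^ Suc n * (real p - real n)"
      have "g1 = A * (t ^ Suc n / real (Suc n) - t ^ n / real n)"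
        unfolding g1_def ep L t(3) A_def by (simp add: power_mult_distrib algebra_simps diff_divide_distrib)
      moreover have "\<mu> = A * (1 / real (Suc n) - 1 / real n)"
        unfolding \<mu>_def ep L A_def by (simp add: algebra_simps diff_divide_distrib)
      moreover have "(t ^ Suc n / real (Suc n) - t ^ n / real n) - (1 / real (Suc n) - 1 / real n)
        = (1 - ((real n + 1) * t ^ n - real n * t ^ Suc n)) / (real n * real (Suc n))"
      proof -
        have "(t ^ Suc n / real (Suc n) - t ^ n / real n) - (1 / real (Suc n) - 1 / real n)
          = (real n * t ^ Suc n - real (Suc n) * t ^ n - real n + real (Suc n)) / (real n * real (Suc n))"
          using n0 by (simp add: diff_divide_distrib add_divide_distrib del: of_nat_Suc power_Suc)
        also have "real n * t ^ Suc n - real (Suc n) * t ^ n - real n + real (Suc n)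
          = 1 - ((real n + 1) * t ^ n - real n * t ^ Suc n)" by (simp add: algebra_simps)
        finally show ?thesis .
      qed
      ultimately have "g1 - \<mu> = A * ((1 - ((real n + 1) * t ^ n - real n * t ^ Suc n)) / (real n * real (Suc n)))"
        by (metis right_diff_distrib)
      then show ?thesis by (simp add: A_def)
    qed
    also have "\<dots> \<ge> 0"
      using power_mult_max[of t n] t n p X by (intro mult_nonneg_nonneg divide_nonneg_nonneg) auto
    finally show ?thesis by simp
  qed
  have "profile_count (Suc n) m z w - L * profile_count n m z w = (1 - w / z) * g0 + w / z * g1"
    unfolding g0_def g1_def n' profile_count_Suc p using z0 by (simp add: field_simps)
  moreover have "(1 - w / z) * \<mu> < (1 - w / z) * g0" using g0 w z0 by (intro mult_strict_left_mono) auto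
  moreover have "w / z * \<mu> \<le> w / z * g1" using g1 w z0 by (intro mult_left_mono) auto
  ultimately have "\<mu> < profile_count (Suc n) m z w - L * profile_count n m z w" by (simp add: algebra_simps)
  then show False using g unfolding \<mu>_def by simp
qed

section \<open>The bound for links\<close>

lemma turan_functional_nonpos:
  assumes "0 \<le> X" "X * (real p - real n) \<le> real (Suc n) * L"
  shows "real (p choose Suc n) * X ^ Suc n - L * (real (p choose n) * X ^ n) \<le> 0"
proof -
  have "real (Suc n) * (real (p choose Suc n) * X ^ Suc n - L * (real (p choose n) * X ^ n))
    = (real (Suc n) * real (p choose Suc n)) * X ^ Suc n - real (Suc n) * L * (real (p choose n) * X ^ n)"
    by (simp only: algebra_simps)
  also have "\<dots> = real (p choose n) * X ^ n * (X * (real p - real n) - real (Suc n) * L)"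
    unfolding binomial_Suc_real by (simp add: algebra_simps)
  also have "\<dots> \<le> 0" using assms by (intro mult_nonneg_nonpos) auto
  finally show ?thesis by (simp add: mult_le_0_iff)
qed

text \<open>
  The statement to be proved by induction on \<open>s\<close> and \<open>q\<close>. The vertices
  are natural numbers so that a new vertex is always available.
\<close>

definition extension_bound :: "nat \<Rightarrow> nat \<Rightarrow> bool" where
  "extension_bound s q \<longleftrightarrow> (\<forall>(A :: nat \<Rightarrow> nat \<Rightarrow> bool) x U z w.
     weighted_graph A x U \<and> 0 \<le> w \<and> w \<le> z \<and> sum x U = real q * z + w \<and> profile_count s q z w \<le> clique_sum A x s U
       \<longrightarrow> profile_count (Suc s) q z w \<le> clique_sum A x (Suc s) U)"

lemma extension_boundD:
  "extension_bound s q \<Longrightarrow> weighted_graph (A :: nat \<Rightarrow> nat \<Rightarrow> bool) x U \<Longrightarrow> 0 \<le> w \<Longrightarrow> w \<le> z \<Longrightarrow> sum x U = real q * z + w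
    \<Longrightarrow> profile_count s q z w \<le> clique_sum A x s U \<Longrightarrow> profile_count (Suc s) q z w \<le> clique_sum A x (Suc s) U"
  unfolding extension_bound_def by blast

text \<open>
  If there were more \<open>s\<close>-cliques, a slightly denser profile would still be within
  reach, and it would force too many \<open>(s + 1)\<close>-cliques.
\<close>

lemma extension_bound_converse:
  fixes A :: "nat \<Rightarrow> nat \<Rightarrow> bool"
  assumes E: "extension_bound s q" and G: "weighted_graph A x U" and s: "1 \<le> s" "s \<le> q"
    and w: "0 \<le> w" "w < z" and d: "sum x U = real q * z + w"
    and K: "clique_sum A x (Suc s) U \<le> profile_count (Suc s) q z w"
  shows "clique_sum A x s U \<le> profile_count s q z w"
proof (rule ccontr)
  assume "\<not> ?thesis"
  then have less: "profile_count s q z w < clique_sum A x s U" by simp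
  obtain j where j: "s = Suc j" using s by (cases s) auto
  obtain m where m: "q = Suc m" using s by (cases q) auto
  define D where "D = sum x U"
  have w_eq: "w = D - real q * z" using d by (simp add: D_def)
  define z0 where "z0 = D / real (Suc q)"
  have z0z: "z0 < z" using d w by (simp add: z0_def D_def field_simps)
  have z00: "0 \<le> z0" using d w by (simp add: z0_def D_def)
  have z0w: "D - real q * z0 = z0" by (simp add: z0_def field_simps)
  have "\<exists>t. z0 \<le> t \<and> t < z \<and> profile_count s q t (D - real q * t) \<le> clique_sum A x s U"
  proof (cases "profile_count s q z0 (D - real q * z0) \<le> clique_sum A x s U")
    case True
    then show ?thesis using z0z by blast
  next
    case False
    have "\<exists>t. z0 \<le> t \<and> t \<le> z \<and> profile_count s q t (D - real q * t) = clique_sum A x s U"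
      by (rule IVT2') (use False less z0z profile_count_cont in \<open>auto simp: w_eq\<close>)
    then obtain t where "z0 \<le> t" "t \<le> z" "profile_count s q t (D - real q * t) = clique_sum A x s U" by blast
    moreover then have "t \<noteq> z" using less by (auto simp: w_eq)
    ultimately show ?thesis by (metis order_le_less order_refl)
  qed
  then obtain t where t: "z0 \<le> t" "t < z" "profile_count s q t (D - real q * t) \<le> clique_sum A x s U" by blast
  have "real q * t \<le> real q * z" "real q * z0 \<le> real q * t" using t by (auto intro: mult_left_mono)
  then have wt: "0 \<le> D - real q * t" "D - real q * t \<le> t" using w w_eq z0w t(1) by linarith+
  have "profile_count (Suc s) q t (D - real q * t) \<le> clique_sum A x (Suc s) U"
    using extension_boundD[OF E G wt _ t(3)] by (simp add: D_def)
  moreover have "profile_count (Suc s) q z (D - real q * z) < profile_count (Suc s) q t (D - real q * t)"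
    unfolding j m using profile_count_strict_antimono[of t z D m j] wt t z00 s unfolding j m by simp
  ultimately show False using K by (simp add: w_eq)
qed

lemma weighted_graph_join_vertex:
  fixes A :: "nat \<Rightarrow> nat \<Rightarrow> bool"
  assumes G: "weighted_graph A x U" and N: "N \<subseteq> U" and \<sigma>: "0 \<le> \<sigma>"
  obtains B y v where "v \<notin> U" "weighted_graph B y (insert v U)" "sum y (insert v U) = sum x U + \<sigma>"
    "\<And>j. clique_sum B y (Suc j) (insert v U) = clique_sum A x (Suc j) U + \<sigma> * clique_sum A x j N"
proof -
  interpret weighted_graph A x U by fact
  obtain v where v: "v \<notin> U" using fin ex_new_if_finite[OF infinite_UNIV_nat] by blast
  define B where "B = (\<lambda>a b. if a = v then b \<in> N else if b = v then a \<in> N else A a b)"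
  define y where "y = x(v := \<sigma>)"
  have vN: "v \<notin> N" using v N by auto
  have GB: "weighted_graph B y (insert v U)"
    using sym irr fin nonneg \<sigma> vN by unfold_locales (auto simp: B_def y_def)
  have same: "clique_sum B y j W = clique_sum A x j W" if "W \<subseteq> U" for j W
    using that v by (intro clique_sum_cong) (auto simp: B_def y_def)
  have nb: "nbhd B v U = N" using N by (auto simp: nbhd_def B_def)
  have "clique_sum B y (Suc j) (insert v U) = clique_sum A x (Suc j) U + \<sigma> * clique_sum A x j N" for j
    using clique_sum_insert[OF fin v, of B y j] weighted_graph.sym[OF GB] same[of U] same[OF N]
    unfolding nb by (simp add: y_def)
  moreover have "sum y (insert v U) = sum x U + \<sigma>"
  proof -
    have "sum y U = sum x U" using v by (intro sum.cong) (auto simp: y_def)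
    then show ?thesis using v fin by (simp add: y_def)
  qed
  ultimately show ?thesis using that v GB by blast
qed

text \<open>
  This is the lower bound for the neighbourhood of a vertex in a nearly worst graph. The
  functional on the right is that of \<open>U\<close> joined with one more vertex of weight
  \<open>\<sigma>\<close>, and the left-hand side is the one of \<open>p\<close> parts
  \<open>X\<close> of the same total weight.
\<close>

lemma link_functional_bound:
  fixes A :: "nat \<Rightarrow> nat \<Rightarrow> bool" and X L \<sigma> :: real
  assumes G: "weighted_graph A x U" and p: "k + 2 \<le> p" and X: "0 < X" and \<sigma>: "0 \<le> \<sigma>"
    and L: "L = X * (real p - real k - 1) / real (Suc k)"
    and d: "sum x U = real p * X - \<sigma>"
    and IHp: "\<And>q. 1 \<le> q \<Longrightarrow> q < p \<Longrightarrow> extension_bound (k + 2) q"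
    and IHk: "1 \<le> k \<Longrightarrow> extension_bound (k + 1) (p - 1)"
    and g: "clique_sum A x (k + 2) U - L * clique_sum A x (k + 1) U
        < real (p choose (k + 2)) * X ^ (k + 2) - L * (real (p choose (k + 1)) * X ^ (k + 1))"
  shows "real (p choose (k + 3)) * X ^ (k + 3) - L * (real (p choose (k + 2)) * X ^ (k + 2))
     \<le> clique_sum A x (k + 3) U - L * clique_sum A x (k + 2) U + \<sigma> * (clique_sum A x (k + 2) U - L * clique_sum A x (k + 1) U)"
proof -
  interpret weighted_graph A x U by fact
  define m where "m = p - 1"
  have pm: "p = Suc m" "k + 1 \<le> m" using p by (auto simp: m_def)
  have L0: "0 \<le> L" using X p by (simp add: L)
  have sk: "real (Suc k) * L = X * (real p - real k - 1)" using L by simp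
  have neg1: "real (p choose (k + 2)) * X ^ (k + 2) - L * (real (p choose (k + 1)) * X ^ (k + 1)) \<le> 0"
    using turan_functional_nonpos[of X p "Suc k" L] X sk L0 by (simp add: algebra_simps)
  have neg2: "real (p choose (k + 3)) * X ^ (k + 3) - L * (real (p choose (k + 2)) * X ^ (k + 2)) \<le> 0"
    using turan_functional_nonpos[of X p "Suc (Suc k)" L] X sk L0 by (simp add: algebra_simps numeral_3_eq_3)
  have d0: "0 < d"
  proof (rule ccontr)
    assume "\<not> 0 < d"
    moreover have "0 \<le> d" using nonneg by (intro sum_nonneg) auto
    ultimately have "d = 0" by linarith
    then have "K (k + 2) = 0" "K (k + 1) = 0"
      using clique_sum_le[of "k + 2"] clique_sum_le[of "k + 1"] clique_sum_nonneg[of _ U] by (auto intro: antisym)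
    then show False using g neg1 by simp
  qed
  have m0: "0 < real m" using pm by simp
  have turm: "turan_poly d (d / real m) j = real (m choose j) * (d / real m) ^ j" for j
    using turan_poly_binomial[of m "d / real m" j] m0 by simp
  have turp: "turan_poly d (d / real p) j = real (p choose j) * (d / real p) ^ j" for j
    using turan_poly_binomial[of p "d / real p" j] pm by simp
  have upper: "K (k + 2) < turan_poly d (d / real p) (k + 2)"
  proof (rule ccontr)
    assume "\<not> ?thesis"
    then have *: "turan_poly d (d / real p) (Suc (Suc k)) \<le> K (Suc (Suc k))" by simp
    have L': "L = X * (real p - real (Suc k)) / real (Suc k)" using L by (simp add: algebra_simps)
    show False using dense_link_bound[of "Suc k" p, OF _ _ d0 X L' *] p g by simp
  qed
  show ?thesis
  proof (cases "K (k + 2) \<le> turan_poly d (d / real m) (k + 2)")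
    case True
    \<comment> \<open>the right-hand side is the functional of \<open>U\<close> joined with a vertex of weight \<open>\<sigma>\<close>; this join has total weight
      \<open>p * X\<close> and no more \<open>(k + 2)\<close>-cliques than \<open>p\<close> parts \<open>X\<close>\<close>
    have "real (k + 1) * (d / real m) \<le> real m * (d / real m)"
      using pm d0 by (intro mult_right_mono) auto
    then have low: "K (k + 1) \<le> turan_poly d (d / real m) (k + 1)"
      using turan_poly_down[of "k + 1" "d / real m"] True d0 m0 by simp
    obtain B y v where v: "v \<notin> U" "weighted_graph B y (insert v U)" "sum y (insert v U) = sum x U + \<sigma>"
      and ins: "\<And>j. clique_sum B y (Suc j) (insert v U) = K (Suc j) + \<sigma> * K j"
      using weighted_graph_join_vertex[OF G order_refl \<sigma>] by metis
    have tot: "sum y (insert v U) = real p * X" using v d by simp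
    have i3: "clique_sum B y (k + 3) (insert v U) = K (k + 3) + \<sigma> * K (k + 2)"
      using ins[of "k + 2"] by (simp add: numeral_3_eq_3)
    have i2: "clique_sum B y (k + 2) (insert v U) = K (k + 2) + \<sigma> * K (k + 1)"
      using ins[of "k + 1"] by simp
    have eq: "K (k + 3) - L * K (k + 2) + \<sigma> * (K (k + 2) - L * K (k + 1))
      = clique_sum B y (k + 3) (insert v U) - L * clique_sum B y (k + 2) (insert v U)"
      unfolding i3 i2 by (simp add: algebra_simps)
    have "K (k + 2) + \<sigma> * K (k + 1) \<le> turan_poly d (d / real m) (k + 2) + \<sigma> * turan_poly d (d / real m) (k + 1)"
      using True low \<sigma> by (intro add_mono mult_left_mono)
    also have "\<dots> = profile_count (Suc (k + 1)) m (d / real m) \<sigma>" unfolding turm profile_count_Suc by simp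
    also have "\<dots> \<le> real (Suc m choose Suc (k + 1)) * X ^ Suc (k + 1)"
      using pm d0 X d m0 by (intro profile_count_le_balanced) auto
    finally have le: "clique_sum B y (k + 2) (insert v U) \<le> real (p choose (k + 2)) * X ^ (k + 2)"
      unfolding i2 pm by simp
    show ?thesis
    proof (cases "0 < clique_sum B y (k + 2) (insert v U)")
      case False
      then have "clique_sum B y (k + 2) (insert v U) = 0" using weighted_graph.clique_sum_nonneg[OF v(2), of "k + 2" "insert v U"] by linarith
      then have "L * clique_sum B y (k + 2) (insert v U) = 0" by (simp only: mult_zero_right)
      moreover have "0 \<le> clique_sum B y (k + 3) (insert v U)" using weighted_graph.clique_sum_nonneg[OF v(2)] .
      ultimately show ?thesis unfolding eq using neg2 by linarith
    next
      case pos: True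
      have S0: "0 < real p * X" using X pm by simp
      obtain q z where qz: "k + 2 - 1 \<le> q" "q < p" "real p * X / real (Suc q) \<le> z" "z < real p * X / real q"
        and kq: "profile_count (k + 2) q z (real p * X - real q * z) = clique_sum B y (k + 2) (insert v U)"
      proof (rule profile_count_exists[OF S0 _ pos])
        show "clique_sum B y (k + 2) (insert v U) \<le> real (p choose (k + 2)) * (real p * X / real p) ^ (k + 2)"
          using le pm by simp
      qed (use that in auto)
      have q1: "1 \<le> q" using qz by simp
      have w: "0 \<le> real p * X - real q * z" "real p * X - real q * z \<le> z"
        using profile_bounds[OF q1 qz(3)] qz(4) by auto
      have "profile_count (Suc (k + 2)) q z (real p * X - real q * z) \<le> clique_sum B y (Suc (k + 2)) (insert v U)"
        using extension_boundD[OF IHp[OF q1 qz(2)] v(2) w] tot kq by simp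
      then have K3: "profile_count (k + 3) q z (real p * X - real q * z) \<le> clique_sum B y (k + 3) (insert v U)"
        by (simp add: numeral_3_eq_3)
      have "real (p choose (k + 3)) * X ^ (k + 3) - L * (real (p choose (k + 2)) * X ^ (k + 2))
        \<le> profile_count (k + 3) q z (real p * X - real q * z) - L * profile_count (k + 2) q z (real p * X - real q * z)"
        using qz q1 by (intro turan_functional_min[OF p _ _ X refl L]) auto
      then show ?thesis unfolding eq using K3 kq by simp
    qed
  next
    case False
    \<comment> \<open>now \<open>U\<close> itself lies in the piece with \<open>m\<close> equal parts, where both induction hypotheses apply\<close>
    obtain z where z: "d / real (Suc m) \<le> z" "z \<le> d / real m" "profile_count (k + 2) m z (d - real m * z) = K (k + 2)"
    proof (rule profile_count_ivt[OF d0])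
      show "1 \<le> m" using pm by simp
      show "real (m choose (k + 2)) * (d / real m) ^ (k + 2) \<le> K (k + 2)" using False unfolding turm by linarith
      show "K (k + 2) \<le> real (Suc m choose (k + 2)) * (d / real (Suc m)) ^ (k + 2)"
        using upper[unfolded turp] unfolding pm(1) by (rule less_imp_le)
    qed (use that in auto)
    define w where "w = d - real m * z"
    have w: "0 \<le> w" "w \<le> z" using profile_bounds[of m d z] z pm unfolding w_def by auto
    have wz: "w < z"
    proof (rule ccontr)
      assume "\<not> w < z"
      then have e: "w = z" using w by simp
      then have "d = real p * z" unfolding w_def pm by (simp add: algebra_simps)
      then have zp: "z = d / real p" using pm by simp
      have "K (k + 2) = real (p choose (k + 2)) * z ^ (k + 2)"
        using z(3) unfolding w_def[symmetric] e profile_count_same pm(1) by linarith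
      then have "K (k + 2) = turan_poly d (d / real p) (k + 2)" unfolding turp zp by linarith
      then show False using upper by simp
    qed
    have dz: "d = real m * z + w" by (simp add: w_def)
    have k2: "profile_count (k + 2) m z w = K (k + 2)" using z(3) by (simp add: w_def)
    have m1: "1 \<le> m" "m < p" using pm by auto
    have "profile_count (Suc (k + 2)) m z w \<le> K (Suc (k + 2))"
      using extension_boundD[OF IHp[OF m1] G w dz] k2 by simp
    then have k3: "profile_count (k + 3) m z w \<le> K (k + 3)" by (simp add: numeral_3_eq_3)
    have k1: "K (k + 1) \<le> profile_count (k + 1) m z w"
    proof (cases "k = 0")
      case True
      then show ?thesis using dz by (simp add: clique_sum_1 profile_count_1)
    next
      case False
      then have "extension_bound (k + 1) m" using IHk unfolding m_def by simp
      then show ?thesis using extension_bound_converse[OF _ G _ _ w(1) wz dz] k2 pm by simp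
    qed
    have L': "L = X * (real p - real (Suc k)) / real (Suc k)" using L by (simp add: algebra_simps)
    have "L * K (k + 1) \<le> L * profile_count (k + 1) m z w" using k1 L0 by (rule mult_left_mono)
    then have "profile_count (Suc (k + 1)) m z w - L * profile_count (k + 1) m z w
      \<le> real (p choose Suc (k + 1)) * X ^ Suc (k + 1) - L * (real (p choose (k + 1)) * X ^ (k + 1))"
      using g k2 by simp
    then have Xz: "X \<le> z"
      using sparse_link_part_size[of "k + 1" m p X L w z] pm X L' w wz by simp
    have mz: "real m * z \<le> d" using w dz by simp
    have "real (p choose (k + 3)) * X ^ (k + 3) - L * (real (p choose (k + 2)) * X ^ (k + 2))
       \<le> profile_count (k + 3) m z w + (\<sigma> - L) * profile_count (k + 2) m z w - L * \<sigma> * profile_count (k + 1) m z w"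
      using join_functional_mono[OF pm(2,1) X L d \<sigma> Xz mz] unfolding w_def .
    also have "\<dots> \<le> K (k + 3) + (\<sigma> - L) * K (k + 2) - L * \<sigma> * K (k + 1)"
      using k3 k2 mult_left_mono[OF k1, of "L * \<sigma>"] L0 \<sigma> by simp
    finally show ?thesis by (simp add: algebra_simps)
  qed
qed

section \<open>Perturbations of a normalised graph\<close>

lemma profile_count_homogeneous: "profile_count j q (c * z) (c * w) = c ^ j * profile_count j q z w"
  by (cases j) (simp_all add: profile_count_def power_mult_distrib algebra_simps)

lemma (in weighted_graph) weighted_graph_scale: "0 \<le> c \<Longrightarrow> weighted_graph A (\<lambda>u. c * x u) W" if "finite W"
  using that sym irr nonneg by unfold_locales auto

text \<open>
  All weights shrink by the factor \<open>1 - \<tau>\<close> to make room for a new vertex of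
  weight \<open>\<tau>\<close> with neighbourhood \<open>N\<close>.
\<close>

lemma perturbed_graph:
  fixes A :: "nat \<Rightarrow> nat \<Rightarrow> bool"
  assumes G: "weighted_graph A x U" "sum x U = 1" and N: "N \<subseteq> U" and \<tau>: "0 \<le> \<tau>" "\<tau> \<le> 1"
  obtains B :: "nat \<Rightarrow> nat \<Rightarrow> bool" and y W where "weighted_graph B y W" "sum y W = 1"
    "\<And>j. clique_sum B y (Suc j) W = (1 - \<tau>) ^ Suc j * clique_sum A x (Suc j) U + \<tau> * ((1 - \<tau>) ^ j * clique_sum A x j N)"
proof -
  interpret weighted_graph A x U by fact
  have G': "weighted_graph A (\<lambda>u. (1 - \<tau>) * x u) U" using weighted_graph_scale[OF fin, of "1 - \<tau>"] \<tau> by simp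
  obtain B y v where B: "weighted_graph B y (insert v U)" "sum y (insert v U) = (\<Sum>u\<in>U. (1 - \<tau>) * x u) + \<tau>"
    "\<And>j. clique_sum B y (Suc j) (insert v U) = clique_sum A (\<lambda>u. (1 - \<tau>) * x u) (Suc j) U + \<tau> * clique_sum A (\<lambda>u. (1 - \<tau>) * x u) j N"
    using weighted_graph_join_vertex[OF G' N \<tau>(1)] by metis
  have fN: "finite N" using N fin finite_subset by blast
  show ?thesis
  proof (rule that[OF B(1)])
    show "sum y (insert v U) = 1" unfolding B(2) sum_distrib_left[symmetric] using G(2) by simp
    show "clique_sum B y (Suc j) (insert v U) = (1 - \<tau>) ^ Suc j * clique_sum A x (Suc j) U + \<tau> * ((1 - \<tau>) ^ j * clique_sum A x j N)" for j
      unfolding B(3) clique_sum_scale[OF fin] clique_sum_scale[OF fN] ..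
  qed
qed

text \<open>
  The \<open>p\<close>-th piece of the extremal curve, for total weight 1. The parameter
  \<open>t\<close> runs from \<open>1 / (p + 1)\<close>, where all \<open>p + 1\<close> parts are
  equal, to \<open>1 / p\<close>, where the last part vanishes.
\<close>

definition profile_curve :: "nat \<Rightarrow> nat \<Rightarrow> real \<Rightarrow> real" where
  "profile_curve p j t = profile_count j p t (1 - real p * t)"

text \<open>
  Only graphs of total weight 1 that have exactly as many \<open>s\<close>-cliques as the profile
  need to be considered.
\<close>

lemma extension_bound_from_normalized:
  assumes p: "2 \<le> s" "s \<le> p"
    and N: "\<And>(A :: nat \<Rightarrow> nat \<Rightarrow> bool) x U t. weighted_graph A x U \<Longrightarrow> sum x U = 1 \<Longrightarrow> 1 / real (Suc p) \<le> t \<Longrightarrow> t \<le> 1 / real p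
        \<Longrightarrow> clique_sum A x s U = profile_curve p s t \<Longrightarrow> profile_curve p (Suc s) t \<le> clique_sum A x (Suc s) U"
  shows "extension_bound s p"
  unfolding extension_bound_def
proof (intro allI impI, elim conjE)
  fix A :: "nat \<Rightarrow> nat \<Rightarrow> bool" and x U and z w :: real
  assume G: "weighted_graph A x U" and w: "0 \<le> w" "w \<le> z" and d: "sum x U = real p * z + w"
    and K: "profile_count s p z w \<le> clique_sum A x s U"
  interpret weighted_graph A x U by fact
  have p0: "0 < real p" using p by simp
  show "profile_count (Suc s) p z w \<le> clique_sum A x (Suc s) U"
  proof (cases "z = 0")
    case True
    then show ?thesis using w clique_sum_nonneg by (simp add: profile_count_def)
  next
    case False
    then have z0: "0 < z" using w by linarith
    define S where "S = sum x U"
    have S: "0 < S" "S = real p * z + w" using z0 w d p0 by (auto simp: S_def add_pos_nonneg)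
    have kp0: "0 < profile_count s p z w"
    proof -
      have "0 < real (p choose s) * z ^ s" using z0 p by simp
      moreover have "0 \<le> real (p choose (s - 1)) * z ^ (s - 1) * w" using z0 w by simp
      ultimately show ?thesis using p by (simp add: profile_count_def)
    qed
    then have Ks: "0 < clique_sum A x s U" using K by linarith
    \<comment> \<open>the weights are shrunk by \<open>\<rho>\<close>, which turns the inequality for \<open>s\<close>-cliques into an equality, and an isolated
      vertex takes up the lost weight\<close>
    define c where "c = profile_count s p z w / clique_sum A x s U"
    have c: "0 < c" "c \<le> 1" using kp0 Ks K by (simp_all add: c_def)
    define \<rho> where "\<rho> = root s c"
    have \<rho>: "0 < \<rho>" "\<rho> \<le> 1" "\<rho> ^ s = c" using c p by (simp_all add: \<rho>_def)
    define x' where "x' = (\<lambda>u. 1 / S * x u)"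
    have G': "weighted_graph A x' U" unfolding x'_def using weighted_graph_scale[OF fin, of "1 / S"] S by simp
    have s1: "sum x' U = 1" unfolding x'_def sum_distrib_left[symmetric] using S(1) by (simp add: S_def)
    have e0: "({} :: nat set) \<subseteq> U" by simp
    obtain B :: "nat \<Rightarrow> nat \<Rightarrow> bool" and y W where B: "weighted_graph B y W" "sum y W = 1"
      "\<And>j. clique_sum B y (Suc j) W = (1 - (1 - \<rho>)) ^ Suc j * clique_sum A x' (Suc j) U + (1 - \<rho>) * ((1 - (1 - \<rho>)) ^ j * clique_sum A x' j {})"
      using perturbed_graph[OF G' s1 e0, of "1 - \<rho>"] \<rho> by (metis diff_ge_0_iff_ge diff_le_eq le_add_same_cancel1 less_imp_le add.commute)
    have emp: "clique_sum A x' j {} = 0" if "1 \<le> j" for j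
    proof -
      have "cliques_of A j {} = {}" using that by (auto simp: cliques_of_def)
      then show ?thesis by (simp add: clique_sum_def)
    qed
    have Bj: "clique_sum B y (Suc j) W = (\<rho> / S) ^ Suc j * clique_sum A x (Suc j) U" if "1 \<le> j" for j
    proof -
      have "clique_sum B y (Suc j) W = \<rho> ^ Suc j * clique_sum A x' (Suc j) U"
        unfolding B(3) emp[OF that] by simp
      also have "clique_sum A x' (Suc j) U = (1 / S) ^ Suc j * clique_sum A x (Suc j) U"
        unfolding x'_def by (rule clique_sum_scale[OF fin])
      finally show ?thesis by (simp add: power_divide)
    qed
    define t where "t = z / S"
    have wS: "1 - real p * t = w / S" using S by (simp add: t_def field_simps)
    have profile_curve_eq: "profile_curve p j t = profile_count j p z w / S ^ j" for j
      using profile_count_homogeneous[of j p "1 / S" z w] wS by (simp add: profile_curve_def t_def power_divide)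
    have tI: "1 / real (Suc p) \<le> t" "t \<le> 1 / real p"
      using S w p0 z0 unfolding t_def by (simp_all add: field_simps)
    have Bs: "clique_sum B y s W = profile_curve p s t"
    proof -
      have "clique_sum B y s W = (\<rho> / S) ^ s * clique_sum A x s U" using Bj[of "s - 1"] p by simp
      also have "\<dots> = profile_count s p z w / S ^ s" unfolding power_divide \<rho>(3) using Ks by (simp add: c_def)
      finally show ?thesis using profile_curve_eq by simp
    qed
    have "profile_count (Suc s) p z w / S ^ Suc s \<le> clique_sum B y (Suc s) W"
      using N[OF B(1,2) tI Bs] profile_curve_eq by simp
    also have "\<dots> = \<rho> ^ Suc s * clique_sum A x (Suc s) U / S ^ Suc s" using Bj[of s] p by (simp add: power_divide)
    also have "\<dots> \<le> clique_sum A x (Suc s) U / S ^ Suc s"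
      using S(1) clique_sum_nonneg[of "Suc s" U] power_le_one[of \<rho> "Suc s"] \<rho>
      by (intro divide_right_mono mult_left_le_one_le) auto
    finally show ?thesis using S(1) by (simp add: divide_le_cancel)
  qed
qed

lemma one_minus_power_bounds:
  fixes \<tau> :: real
  assumes "0 \<le> \<tau>" "\<tau> \<le> 1"
  shows "1 - real n * \<tau> \<le> (1 - \<tau>) ^ n" "(1 - \<tau>) ^ n \<le> 1 - real n * \<tau> + (real n)\<^sup>2 * \<tau>\<^sup>2"
proof -
  show "1 - real n * \<tau> \<le> (1 - \<tau>) ^ n"
    using Bernoulli_inequality[of "- \<tau>" n] assms by simp
  show "(1 - \<tau>) ^ n \<le> 1 - real n * \<tau> + (real n)\<^sup>2 * \<tau>\<^sup>2"
  proof (induction n)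
    case (Suc n)
    have "(1 - \<tau>) ^ Suc n \<le> (1 - \<tau>) * (1 - real n * \<tau> + (real n)\<^sup>2 * \<tau>\<^sup>2)"
      using Suc.IH assms by (simp add: mult_left_mono)
    also have "\<dots> = 1 - real (Suc n) * \<tau> + (real (Suc n))\<^sup>2 * \<tau>\<^sup>2 - ((real n + 1) * \<tau>\<^sup>2 + (real n)\<^sup>2 * \<tau> ^ 3)"
      by (simp add: algebra_simps power2_eq_square power3_eq_cube)
    also have "\<dots> \<le> 1 - real (Suc n) * \<tau> + (real (Suc n))\<^sup>2 * \<tau>\<^sup>2"
    proof -
      have "0 \<le> (real n + 1) * \<tau>\<^sup>2 + (real n)\<^sup>2 * \<tau> ^ 3" using assms by (intro add_nonneg_nonneg mult_nonneg_nonneg) auto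
      then show ?thesis by linarith
    qed
    finally show ?case .
  qed simp
qed

context
  fixes k p :: nat
  assumes p: "k + 2 \<le> p"
begin

text \<open>
  The slope of the curve at the parameter \<open>t\<close> is \<open>curve_ratio * t\<close>,
  compare \<open>profile_curve_deriv\<close> and \<open>profile_curve_deriv'\<close>.
\<close>

definition curve_ratio where "curve_ratio = (real p - real k - 1) / real (Suc k)"

definition curve_deriv where "curve_deriv t = real p * (1 - real p * t - t) * (real ((p - 1) choose k) * t ^ k)"

lemma curve_ratio_pos: "0 < curve_ratio" using p by (simp add: curve_ratio_def)

lemma profile_curve_deriv: "(profile_curve p (k + 2) has_real_derivative curve_deriv t) (at t)"
proof -
  obtain m where m: "p = Suc m" using p by (cases p) auto
  show ?thesis using profile_count_deriv[of k m 1 t] unfolding curve_deriv_def profile_curve_def[abs_def] unfolding m by simp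
qed

lemma profile_curve_deriv': "(profile_curve p (k + 3) has_real_derivative curve_ratio * t * curve_deriv t) (at t)"
proof -
  obtain m where m: "p = Suc m" using p by (cases p) auto
  have b: "real (m choose Suc k) = curve_ratio * real (m choose k)"
    using binomial_Suc_real[of k m] unfolding curve_ratio_def unfolding m by (simp add: field_simps)
  have der: "(profile_curve p (k + 3) has_real_derivative real p * (1 - real p * t - t) * (real (m choose Suc k) * t ^ Suc k)) (at t)"
    using profile_count_deriv[of "Suc k" m 1 t] unfolding profile_curve_def[abs_def] unfolding m by (simp add: numeral_3_eq_3)
  have "real p * (1 - real p * t - t) * (real (m choose Suc k) * t ^ Suc k) = curve_ratio * t * curve_deriv t"
    unfolding b curve_deriv_def using m by simp
  then show ?thesis using der by (simp only:)
qed

lemma p_pos: "0 < real p" using p by simp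

lemma curve_deriv_bounds:
  assumes "1 / real (Suc p) + h \<le> t" "0 \<le> h" "t \<le> 1 / real p"
  shows "curve_deriv t \<le> - (real p * (real (Suc p) * h) * (real ((p - 1) choose k) * (1 / real (Suc p)) ^ k))"
    and "\<bar>curve_deriv t\<bar> \<le> real p * real ((p - 1) choose k)"
proof -
  have t0: "1 / real (Suc p) \<le> t" using assms by linarith
  have tn: "0 \<le> t" using t0 by (meson divide_nonneg_nonneg of_nat_0_le_iff order_trans zero_le_one)
  have pt: "real p * t \<le> 1" using assms(3) p_pos by (simp add: field_simps)
  have "1 + real (Suc p) * h \<le> real (Suc p) * t"
    using mult_left_mono[OF assms(1), of "real (Suc p)"] by (simp add: distrib_left)
  then have lo: "real (Suc p) * h \<le> real p * t + t - 1" by (simp add: algebra_simps)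
  have neg: "curve_deriv t = - (real p * (real p * t + t - 1) * (real ((p - 1) choose k) * t ^ k))"
    by (simp add: curve_deriv_def algebra_simps)
  have lo0: "0 \<le> real (Suc p) * h" using assms by simp
  have "real p * (real (Suc p) * h) * (real ((p - 1) choose k) * (1 / real (Suc p)) ^ k)
     \<le> real p * (real p * t + t - 1) * (real ((p - 1) choose k) * t ^ k)"
    using lo t0 lo0 by (intro mult_mono mult_left_mono power_mono) auto
  then show "curve_deriv t \<le> - (real p * (real (Suc p) * h) * (real ((p - 1) choose k) * (1 / real (Suc p)) ^ k))"
    unfolding neg by simp
  have "1 / real p \<le> 1" using p by simp
  then have t1: "t \<le> 1" using assms(3) by linarith
  have "real p * (real p * t + t - 1) * (real ((p - 1) choose k) * t ^ k)
     \<le> real p * 1 * (real ((p - 1) choose k) * 1)"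
    using pt t1 tn lo lo0 power_le_one[OF tn t1, of k] by (intro mult_mono mult_left_mono) auto
  moreover have "0 \<le> real p * (real p * t + t - 1) * (real ((p - 1) choose k) * t ^ k)"
    using lo lo0 tn by (intro mult_nonneg_nonneg) auto
  ultimately show "\<bar>curve_deriv t\<bar> \<le> real p * real ((p - 1) choose k)" unfolding neg by simp
qed

text \<open>
  Away from \<open>1 / (p + 1)\<close> the derivative is bounded away from zero, so that the
  parameter depends on the number of cliques in a Lipschitz way.
\<close>

lemma profile_curve_decrease:
  assumes "1 / real (Suc p) + h \<le> t" "0 \<le> h" "t \<le> t'" "t' \<le> 1 / real p"
  defines "c \<equiv> real p * (real (Suc p) * h) * (real ((p - 1) choose k) * (1 / real (Suc p)) ^ k)"
  shows "c * (t' - t) \<le> profile_curve p (k + 2) t - profile_curve p (k + 2) t'"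
proof -
  have "profile_curve p (k + 2) t' + c * t' \<le> profile_curve p (k + 2) t + c * t"
  proof (rule DERIV_nonpos_imp_nonincreasing[OF assms(3)])
    fix u assume u: "t \<le> u" "u \<le> t'"
    have "((\<lambda>t. profile_curve p (k + 2) t + c * t) has_real_derivative curve_deriv u + c) (at u)"
      by (intro DERIV_add profile_curve_deriv DERIV_cmult_Id)
    moreover have "curve_deriv u + c \<le> 0" using curve_deriv_bounds(1)[of h u] u assms by simp
    ultimately show "\<exists>y. ((\<lambda>t. profile_curve p (k + 2) t + c * t) has_real_derivative y) (at u) \<and> y \<le> 0" by blast
  qed
  then show ?thesis by (simp add: algebra_simps)
qed

text \<open>
  The curve may fall below its tangent, but only by a quadratic term. This is all that the
  first-order analysis of a nearly worst graph requires.
\<close>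

lemma tangent_quadratic:
  assumes "1 / real (Suc p) \<le> t" "t \<le> 1 / real p" "1 / real (Suc p) \<le> t'" "t' \<le> 1 / real p"
  shows "profile_curve p (k + 3) t - curve_ratio * t * profile_curve p (k + 2) t - curve_ratio * (real p * real ((p - 1) choose k)) * (t' - t)\<^sup>2
     \<le> profile_curve p (k + 3) t' - curve_ratio * t * profile_curve p (k + 2) t'"
proof -
  define W where "W = (\<lambda>u. profile_curve p (k + 3) u - curve_ratio * t * profile_curve p (k + 2) u)"
  let ?c = "real p * real ((p - 1) choose k)"
  have der: "(W has_real_derivative curve_ratio * (u - t) * curve_deriv u) (at u)" for u
  proof -
    have "(W has_real_derivative curve_ratio * u * curve_deriv u - curve_ratio * t * curve_deriv u) (at u)"
      unfolding W_def by (intro DERIV_diff profile_curve_deriv' DERIV_cmult profile_curve_deriv)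
    then show ?thesis by (simp add: algebra_simps)
  qed
  have key: "\<bar>curve_ratio * (u - t) * curve_deriv u\<bar> \<le> curve_ratio * \<bar>u - t\<bar> * ?c" if "1 / real (Suc p) \<le> u" "u \<le> 1 / real p" for u
    using curve_deriv_bounds(2)[of 0 u] that curve_ratio_pos by (simp add: abs_mult mult_left_mono)
  have "\<bar>W t' - W t\<bar> \<le> curve_ratio * ?c * (t' - t)\<^sup>2"
  proof (cases "t' = t")
    case False
    have "\<exists>u. (min t t' < u \<and> u < max t t') \<and> \<bar>W t' - W t\<bar> = \<bar>t' - t\<bar> * \<bar>curve_ratio * (u - t) * curve_deriv u\<bar>"
    proof (cases "t < t'")
      case True
      obtain u where "t < u" "u < t'" "W t' - W t = (t' - t) * (curve_ratio * (u - t) * curve_deriv u)"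
        using MVT2[OF True, of W "\<lambda>u. curve_ratio * (u - t) * curve_deriv u"] der by blast
      then show ?thesis using True by (intro exI[of _ u]) (simp add: abs_mult)
    next
      case F: False
      then have lt: "t' < t" using False by simp
      obtain u where "t' < u" "u < t" "W t - W t' = (t - t') * (curve_ratio * (u - t) * curve_deriv u)"
        using MVT2[OF lt, of W "\<lambda>u. curve_ratio * (u - t) * curve_deriv u"] der by blast
      then show ?thesis using lt by (intro exI[of _ u]) (simp add: abs_mult abs_minus_commute)
    qed
    then obtain u where u: "min t t' < u" "u < max t t'" "\<bar>W t' - W t\<bar> = \<bar>t' - t\<bar> * \<bar>curve_ratio * (u - t) * curve_deriv u\<bar>" by blast
    have "1 / real (Suc p) \<le> u" "u \<le> 1 / real p" using u(1,2) assms unfolding min_def max_def by (auto split: if_splits)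
    then have "\<bar>curve_ratio * (u - t) * curve_deriv u\<bar> \<le> curve_ratio * \<bar>u - t\<bar> * ?c" by (rule key)
    also have "\<dots> \<le> curve_ratio * \<bar>t' - t\<bar> * ?c"
      using u curve_ratio_pos by (intro mult_right_mono mult_left_mono) (auto simp: min_def max_def split: if_splits)
    finally have "\<bar>t' - t\<bar> * \<bar>curve_ratio * (u - t) * curve_deriv u\<bar> \<le> \<bar>t' - t\<bar> * (curve_ratio * \<bar>t' - t\<bar> * ?c)"
      by (intro mult_left_mono) auto
    also have "\<dots> = curve_ratio * ?c * \<bar>t' - t\<bar>\<^sup>2" by (simp add: power2_eq_square)
    finally show ?thesis unfolding u(3) by simp
  qed simp
  then show ?thesis unfolding W_def by linarith
qed

end

lemma profile_curve_eq: "1 \<le> j \<Longrightarrow> profile_curve p j t = real (p choose j) * t ^ j + real (p choose (j - 1)) * t ^ (j - 1) * (1 - real p * t)"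
  by (simp add: profile_curve_def profile_count_def)

text \<open>
  Restoring the vertices outside \<open>H\<close> one at a time, each of them adds its weight
  times the functional of its neighbourhood in the current vertex set, which is at least
  \<open>c\<close>.
\<close>

lemma (in weighted_graph) removal_bound:
  assumes H: "H \<subseteq> U" and c: "\<And>S. S \<subseteq> U \<Longrightarrow> c \<le> clique_sum A x (Suc i) S - L * clique_sum A x i S"
  shows "clique_sum A x (Suc (Suc i)) H - L * clique_sum A x (Suc i) H + c * (sum x U - sum x H)
      \<le> clique_sum A x (Suc (Suc i)) U - L * clique_sum A x (Suc i) U"
proof -
  have "clique_sum A x (Suc (Suc i)) H - L * clique_sum A x (Suc i) H + c * sum x R
      \<le> clique_sum A x (Suc (Suc i)) (H \<union> R) - L * clique_sum A x (Suc i) (H \<union> R)"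
    if "finite R" "R \<subseteq> U - H" for R
    using that
  proof (induction R rule: finite_induct)
    case (insert b R)
    have fin': "finite (H \<union> R)" using H fin insert by (auto dest: finite_subset)
    have b: "b \<notin> H \<union> R" using insert by auto
    have sub: "nbhd A b (H \<union> R) \<subseteq> U" using H insert.prems by (auto simp: nbhd_def)
    have "x b * c \<le> x b * (clique_sum A x (Suc i) (nbhd A b (H \<union> R)) - L * clique_sum A x i (nbhd A b (H \<union> R)))"
      using c[OF sub] nonneg by (intro mult_left_mono) auto
    moreover have "clique_sum A x (Suc j) (H \<union> insert b R) = clique_sum A x (Suc j) (H \<union> R) + x b * clique_sum A x j (nbhd A b (H \<union> R))" for j
      using clique_sum_insert[OF fin' b sym] by simp
    ultimately show ?case using insert by (simp add: algebra_simps)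
  qed simp
  from this[of "U - H"] show ?thesis
    using H fin sum_diff[of U H x] by (simp add: Un_absorb1)
qed

lemma (in weighted_graph) exists_below_average:
  assumes "sum x U = 1" "(\<Sum>v\<in>U. x v * h v) \<le> c"
  shows "\<exists>v\<in>U. h v \<le> c"
proof (rule ccontr)
  assume "\<not> ?thesis"
  then have big: "\<And>v. v \<in> U \<Longrightarrow> c < h v" by (simp add: not_le)
  have "(\<Sum>v\<in>U. x v * (h v - c)) = (\<Sum>v\<in>U. x v * h v) - c"
    using assms(1) by (simp add: right_diff_distrib sum_subtractf sum_distrib_right[symmetric])
  then have le: "(\<Sum>v\<in>U. x v * (h v - c)) \<le> 0" using assms(2) by simp
  have nn: "\<And>v. v \<in> U \<Longrightarrow> 0 \<le> x v * (h v - c)" using big nonneg by (simp add: less_imp_le)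
  then have "(\<Sum>v\<in>U. x v * (h v - c)) = 0" using le sum_nonneg[of U] by (meson antisym)
  then have "\<forall>v\<in>U. x v * (h v - c) = 0" using sum_nonneg_eq_0_iff[OF fin, of "\<lambda>v. x v * (h v - c)"] nn by blast
  then have "\<forall>v\<in>U. x v = 0" using big by fastforce
  then show False using assms(1) by simp
qed

lemma turan_poly_strict_antimono:
  assumes "2 \<le> s" "0 \<le> y1" "y1 < y2" "real s * y2 \<le> 1"
  shows "turan_poly 1 y2 s < turan_poly 1 y1 s"
proof -
  have s: "{..<s} = insert 1 ({..<s} - {1})" using assms(1) by auto
  have pos: "0 < 1 - real i * y1" if "i < s" for i
  proof -
    have "real i * y1 \<le> real i * y2" using assms by (intro mult_left_mono) auto
    also have "\<dots> < real s * y2" using that assms by (intro mult_strict_right_mono) auto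
    finally show ?thesis using assms by linarith
  qed
  have nn: "0 \<le> 1 - real i * y2" if "i < s" for i
  proof -
    have "real i * y2 \<le> real s * y2" using that assms by (intro mult_right_mono) auto
    then show ?thesis using assms(4) by linarith
  qed
  have "(\<Prod>i<s. 1 - real i * y2) = (1 - y2) * (\<Prod>i\<in>{..<s} - {1}. 1 - real i * y2)"
    by (subst s, subst prod.insert) auto
  also have "\<dots> \<le> (1 - y2) * (\<Prod>i\<in>{..<s} - {1}. 1 - real i * y1)"
    using nn nn[of 1] assms by (intro mult_left_mono prod_mono) (auto intro!: mult_left_mono)
  also have "\<dots> < (1 - y1) * (\<Prod>i\<in>{..<s} - {1}. 1 - real i * y1)"
    using pos assms by (intro mult_strict_right_mono prod_pos) auto
  also have "\<dots> = (\<Prod>i<s. 1 - real i * y1)"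
    by (subst (2) s, subst prod.insert) auto
  finally show ?thesis unfolding turan_poly_def by (intro divide_strict_right_mono) auto
qed

lemma profile_curve_left: "1 \<le> p \<Longrightarrow> profile_curve p j (1 / real p) = turan_poly 1 (1 / real p) j"
  using turan_poly_binomial[of p "1 / real p" j] by (simp add: profile_curve_def profile_count_0_right)

lemma profile_curve_right: "profile_curve p j (1 / real (Suc p)) = turan_poly 1 (1 / real (Suc p)) j"
proof -
  have "1 - real p * (1 / real (Suc p)) = 1 / real (Suc p)" by (simp add: field_simps)
  then show ?thesis unfolding profile_curve_def
    using turan_poly_binomial[of "Suc p" "1 / real (Suc p)" j] profile_count_same[of j p] by simp
qed

lemma profile_curve_antimono:
  assumes "1 \<le> p" "1 / real (Suc p) \<le> t1" "t1 \<le> t2"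
  shows "profile_curve p (Suc j) t2 \<le> profile_curve p (Suc j) t1"
proof -
  obtain m where m: "p = Suc m" using assms(1) by (cases p) auto
  have "0 \<le> t1" using assms(2) by (meson divide_nonneg_nonneg of_nat_0_le_iff order_trans zero_le_one)
  moreover have "1 - real p * t1 \<le> t1" using assms(2) by (simp add: field_simps)
  ultimately show ?thesis using profile_count_antimono[of t1 t2 1 m j] assms unfolding profile_curve_def m by simp
qed

lemma profile_curve_cont: "isCont (profile_curve p j) t"
proof -
  have "continuous_on UNIV (\<lambda>z. profile_count j p z (1 - real p * z))" by (rule profile_count_cont)
  then show ?thesis unfolding profile_curve_def[abs_def] by (simp add: continuous_on_eq_continuous_at)
qed

lemma turan_poly_cont: "isCont (\<lambda>y. turan_poly 1 y j) y"
  unfolding turan_poly_def by (intro continuous_intros) auto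

lemma isCont_real_nbhd:
  fixes f :: "real \<Rightarrow> real"
  assumes "isCont f a" "0 < e"
  obtains \<delta> where "0 < \<delta>" "\<And>x. \<bar>x - a\<bar> < \<delta> \<Longrightarrow> \<bar>f x - f a\<bar> < e"
proof -
  obtain \<delta> where \<delta>: "0 < \<delta>" "\<forall>x. x \<noteq> a \<and> norm (x - a) < \<delta> \<longrightarrow> norm (f x - f a) < e"
    using assms unfolding isCont_def LIM_eq by blast
  have "\<bar>f x - f a\<bar> < e" if "\<bar>x - a\<bar> < \<delta>" for x
    using \<delta>(2) that assms(2) by (cases "x = a") auto
  then show ?thesis using that \<delta>(1) by blast
qed

text \<open>
  At both ends of the curve the profile is balanced, and there the Moon-Moser bound is sharp. By
  continuity the violation is small near the ends.
\<close>

lemma violation_away_from_ends: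
  assumes p: "2 \<le> s" "s \<le> p" and \<epsilon>: "0 < \<epsilon>"
  obtains \<theta> where "0 < \<theta>"
    "\<And>(A :: nat \<Rightarrow> nat \<Rightarrow> bool) x U t. weighted_graph A x U \<Longrightarrow> sum x U = 1 \<Longrightarrow> 1 / real (Suc p) \<le> t \<Longrightarrow> t \<le> 1 / real p
        \<Longrightarrow> clique_sum A x s U = profile_curve p s t \<Longrightarrow> \<epsilon> \<le> profile_curve p (Suc s) t - clique_sum A x (Suc s) U
        \<Longrightarrow> 1 / real (Suc p) + \<theta> \<le> t \<and> t \<le> 1 / real p - \<theta>"
proof -
  define u0 where "u0 = 1 / real (Suc p)"
  define u1 where "u1 = 1 / real p"
  have u: "0 < u0" "u0 < u1" using p by (simp_all add: u0_def u1_def field_simps)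
  have su: "real s * u1 \<le> 1" using p by (simp add: u1_def)
  obtain \<theta>1 where \<theta>1: "0 < \<theta>1" "\<And>t. \<bar>t - u1\<bar> < \<theta>1 \<Longrightarrow> \<bar>profile_curve p (Suc s) t - profile_curve p (Suc s) u1\<bar> < \<epsilon>"
    using isCont_real_nbhd[OF profile_curve_cont[where p = p and j = "Suc s" and t = u1] \<epsilon>] by blast
  obtain \<theta>y where \<theta>y: "0 < \<theta>y" "\<And>y. \<bar>y - u0\<bar> < \<theta>y \<Longrightarrow> \<bar>turan_poly 1 y (Suc s) - turan_poly 1 u0 (Suc s)\<bar> < \<epsilon>"
    using isCont_real_nbhd[OF turan_poly_cont[where j = "Suc s" and y = u0] \<epsilon>] by blast
  \<comment> \<open>a part size slightly above \<open>u0\<close>, whose Turan bound is already good enough\<close>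
  define y where "y = min u1 (u0 + \<theta>y / 2)"
  have y: "u0 < y" "y \<le> u1" "\<bar>y - u0\<bar> < \<theta>y" using u \<theta>y(1) by (auto simp: y_def min_def)
  have sy: "real s * y \<le> 1"
    using mult_left_mono[OF y(2), of "real s"] su by linarith
  have "0 < turan_poly 1 u0 s - turan_poly 1 y s" using turan_poly_strict_antimono[OF p(1) _ y(1) sy] u by simp
  then obtain \<theta>2 where \<theta>2: "0 < \<theta>2" "\<And>t. \<bar>t - u0\<bar> < \<theta>2 \<Longrightarrow> \<bar>profile_curve p s t - profile_curve p s u0\<bar> < turan_poly 1 u0 s - turan_poly 1 y s"
    using isCont_real_nbhd[OF profile_curve_cont[where p = p and j = s and t = u0]] by blast
  have away: "u0 + min \<theta>1 \<theta>2 \<le> t \<and> t \<le> u1 - min \<theta>1 \<theta>2"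
    if G: "weighted_graph A x U" "sum x U = 1" and t: "u0 \<le> t" "t \<le> u1"
      and K: "clique_sum A x s U = profile_curve p s t" and v: "\<epsilon> \<le> profile_curve p (Suc s) t - clique_sum A x (Suc s) U"
    for A :: "nat \<Rightarrow> nat \<Rightarrow> bool" and x U t
  proof -
    interpret weighted_graph A x U by fact
    obtain s' where s': "s = Suc s'" using p by (cases s) auto
    have "u0 + \<theta>2 \<le> t"
    proof (rule ccontr)
      assume "\<not> ?thesis"
      then have "\<bar>t - u0\<bar> < \<theta>2" using t by auto
      then have "profile_curve p s u0 - profile_curve p s t < turan_poly 1 u0 s - turan_poly 1 y s" using \<theta>2(2) by fastforce
      then have "turan_poly 1 y s \<le> K s" unfolding K u0_def profile_curve_right by simp
      then have "turan_poly 1 y (Suc s) \<le> K (Suc s)" using turan_poly_up[OF p(1), of y] G(2) sy y u by simp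
      moreover have "turan_poly 1 u0 (Suc s) - \<epsilon> < turan_poly 1 y (Suc s)" using \<theta>y(2)[OF y(3)] by linarith
      moreover have "profile_curve p (Suc s) t \<le> turan_poly 1 u0 (Suc s)"
        using profile_curve_antimono[of p u0 t s] t p unfolding u0_def profile_curve_right by simp
      ultimately show False using v by linarith
    qed
    moreover have "t \<le> u1 - \<theta>1"
    proof (rule ccontr)
      assume "\<not> ?thesis"
      then have "\<bar>t - u1\<bar> < \<theta>1" using t by auto
      then have lt: "profile_curve p (Suc s) t < profile_curve p (Suc s) u1 + \<epsilon>" using \<theta>1(2) by fastforce
      have e: "profile_curve p j u1 = turan_poly 1 u1 j" for j unfolding u1_def using p by (intro profile_curve_left) simp
      have "profile_curve p s u1 \<le> profile_curve p s t" using profile_curve_antimono[of p t u1 s'] t p unfolding s' u0_def by simp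
      then have "turan_poly 1 u1 s \<le> K s" unfolding K e .
      then have "turan_poly 1 u1 (Suc s) \<le> K (Suc s)" using turan_poly_up[OF p(1), of u1] G(2) su u by simp
      then show False using lt v unfolding e by linarith
    qed
    ultimately show ?thesis by auto
  qed
  show ?thesis
    by (rule that[of "min \<theta>1 \<theta>2"])
      (use \<theta>1(1) \<theta>2(1) in simp, rule away[unfolded u0_def u1_def])
qed

text \<open>
  Adding a vertex of weight \<open>\<tau>\<close> with neighbourhood \<open>S\<close> raises the
  violation by \<open>\<tau>\<close> times the amount by which the right-hand side falls short of
  the average on the left, up to \<open>O(\<tau>\<^sup>2)\<close>. Within \<open>\<eta>\<close> of
  the largest possible violation \<open>\<epsilon>\<close> this amount cannot exceed
  \<open>\<zeta>\<close>.
\<close>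

lemma near_extremal_first_order:
  fixes k p :: nat and \<epsilon> \<theta> \<zeta> :: real
  assumes p: "k + 2 \<le> p" and \<theta>: "0 < \<theta>" and \<zeta>: "0 < \<zeta>"
    and opt: "\<And>(A :: nat \<Rightarrow> nat \<Rightarrow> bool) x U t. weighted_graph A x U \<Longrightarrow> sum x U = 1 \<Longrightarrow> 1 / real (Suc p) \<le> t \<Longrightarrow> t \<le> 1 / real p
        \<Longrightarrow> clique_sum A x (k + 2) U = profile_curve p (k + 2) t \<Longrightarrow> profile_curve p (k + 3) t - clique_sum A x (k + 3) U \<le> \<epsilon>"
  obtains \<eta> where "0 < \<eta>"
    "\<And>(A :: nat \<Rightarrow> nat \<Rightarrow> bool) x U t S. weighted_graph A x U \<Longrightarrow> sum x U = 1
      \<Longrightarrow> 1 / real (Suc p) + \<theta> \<le> t \<Longrightarrow> t \<le> 1 / real p - \<theta>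
      \<Longrightarrow> clique_sum A x (k + 2) U = profile_curve p (k + 2) t \<Longrightarrow> \<epsilon> - \<eta> < profile_curve p (k + 3) t - clique_sum A x (k + 3) U \<Longrightarrow> S \<subseteq> U
      \<Longrightarrow> real (k + 3) * clique_sum A x (k + 3) U - curve_ratio k p * t * (real (k + 2) * clique_sum A x (k + 2) U) - \<zeta>
           \<le> clique_sum A x (k + 2) S - curve_ratio k p * t * clique_sum A x (k + 1) S"
proof -
  define h where "h = \<theta> / 2"
  have h: "0 < h" using \<theta> by (simp add: h_def)
  define c0 where "c0 = real p * (real (Suc p) * h) * (real ((p - 1) choose k) * (1 / real (Suc p)) ^ k)"
  define c1 where "c1 = curve_ratio k p * (real p * real ((p - 1) choose k))"
  have c0: "0 < c0" using p h by (simp add: c0_def)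
  have c1: "0 \<le> c1" using curve_ratio_pos[OF p] by (simp add: c1_def)
  define C where "C = c1 * (real (k + 2) / c0)\<^sup>2 + ((real (k + 3))\<^sup>2 + curve_ratio k p * real (k + 2))"
  have C: "0 < C" using c1 curve_ratio_pos[OF p] unfolding C_def by (intro add_nonneg_pos add_pos_pos mult_nonneg_nonneg mult_pos_pos) auto
  \<comment> \<open>\<open>\<tau>\<close> is so small that the perturbed count stays on the curve within distance \<open>h\<close> of \<open>t\<close>, and that all
    quadratic errors, which add up to at most \<open>C * \<tau>\<^sup>2\<close>, stay below \<open>\<zeta> * \<tau> / 2\<close>\<close>
  define \<tau> where "\<tau> = min 1 (min (c0 * h / real (k + 2)) (\<zeta> / (2 * C)))"
  have \<tau>: "0 < \<tau>" "\<tau> \<le> 1" "\<tau> \<le> c0 * h / real (k + 2)" "\<tau> \<le> \<zeta> / (2 * C)"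
    using c0 h C \<zeta> by (auto simp: \<tau>_def)
  have \<tau>s: "real (k + 2) * \<tau> \<le> c0 * h"
    using mult_left_mono[OF \<tau>(3), of "real (k + 2)"] by simp
  have \<tau>C: "C * \<tau> \<le> \<zeta> / 2"
    using mult_left_mono[OF \<tau>(4), of C] C by simp
  define \<eta> where "\<eta> = \<zeta> * \<tau> / 2"
  have \<eta>: "0 < \<eta>" using \<zeta> \<tau> by (simp add: \<eta>_def)
  show ?thesis
  proof (rule that[OF \<eta>])
    fix A :: "nat \<Rightarrow> nat \<Rightarrow> bool" and x U t S
    assume G: "weighted_graph A x U" and tot: "sum x U = 1"
      and t: "1 / real (Suc p) + \<theta> \<le> t" "t \<le> 1 / real p - \<theta>"
      and K2: "clique_sum A x (k + 2) U = profile_curve p (k + 2) t"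
      and near: "\<epsilon> - \<eta> < profile_curve p (k + 3) t - clique_sum A x (k + 3) U" and S: "S \<subseteq> U"
    interpret weighted_graph A x U by fact
    define \<Lambda> where "\<Lambda> = curve_ratio k p * t"
    have t0: "0 \<le> t" "t \<le> 1"
    proof -
      show "0 \<le> t" using t(1) \<theta> by (meson add_nonneg_nonneg divide_nonneg_nonneg less_imp_le of_nat_0_le_iff order_trans zero_le_one)
      have "1 / real p \<le> 1" using p by simp
      then show "t \<le> 1" using t(2) \<theta> by linarith
    qed
    have \<Lambda>: "0 \<le> \<Lambda>" "\<Lambda> \<le> curve_ratio k p"
      using t0 curve_ratio_pos[OF p] by (simp_all add: \<Lambda>_def mult_left_le)
    interpret S: weighted_graph A x S using subgraph[OF S] .
    have sS: "sum x S \<le> 1" "0 \<le> sum x S" using tot S fin nonneg sum_mono2[of U S x] by (auto intro: sum_nonneg)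
    have kS: "0 \<le> clique_sum A x j S" "clique_sum A x j S \<le> 1" for j
      using S.clique_sum_nonneg S.clique_sum_le[of j] power_le_one[OF sS(2,1), of j] by (auto intro: order_trans)
    have kU: "0 \<le> K j" "K j \<le> 1" for j
      using clique_sum_nonneg clique_sum_le[of j] tot by auto
    obtain B :: "nat \<Rightarrow> nat \<Rightarrow> bool" and y W where B: "weighted_graph B y W" "sum y W = 1"
      and Bj: "\<And>j. clique_sum B y (Suc j) W = (1 - \<tau>) ^ Suc j * K (Suc j) + \<tau> * ((1 - \<tau>) ^ j * clique_sum A x j S)"
      using perturbed_graph[OF G tot S less_imp_le[OF \<tau>(1)] \<tau>(2)] by metis
    have pw: "1 - real n * \<tau> \<le> (1 - \<tau>) ^ n" "(1 - \<tau>) ^ n \<le> 1 - real n * \<tau> + (real n)\<^sup>2 * \<tau>\<^sup>2"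
      "0 \<le> (1 - \<tau>) ^ n" "(1 - \<tau>) ^ n \<le> 1" for n
      using one_minus_power_bounds[of \<tau> n] \<tau> by (auto intro: power_le_one)
    \<comment> \<open>to first order in \<open>\<tau>\<close>, the count of \<open>j\<close>-cliques changes by \<open>\<tau>\<close> times the number of \<open>j\<close>-cliques at the new vertex minus \<open>j\<close> times the old count\<close>
    have up: "clique_sum B y (k + 3) W \<le> K (k + 3) + \<tau> * (clique_sum A x (k + 2) S - real (k + 3) * K (k + 3)) + (real (k + 3))\<^sup>2 * \<tau>\<^sup>2"
    proof -
      have "clique_sum B y (k + 3) W = (1 - \<tau>) ^ (k + 3) * K (k + 3) + \<tau> * ((1 - \<tau>) ^ (k + 2) * clique_sum A x (k + 2) S)"
        using Bj[of "k + 2"] by (simp add: numeral_3_eq_3)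
      also have "\<dots> \<le> (1 - real (k + 3) * \<tau> + (real (k + 3))\<^sup>2 * \<tau>\<^sup>2) * K (k + 3) + \<tau> * (1 * clique_sum A x (k + 2) S)"
        by (intro add_mono mult_right_mono mult_left_mono pw kU kS less_imp_le[OF \<tau>(1)])
      also have "\<dots> = K (k + 3) + \<tau> * (clique_sum A x (k + 2) S - real (k + 3) * K (k + 3)) + (real (k + 3))\<^sup>2 * \<tau>\<^sup>2 * K (k + 3)"
        by (simp add: algebra_simps)
      also have "(real (k + 3))\<^sup>2 * \<tau>\<^sup>2 * K (k + 3) \<le> (real (k + 3))\<^sup>2 * \<tau>\<^sup>2" using kU by (intro mult_left_le) auto
      finally show ?thesis by simp
    qed
    have B2: "clique_sum B y (k + 2) W = (1 - \<tau>) ^ (k + 2) * K (k + 2) + \<tau> * ((1 - \<tau>) ^ (k + 1) * clique_sum A x (k + 1) S)"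
      using Bj[of "k + 1"] by simp
    have low: "K (k + 2) + \<tau> * (clique_sum A x (k + 1) S - real (k + 2) * K (k + 2)) - real (k + 2) * \<tau>\<^sup>2 \<le> clique_sum B y (k + 2) W"
    proof -
      have "K (k + 2) + \<tau> * (clique_sum A x (k + 1) S - real (k + 2) * K (k + 2)) - real (k + 2) * \<tau>\<^sup>2
         \<le> K (k + 2) + \<tau> * (clique_sum A x (k + 1) S - real (k + 2) * K (k + 2)) - real (k + 1) * \<tau>\<^sup>2 * clique_sum A x (k + 1) S"
      proof -
        have "real (k + 1) * \<tau>\<^sup>2 * clique_sum A x (k + 1) S \<le> real (k + 1) * \<tau>\<^sup>2 * 1"
          using kS by (intro mult_left_mono) auto
        also have "\<dots> \<le> real (k + 2) * \<tau>\<^sup>2" by (simp add: mult_right_mono)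
        finally show ?thesis by simp
      qed
      also have "\<dots> = (1 - real (k + 2) * \<tau>) * K (k + 2) + \<tau> * ((1 - real (k + 1) * \<tau>) * clique_sum A x (k + 1) S)"
        by (simp add: algebra_simps power2_eq_square)
      also have "\<dots> \<le> clique_sum B y (k + 2) W"
        unfolding B2 by (intro add_mono mult_right_mono mult_left_mono pw kU kS less_imp_le[OF \<tau>(1)])
      finally show ?thesis .
    qed
    have change: "\<bar>clique_sum B y (k + 2) W - K (k + 2)\<bar> \<le> real (k + 2) * \<tau>"
    proof -
      have "K (k + 2) - real (k + 2) * \<tau> \<le> (1 - real (k + 2) * \<tau>) * K (k + 2) + 0"
      proof -
        have "real (k + 2) * \<tau> * K (k + 2) \<le> real (k + 2) * \<tau>" using kU \<tau> by (intro mult_left_le) auto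
        then show ?thesis by (simp add: algebra_simps)
      qed
      also have "\<dots> \<le> clique_sum B y (k + 2) W"
        unfolding B2 by (intro add_mono mult_right_mono mult_nonneg_nonneg pw kU kS less_imp_le[OF \<tau>(1)])
      finally have 1: "K (k + 2) - real (k + 2) * \<tau> \<le> clique_sum B y (k + 2) W" .
      have "clique_sum B y (k + 2) W \<le> 1 * K (k + 2) + \<tau> * (1 * 1)"
        unfolding B2 by (intro add_mono mult_right_mono mult_left_mono mult_mono pw kU kS less_imp_le[OF \<tau>(1)] zero_le_one)
      moreover have "1 * \<tau> \<le> real (k + 2) * \<tau>" using \<tau> by (intro mult_right_mono) auto
      ultimately show ?thesis using 1 by linarith
    qed
    \<comment> \<open>the perturbed graph has a parameter \<open>t'\<close> of its own, at distance \<open>O(\<tau>)\<close> from \<open>t\<close>\<close>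
    have int: "1 / real (Suc p) + h \<le> t - h" "t + h \<le> 1 / real p" using t \<theta> by (simp_all add: h_def)
    have dl: "c0 * (b - a) \<le> profile_curve p (k + 2) a - profile_curve p (k + 2) b"
      if "t - h \<le> a" "a \<le> b" "b \<le> t + h" for a b
      using profile_curve_decrease[OF p, of h a b] that int h unfolding c0_def by simp
    have "\<exists>t'. t - h \<le> t' \<and> t' \<le> t + h \<and> profile_curve p (k + 2) t' = clique_sum B y (k + 2) W"
    proof (rule IVT2')
      show "profile_curve p (k + 2) (t + h) \<le> clique_sum B y (k + 2) W"
        using dl[of t "t + h"] h change \<tau>s K2 by simp
      show "clique_sum B y (k + 2) W \<le> profile_curve p (k + 2) (t - h)"
        using dl[of "t - h" t] h change \<tau>s K2 by simp
      show "continuous_on {t - h..t + h} (profile_curve p (k + 2))"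
        unfolding profile_curve_def[abs_def] by (rule profile_count_cont)
    qed (use h in simp)
    then obtain t' where t': "t - h \<le> t'" "t' \<le> t + h" "profile_curve p (k + 2) t' = clique_sum B y (k + 2) W" by blast
    have dist: "c0 * \<bar>t' - t\<bar> \<le> real (k + 2) * \<tau>"
    proof (cases "t \<le> t'")
      case True
      then show ?thesis using dl[of t t'] t' h change K2 by simp
    next
      case False
      then have e: "\<bar>t' - t\<bar> = t - t'" by simp
      have "c0 * (t - t') \<le> profile_curve p (k + 2) t' - profile_curve p (k + 2) t" using dl[of t' t] t' h False by simp
      then show ?thesis unfolding e using abs_le_D1[OF change] unfolding K2 t'(3) by linarith
    qed
    have sq: "c1 * (t' - t)\<^sup>2 \<le> c1 * (real (k + 2) / c0)\<^sup>2 * \<tau>\<^sup>2"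
    proof -
      have "\<bar>t' - t\<bar> \<le> real (k + 2) / c0 * \<tau>" using dist c0 by (simp add: field_simps)
      then have "\<bar>t' - t\<bar>\<^sup>2 \<le> (real (k + 2) / c0 * \<tau>)\<^sup>2" by (intro power_mono) auto
      then have "(t' - t)\<^sup>2 \<le> (real (k + 2) / c0)\<^sup>2 * \<tau>\<^sup>2" unfolding power2_abs power_mult_distrib .
      then show ?thesis using c1 by (simp add: mult_left_mono mult.assoc)
    qed
    have h0: "0 \<le> h" using h by simp
    have tI: "1 / real (Suc p) \<le> t" "t \<le> 1 / real p" "1 / real (Suc p) \<le> t'" "t' \<le> 1 / real p"
      using int t' h by linarith+
    have quad: "profile_curve p (k + 3) t - \<Lambda> * profile_curve p (k + 2) t - c1 * (t' - t)\<^sup>2 \<le> profile_curve p (k + 3) t' - \<Lambda> * profile_curve p (k + 2) t'"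
      using tangent_quadratic[OF p tI] unfolding \<Lambda>_def c1_def .
    have ext: "profile_curve p (k + 3) t' - clique_sum B y (k + 3) W \<le> \<epsilon>"
      using opt[OF B tI(3,4) t'(3)[symmetric]] .
    define g where "g = clique_sum A x (k + 2) S - \<Lambda> * clique_sum A x (k + 1) S"
    define \<mu> where "\<mu> = real (k + 3) * K (k + 3) - \<Lambda> * (real (k + 2) * K (k + 2))"
    have "clique_sum B y (k + 3) W - \<Lambda> * clique_sum B y (k + 2) W
      \<le> (K (k + 3) + \<tau> * (clique_sum A x (k + 2) S - real (k + 3) * K (k + 3)) + (real (k + 3))\<^sup>2 * \<tau>\<^sup>2)
       - \<Lambda> * (K (k + 2) + \<tau> * (clique_sum A x (k + 1) S - real (k + 2) * K (k + 2)) - real (k + 2) * \<tau>\<^sup>2)"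
      using up mult_left_mono[OF low \<Lambda>(1)] by linarith
    also have "\<dots> = K (k + 3) - \<Lambda> * K (k + 2) + \<tau> * (g - \<mu>) + ((real (k + 3))\<^sup>2 + \<Lambda> * real (k + 2)) * \<tau>\<^sup>2"
      unfolding g_def \<mu>_def by (simp add: algebra_simps)
    also have "\<dots> \<le> K (k + 3) - \<Lambda> * K (k + 2) + \<tau> * (g - \<mu>) + ((real (k + 3))\<^sup>2 + curve_ratio k p * real (k + 2)) * \<tau>\<^sup>2"
      using \<Lambda>(2) by (intro add_left_mono mult_right_mono add_mono) auto
    finally have exp: "clique_sum B y (k + 3) W - \<Lambda> * clique_sum B y (k + 2) W
      \<le> K (k + 3) - \<Lambda> * K (k + 2) + \<tau> * (g - \<mu>) + ((real (k + 3))\<^sup>2 + curve_ratio k p * real (k + 2)) * \<tau>\<^sup>2" .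
    have "- \<eta> - C * \<tau>\<^sup>2 \<le> \<tau> * (g - \<mu>)"
    proof -
      have "C * \<tau>\<^sup>2 = c1 * (real (k + 2) / c0)\<^sup>2 * \<tau>\<^sup>2 + ((real (k + 3))\<^sup>2 + curve_ratio k p * real (k + 2)) * \<tau>\<^sup>2"
        unfolding C_def by (rule distrib_right)
      then show ?thesis using exp quad ext near sq unfolding t'(3) K2 by linarith
    qed
    moreover have "C * \<tau>\<^sup>2 \<le> \<zeta> / 2 * \<tau>"
      using mult_right_mono[OF \<tau>C, of \<tau>] \<tau> by (simp add: power2_eq_square mult.assoc)
    ultimately have "\<tau> * (- \<zeta>) \<le> \<tau> * (g - \<mu>)" unfolding \<eta>_def by (simp add: algebra_simps)
    then have "- \<zeta> \<le> g - \<mu>" using \<tau>(1) by (rule mult_left_le_imp_le)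
    then show "real (k + 3) * clique_sum A x (k + 3) U - curve_ratio k p * t * (real (k + 2) * clique_sum A x (k + 2) U) - \<zeta>
           \<le> clique_sum A x (k + 2) S - curve_ratio k p * t * clique_sum A x (k + 1) S"
      unfolding g_def \<mu>_def \<Lambda>_def by linarith
  qed
qed

section \<open>The extension bound for all profiles\<close>

text \<open>
  In the profile every vertex has the same partial derivative \<open>\<mu>\<close> of the
  functional on the left of the second identity. The first identity expresses \<open>\<mu>\<close>
  as the average of these derivatives, and the second one adds the part of weight \<open>y\<close>
  to \<open>p\<close> equal parts.
\<close>

lemma profile_curve_slope_identities:
  fixes k p :: nat and t :: real
  assumes p: "k + 2 \<le> p"
  defines "L \<equiv> curve_ratio k p * t" and "y \<equiv> 1 - real p * t"
  defines "\<mu> \<equiv> real (p choose (k + 2)) * t ^ (k + 2) - L * (real (p choose (k + 1)) * t ^ (k + 1))"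
  shows "real (k + 3) * profile_curve p (k + 3) t - L * (real (k + 2) * profile_curve p (k + 2) t) = \<mu>"
    and "profile_curve p (k + 3) t - L * profile_curve p (k + 2) t
      = real (p choose (k + 3)) * t ^ (k + 3) - L * (real (p choose (k + 2)) * t ^ (k + 2)) + y * \<mu>"
proof -
  define a where "a = real (p choose (k + 3)) * t ^ (k + 3)"
  define b where "b = real (p choose (k + 2)) * t ^ (k + 2)"
  define c where "c = real (p choose (k + 1)) * t ^ (k + 1)"
  have P3: "profile_curve p (k + 3) t = a + b * y"
    using profile_curve_eq[of "k + 3" p t] by (simp add: a_def b_def y_def numeral_3_eq_3 numeral_2_eq_2)
  have P2: "profile_curve p (k + 2) t = b + c * y"
    using profile_curve_eq[of "k + 2" p t] by (simp add: b_def c_def y_def)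
  have \<mu>: "\<mu> = b - L * c" by (simp add: \<mu>_def b_def c_def)
  show "profile_curve p (k + 3) t - L * profile_curve p (k + 2) t
      = real (p choose (k + 3)) * t ^ (k + 3) - L * (real (p choose (k + 2)) * t ^ (k + 2)) + y * \<mu>"
    unfolding P3 P2 \<mu> a_def[symmetric] b_def[symmetric] by (simp add: algebra_simps)
  have ab: "real (k + 3) * a = (real p - real (k + 2)) * t * b"
    using binomial_Suc_real[of "k + 2" p] unfolding a_def b_def by (simp add: numeral_3_eq_3)
  have bc: "real (k + 2) * b = (real p - real (k + 1)) * t * c"
    using binomial_Suc_real[of "k + 1" p] unfolding b_def c_def by simp
  have L1: "real (k + 1) * L = (real p - real (k + 1)) * t"
  proof -
    have "real (Suc k) * curve_ratio k p = real p - real k - 1" by (simp add: curve_ratio_def[OF p] del: of_nat_Suc)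
    then have "real (Suc k) * curve_ratio k p * t = (real p - real k - 1) * t" by (simp only:)
    then show ?thesis by (simp add: L_def algebra_simps)
  qed
  have "real (k + 3) * (a + b * y) - L * (real (k + 2) * (b + c * y))
    = (real p - real (k + 2)) * t * b + real (k + 3) * b * y - L * ((real p - real (k + 1)) * t * c + real (k + 2) * c * y)"
    unfolding ab[symmetric] bc[symmetric] by (simp add: algebra_simps)
  also have "\<dots> = \<mu> * (real p * t + y) + (y - t) * (real (k + 2) * b - real (k + 1) * L * c)"
    unfolding \<mu> by (simp add: algebra_simps)
  also have "\<dots> = \<mu>" unfolding bc L1 by (simp add: y_def)
  finally show "real (k + 3) * profile_curve p (k + 3) t - L * (real (k + 2) * profile_curve p (k + 2) t) = \<mu>"
    unfolding P3 P2 .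
qed

text \<open>
  The contradiction at a nearly worst graph: the upper bound \<open>removal_bound\<close> and the
  lower bound \<open>link_functional_bound\<close> for the neighbourhood of a suitable vertex
  exclude each other.
\<close>

lemma no_violation:
  fixes k p :: nat
  assumes p: "k + 2 \<le> p"
    and IHp: "\<And>q. 1 \<le> q \<Longrightarrow> q < p \<Longrightarrow> extension_bound (k + 2) q"
    and IHk: "1 \<le> k \<Longrightarrow> extension_bound (k + 1) (p - 1)"
    and G0: "weighted_graph (A0 :: nat \<Rightarrow> nat \<Rightarrow> bool) x0 U0" "sum x0 U0 = 1" "1 / real (Suc p) \<le> t0" "t0 \<le> 1 / real p"
      "clique_sum A0 x0 (k + 2) U0 = profile_curve p (k + 2) t0"
  shows "profile_curve p (k + 3) t0 \<le> clique_sum A0 x0 (k + 3) U0"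
proof (rule ccontr)
  assume viol: "\<not> ?thesis"
  define V where "V = {profile_curve p (k + 3) t - clique_sum A x (k + 3) U | (A :: nat \<Rightarrow> nat \<Rightarrow> bool) x U t.
     weighted_graph A x U \<and> sum x U = 1 \<and> 1 / real (Suc p) \<le> t \<and> t \<le> 1 / real p \<and> clique_sum A x (k + 2) U = profile_curve p (k + 2) t}"
  define u0 where "u0 = 1 / real (Suc p)"
  have p1: "1 \<le> p" using p by simp
  have in0: "profile_curve p (k + 3) t0 - clique_sum A0 x0 (k + 3) U0 \<in> V"
    unfolding V_def mem_Collect_eq by (intro exI conjI) (rule refl, (rule G0)+)
  have bdd: "bdd_above V"
  proof (rule bdd_aboveI[of _ "profile_curve p (k + 3) u0"])
    fix v assume "v \<in> V"
    then obtain A :: "nat \<Rightarrow> nat \<Rightarrow> bool" and x U t where *: "v = profile_curve p (k + 3) t - clique_sum A x (k + 3) U"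
      "weighted_graph A x U" "1 / real (Suc p) \<le> t" unfolding V_def mem_Collect_eq by (elim exE conjE) (rule that)
    have "profile_curve p (k + 3) t \<le> profile_curve p (k + 3) u0"
      using profile_curve_antimono[of p u0 t "k + 2"] p1 *(3) unfolding u0_def by (simp add: numeral_3_eq_3)
    then show "v \<le> profile_curve p (k + 3) u0" using *(1) weighted_graph.clique_sum_nonneg[OF *(2), of "k + 3" U] by linarith
  qed
  define \<epsilon> where "\<epsilon> = Sup V"
  have \<epsilon>: "0 < \<epsilon>" using cSup_upper[OF in0 bdd] viol unfolding \<epsilon>_def by linarith
  have opt: "profile_curve p (k + 3) t - clique_sum A x (k + 3) U \<le> \<epsilon>"
    if "weighted_graph A x U" "sum x U = 1" "1 / real (Suc p) \<le> t" "t \<le> 1 / real p" "clique_sum A x (k + 2) U = profile_curve p (k + 2) t"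
    for A :: "nat \<Rightarrow> nat \<Rightarrow> bool" and x U t
  proof -
    have "profile_curve p (k + 3) t - clique_sum A x (k + 3) U \<in> V"
      unfolding V_def mem_Collect_eq by (intro exI conjI) (rule refl, (rule that)+)
    then show ?thesis unfolding \<epsilon>_def by (rule cSup_upper[OF _ bdd])
  qed
  have e2: "0 < \<epsilon> / 2" using \<epsilon> by simp
  have s2: "2 \<le> k + 2" by simp
  obtain \<theta> where \<theta>: "0 < \<theta>" and away: "\<And>(A :: nat \<Rightarrow> nat \<Rightarrow> bool) x U t. weighted_graph A x U \<Longrightarrow> sum x U = 1 \<Longrightarrow> 1 / real (Suc p) \<le> t
     \<Longrightarrow> t \<le> 1 / real p \<Longrightarrow> clique_sum A x (k + 2) U = profile_curve p (k + 2) t \<Longrightarrow> \<epsilon> / 2 \<le> profile_curve p (Suc (k + 2)) t - clique_sum A x (Suc (k + 2)) U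
        \<Longrightarrow> 1 / real (Suc p) + \<theta> \<le> t \<and> t \<le> 1 / real p - \<theta>"
    by (rule violation_away_from_ends[OF s2 p e2]) blast
  \<comment> \<open>The argument ends with \<open>c * e \<le> \<zeta> + \<beta>\<close> for a violation \<open>e \<ge> \<epsilon> / 2\<close>, which dictates \<open>\<beta> \<le> \<epsilon> * c / 8\<close>.
    The bound \<open>\<beta> \<le> \<epsilon> / 4\<close> keeps the chosen link below the critical value \<open>\<mu>s\<close>, and \<open>\<zeta> \<le> p * \<theta> * \<beta>\<close> keeps its weight below \<open>p * t\<close>.\<close>
  define c where "c = real p * (real (Suc p) * \<theta>)"
  have c: "0 < c" using p1 \<theta> by (simp add: c_def)
  define \<beta> where "\<beta> = min (\<epsilon> * c / 8) (\<epsilon> / 4)"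
  have \<beta>: "0 < \<beta>" "\<beta> \<le> \<epsilon> * c / 8" "\<beta> \<le> \<epsilon> / 4" using \<epsilon> c by (auto simp: \<beta>_def)
  define \<zeta> where "\<zeta> = min \<beta> (real p * \<theta> * \<beta>)"
  have \<zeta>: "0 < \<zeta>" "\<zeta> \<le> \<beta>" "\<zeta> \<le> real p * \<theta> * \<beta>" using \<beta>(1) \<theta> p1 by (auto simp: \<zeta>_def)
  obtain \<eta> where \<eta>: "0 < \<eta>" and first: "\<And>(A :: nat \<Rightarrow> nat \<Rightarrow> bool) x U t S. weighted_graph A x U \<Longrightarrow> sum x U = 1
      \<Longrightarrow> 1 / real (Suc p) + \<theta> \<le> t \<Longrightarrow> t \<le> 1 / real p - \<theta>
      \<Longrightarrow> clique_sum A x (k + 2) U = profile_curve p (k + 2) t \<Longrightarrow> \<epsilon> - \<eta> < profile_curve p (k + 3) t - clique_sum A x (k + 3) U \<Longrightarrow> S \<subseteq> U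
      \<Longrightarrow> real (k + 3) * clique_sum A x (k + 3) U - curve_ratio k p * t * (real (k + 2) * clique_sum A x (k + 2) U) - \<zeta>
           \<le> clique_sum A x (k + 2) S - curve_ratio k p * t * clique_sum A x (k + 1) S"
  proof (rule near_extremal_first_order[where \<epsilon> = \<epsilon>, OF p \<theta> \<zeta>(1)], goal_cases)
    case (1 A x U t)
    from 1(2-6) show ?case by (rule opt)
  next
    case (2 \<eta>)
    show ?case by (rule 2(1)[OF 2(2,3)])
  qed
  have "\<epsilon> - min \<eta> (\<epsilon> / 2) < Sup V" using \<eta> \<epsilon> by (simp add: \<epsilon>_def[symmetric])
  moreover have "V \<noteq> {}" using in0 by auto
  ultimately obtain v where v: "v \<in> V" "\<epsilon> - min \<eta> (\<epsilon> / 2) < v"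
    using less_cSup_iff[OF _ bdd] by auto
  obtain A :: "nat \<Rightarrow> nat \<Rightarrow> bool" and x U t where G: "weighted_graph A x U" and tot: "sum x U = 1"
    and t: "1 / real (Suc p) \<le> t" "t \<le> 1 / real p" and K2: "clique_sum A x (k + 2) U = profile_curve p (k + 2) t"
    and veq: "v = profile_curve p (k + 3) t - clique_sum A x (k + 3) U"
    using v(1) unfolding V_def mem_Collect_eq by (elim exE conjE) (rule that)
  interpret weighted_graph A x U by fact
  define e where "e = profile_curve p (k + 3) t - K (k + 3)"
  have e: "\<epsilon> / 2 \<le> e" "\<epsilon> - \<eta> < e" using v(2) veq by (auto simp: e_def)
  have tin: "u0 + \<theta> \<le> t" "t \<le> 1 / real p - \<theta>"
    using away[OF G tot t K2] e(1) unfolding e_def u0_def by (simp_all add: numeral_3_eq_3)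
  define L where "L = curve_ratio k p * t"
  define y where "y = 1 - real p * t"
  define \<mu>s where "\<mu>s = real (p choose (k + 2)) * t ^ (k + 2) - L * (real (p choose (k + 1)) * t ^ (k + 1))"
  define \<mu> where "\<mu> = real (k + 3) * K (k + 3) - L * (real (k + 2) * K (k + 2))"
  have \<mu>eq: "\<mu> = \<mu>s - real (k + 3) * e"
    using profile_curve_slope_identities(1)[OF p, of t] unfolding \<mu>_def \<mu>s_def L_def e_def K2 by (simp add: algebra_simps)
  define g where "g = (\<lambda>S. clique_sum A x (k + 2) S - L * clique_sum A x (k + 1) S)"
  have fo: "\<mu> - \<zeta> \<le> g S" if "S \<subseteq> U" for S
    using first[OF G tot tin(1)[unfolded u0_def] tin(2) K2 e(2)[unfolded e_def] that]
    unfolding \<mu>_def g_def L_def .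
  have u0p: "real p * u0 = 1 - u0" by (simp add: u0_def field_simps)
  have u0: "0 < u0" by (simp add: u0_def)
  have tpos: "0 < t" using tin u0 \<theta> by linarith
  have y0: "0 \<le> y" using t(2) p1 by (simp add: y_def field_simps)
  have yb: "real (k + 3) * y \<le> 1 - c"
  proof -
    have "real p * (u0 + \<theta>) \<le> real p * t" using tin(1) by (intro mult_left_mono) auto
    then have "y \<le> u0 - real p * \<theta>" using u0p unfolding y_def by (simp add: algebra_simps)
    then have "real (Suc p) * y \<le> real (Suc p) * (u0 - real p * \<theta>)" by (intro mult_left_mono) auto
    also have "\<dots> = 1 - c" by (simp add: c_def u0_def right_diff_distrib del: of_nat_Suc)
    finally have "real (Suc p) * y \<le> 1 - c" .
    moreover have "real (k + 3) * y \<le> real (Suc p) * y" using p y0 by (intro mult_right_mono) auto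
    ultimately show ?thesis by linarith
  qed
  \<comment> \<open>more edges would force at least the clique counts of the balanced complete \<open>(p + 1)\<close>-partite graph, but \<open>t > u0\<close>\<close>
  have edges: "2 * K 2 \<le> 1 - u0"
  proof (rule ccontr)
    assume neg: "\<not> ?thesis"
    have "{..<2} = {0, 1::nat}" by auto
    then have t2: "turan_poly 1 u0 2 = (1 - u0) / 2" by (simp add: turan_poly_def)
    have "real (k + 2) * u0 \<le> real (Suc p) * u0" using p u0 by (intro mult_right_mono) auto
    then have le: "real (k + 2) * u0 \<le> 1" by (simp add: u0_def del: of_nat_Suc)
    have "1 - u0 < 2 * K 2" using neg by (simp only: not_le)
    then have "(1 - u0) / 2 \<le> K 2" by simp
    then have t2K: "turan_poly d u0 2 \<le> K 2" unfolding tot t2 .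
    have "turan_poly d u0 (k + 2) \<le> K (k + 2)"
      using t2K _ less_imp_le[OF u0] le[folded tot] by (rule turan_poly_up_iter) simp
    then have "profile_curve p (k + 2) u0 \<le> profile_curve p (k + 2) t" unfolding K2 tot u0_def profile_curve_right .
    moreover have "profile_curve p (k + 2) t < profile_curve p (k + 2) u0"
    proof -
      obtain m where m: "p = Suc m" using p1 by (cases p) auto
      have "k \<le> m" using p m by simp
      moreover have "1 - real (Suc m) * u0 \<le> u0" using u0p m by simp
      ultimately show ?thesis
        using profile_count_strict_antimono[of u0 t 1 m k] tin(1) \<theta> u0
        unfolding profile_curve_def m numeral_2_eq_2 add_Suc_right add_0_right by linarith
    qed
    ultimately show False by simp
  qed
  \<comment> \<open>averaging the degree plus \<open>M\<close> times the excess of \<open>g\<close> over its lower bound gives one vertex that is good for both\<close>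
  define M where "M = 1 / \<beta>"
  have M: "0 < M" using \<beta> by (simp add: M_def)
  have Mz: "M * \<zeta> \<le> real p * \<theta>" using \<zeta>(3) \<beta>(1) by (simp add: M_def field_simps)
  define hh where "hh = (\<lambda>v. clique_sum A x 1 (nbhd A v U) + M * (g (nbhd A v U) - \<mu> + \<zeta>))"
  have "(\<Sum>v\<in>U. x v * hh v)
      = (\<Sum>v\<in>U. x v * clique_sum A x 1 (nbhd A v U))
        + M * ((\<Sum>v\<in>U. x v * clique_sum A x (k + 2) (nbhd A v U)) - L * (\<Sum>v\<in>U. x v * clique_sum A x (k + 1) (nbhd A v U)) + (\<zeta> - \<mu>) * (\<Sum>v\<in>U. x v))"
  proof -
    have "x v * hh v
      = x v * clique_sum A x 1 (nbhd A v U) + M * (x v * clique_sum A x (k + 2) (nbhd A v U) - L * (x v * clique_sum A x (k + 1) (nbhd A v U)) + (\<zeta> - \<mu>) * x v)" for v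
      unfolding g_def hh_def by (simp only: algebra_simps)
    then show ?thesis by (simp only: sum.distrib sum_subtractf sum_distrib_left[symmetric])
  qed
  also have "\<dots> = 2 * K 2 + M * \<zeta>"
  proof -
    have "(\<Sum>v\<in>U. x v * clique_sum A x 1 (nbhd A v U)) = 2 * K 2"
      using clique_sum_degree_sum[of 1] by (simp only: of_nat_Suc Suc_1 of_nat_1 one_add_one)
    moreover have "(\<Sum>v\<in>U. x v * clique_sum A x (k + 2) (nbhd A v U)) = real (k + 3) * K (k + 3)"
      using clique_sum_degree_sum[of "k + 2"] by (simp only: numeral_3_eq_3 numeral_2_eq_2 add_Suc_right)
    moreover have "(\<Sum>v\<in>U. x v * clique_sum A x (k + 1) (nbhd A v U)) = real (k + 2) * K (k + 2)"
      using clique_sum_degree_sum[of "k + 1"] by (simp only: numeral_2_eq_2 One_nat_def add_Suc_right)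
    ultimately show ?thesis unfolding tot by (simp add: \<mu>_def)
  qed
  also have "\<dots> \<le> 1 - u0 + M * \<zeta>" using edges by simp
  finally have "\<exists>z\<in>U. hh z \<le> 1 - u0 + M * \<zeta>" by (rule exists_below_average[OF tot])
  then obtain z where z: "z \<in> U" "hh z \<le> 1 - u0 + M * \<zeta>" by blast
  define H where "H = nbhd A z U"
  have HU: "H \<subseteq> U" by (auto simp: H_def nbhd_def)
  have d1: "clique_sum A x 1 H = sum x H" using clique_sum_1[of A x H] by simp
  have dH: "0 \<le> sum x H" using nonneg by (intro sum_nonneg) auto
  have gH0: "0 \<le> g H - \<mu> + \<zeta>" using fo[OF HU] by simp
  have zz: "sum x H + M * (g H - \<mu> + \<zeta>) \<le> 1 - u0 + M * \<zeta>" using z(2) unfolding hh_def H_def[symmetric] d1 .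
  have deg: "sum x H \<le> real p * t"
  proof -
    have "0 \<le> M * (g H - \<mu> + \<zeta>)" using M gH0 by simp
    then have "sum x H \<le> 1 - u0 + real p * \<theta>" using zz Mz by linarith
    also have "\<dots> = real p * (u0 + \<theta>)" using u0p by (simp add: algebra_simps)
    also have "\<dots> \<le> real p * t" using tin(1) by (intro mult_left_mono) auto
    finally show ?thesis .
  qed
  have gH: "g H \<le> \<mu> + \<beta>"
  proof -
    have "M * (g H - \<mu>) \<le> 1" using zz dH u0 by (simp add: algebra_simps)
    then show ?thesis using \<beta>(1) by (simp add: M_def field_simps)
  qed
  define \<sigma> where "\<sigma> = real p * t - sum x H"
  have \<sigma>: "0 \<le> \<sigma>" using deg by (simp add: \<sigma>_def)
  have Leq: "L = t * (real p - real k - 1) / real (Suc k)" unfolding L_def curve_ratio_def[OF p] by simp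
  have dHe: "sum x H = real p * t - \<sigma>" by (simp add: \<sigma>_def)
  have glt: "clique_sum A x (k + 2) H - L * clique_sum A x (k + 1) H
        < real (p choose (k + 2)) * t ^ (k + 2) - L * (real (p choose (k + 1)) * t ^ (k + 1))"
  proof -
    have "1 * e \<le> real (k + 3) * e" using e(1) \<epsilon> by (intro mult_right_mono) auto
    then have "\<epsilon> / 2 \<le> real (k + 3) * e" using e(1) by linarith
    then have "\<mu> + \<beta> < \<mu>s" using \<mu>eq \<beta>(3) \<epsilon> by linarith
    then show ?thesis using gH unfolding g_def \<mu>s_def by linarith
  qed
  have claim: "real (p choose (k + 3)) * t ^ (k + 3) - L * (real (p choose (k + 2)) * t ^ (k + 2))
     \<le> clique_sum A x (k + 3) H - L * clique_sum A x (k + 2) H + \<sigma> * g H"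
    unfolding g_def by (rule link_functional_bound[OF subgraph[OF HU] p tpos \<sigma> Leq dHe IHp IHk glt])
  have rem: "clique_sum A x (k + 3) H - L * clique_sum A x (k + 2) H + (\<mu> - \<zeta>) * (1 - sum x H) \<le> K (k + 3) - L * K (k + 2)"
    using removal_bound[OF HU, of "\<mu> - \<zeta>" "k + 1" L] fo tot unfolding g_def by (simp add: numeral_3_eq_3)
  have fG: "K (k + 3) - L * K (k + 2)
    = real (p choose (k + 3)) * t ^ (k + 3) - L * (real (p choose (k + 2)) * t ^ (k + 2)) + y * \<mu>s - e"
    using profile_curve_slope_identities(2)[OF p, of t] unfolding L_def[symmetric] y_def[symmetric] \<mu>s_def[symmetric] K2 e_def by linarith
  have oneH: "1 - sum x H = y + \<sigma>" by (simp add: y_def \<sigma>_def)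
  have \<sigma>1: "\<sigma> \<le> 1" "y + \<sigma> \<le> 1" using y0 dH oneH by linarith+
  have "\<sigma> * g H \<le> \<sigma> * (\<mu> + \<beta>)" using gH \<sigma> by (intro mult_left_mono)
  then have "e \<le> y * (\<mu>s - \<mu>) + \<zeta> * (y + \<sigma>) + \<sigma> * \<beta>"
    using claim rem fG unfolding oneH by (simp add: algebra_simps)
  also have "\<dots> \<le> y * (real (k + 3) * e) + \<zeta> + \<beta>"
  proof -
    have "\<zeta> * (y + \<sigma>) \<le> \<zeta>" using \<zeta>(1) \<sigma>1 y0 \<sigma> by (intro mult_left_le) auto
    moreover have "\<sigma> * \<beta> \<le> \<beta>" using \<beta>(1) \<sigma>1 \<sigma> by (intro mult_left_le_one_le) auto
    ultimately show ?thesis using \<mu>eq by simp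
  qed
  also have "y * (real (k + 3) * e) \<le> (1 - c) * e"
    using mult_right_mono[OF yb, of e] e(1) \<epsilon> by (simp add: mult_ac)
  finally have "c * e \<le> \<zeta> + \<beta>" by (simp add: algebra_simps)
  moreover have "c * (\<epsilon> / 2) \<le> c * e" using e(1) c by (intro mult_left_mono) auto
  moreover have "0 < c * \<epsilon>" using c \<epsilon> by simp
  ultimately show False using \<zeta>(2) \<beta>(2) unfolding mult.commute[of \<epsilon> c] by linarith
qed

theorem extension_bound_all: "extension_bound (k + 2) q"
proof (induction k arbitrary: q)
  case (Suc k)
  note IHk = Suc.IH
  show ?case
  proof (induction q rule: less_induct)
    case (less p)
    show ?case
    proof (cases "Suc k + 2 \<le> p")
      case True
      show ?thesis
      proof (rule extension_bound_from_normalized[OF _ True])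
        fix A :: "nat \<Rightarrow> nat \<Rightarrow> bool" and x U t
        assume "weighted_graph A x U" "sum x U = 1" "1 / real (Suc p) \<le> t" "t \<le> 1 / real p" "clique_sum A x (Suc k + 2) U = profile_curve p (Suc k + 2) t"
        then have "profile_curve p (Suc k + 3) t \<le> clique_sum A x (Suc k + 3) U"
          using less.IH IHk[of "p - 1"] by (intro no_violation[OF True]) auto
        then show "profile_curve p (Suc (Suc k + 2)) t \<le> clique_sum A x (Suc (Suc k + 2)) U"
          by (simp add: numeral_3_eq_3)
      qed simp
    next
      case False
      then show ?thesis unfolding extension_bound_def
        using weighted_graph.clique_sum_nonneg by (auto simp: profile_count_def binomial_eq_0)
    qed
  qed
next
  case 0
  show ?case
  proof (induction q rule: less_induct)
    case (less p)
    show ?case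
    proof (cases "0 + 2 \<le> p")
      case True
      show ?thesis
      proof (rule extension_bound_from_normalized[OF _ True])
        fix A :: "nat \<Rightarrow> nat \<Rightarrow> bool" and x U t
        assume "weighted_graph A x U" "sum x U = 1" "1 / real (Suc p) \<le> t" "t \<le> 1 / real p" "clique_sum A x (0 + 2) U = profile_curve p (0 + 2) t"
        then have "profile_curve p (0 + 3) t \<le> clique_sum A x (0 + 3) U"
          using less.IH by (intro no_violation[OF True]) auto
        then show "profile_curve p (Suc (0 + 2)) t \<le> clique_sum A x (Suc (0 + 2)) U"
          by (simp add: numeral_3_eq_3)
      qed simp
    next
      case False
      then show ?thesis unfolding extension_bound_def
        using weighted_graph.clique_sum_nonneg by (auto simp: profile_count_def binomial_eq_0)
    qed
  qed
qed

section \<open>Clique densities of graphs\<close>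

text \<open>
  Every vertex receives the weight \<open>1 / n\<close>, and the vertices are renamed to natural
  numbers.
\<close>

lemma clique_density_weighted:
  fixes V :: "'a set" and E :: "'a set set"
  assumes "simple_graph V E"
  obtains A :: "nat \<Rightarrow> nat \<Rightarrow> bool" and x U where "weighted_graph A x U" "sum x U = 1"
    "\<And>j. clique_sum A x j U = clique_density j V E"
proof -
  have V: "finite V" "V \<noteq> {}" using assms by (auto simp: simple_graph_def)
  obtain f :: "'a \<Rightarrow> nat" where f: "inj_on f V" using finite_imp_inj_to_nat_seg[OF V(1)] by metis
  define U where "U = f ` V"
  define x :: "nat \<Rightarrow> real" where "x = (\<lambda>_. 1 / real (card V))"
  define A where "A = (\<lambda>a b. \<exists>u\<in>V. \<exists>v\<in>V. a = f u \<and> b = f v \<and> u \<noteq> v \<and> {u, v} \<in> E)"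
  have n: "0 < real (card V)" using V by (simp add: card_gt_0_iff)
  have cU: "card U = card V" unfolding U_def using f by (rule card_image)
  have A_iff: "A (f u) (f v) \<longleftrightarrow> u \<noteq> v \<and> {u, v} \<in> E" if "u \<in> V" "v \<in> V" for u v
    using that f unfolding A_def inj_on_def by blast
  have G: "weighted_graph A x U"
  proof
    show "A v u" if "A u v" for u v using that unfolding A_def by (metis insert_commute)
    show "\<not> A u u" for u using f unfolding A_def inj_on_def by blast
  qed (auto simp: U_def x_def V)
  have "clique_sum A x j U = clique_density j V E" for j
  proof -
    let ?C = "{S \<in> [V]\<^bsup>j\<^esup>. clique S E}"
    have C: "cliques_of A j U = (`) f ` ?C"
    proof (intro equalityI subsetI)
      fix T assume T: "T \<in> cliques_of A j U"
      then obtain S where S: "S \<subseteq> V" "T = f ` S" unfolding cliques_of_def U_def by (auto elim: subset_imageE)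
      have inj: "inj_on f S" using f S(1) by (rule inj_on_subset)
      have "card S = j" using T S card_image[OF inj] by (simp add: cliques_of_def)
      moreover have "clique S E"
        unfolding clique_def
      proof (intro ballI impI)
        fix u v assume uv: "u \<in> S" "v \<in> S" "u \<noteq> v"
        then have "f u \<noteq> f v" using inj by (auto simp: inj_on_def)
        then have "A (f u) (f v)" using T uv S(2) by (auto simp: cliques_of_def pairwise_def)
        then show "{u, v} \<in> E" using A_iff uv S(1) by blast
      qed
      ultimately have "S \<in> ?C" using S(1) V(1) by (auto simp: nsets_def dest: finite_subset)
      then show "T \<in> (`) f ` ?C" using S(2) by blast
    next
      fix T assume "T \<in> (`) f ` ?C"
      then obtain S where S: "S \<subseteq> V" "card S = j" "clique S E" "T = f ` S" by (auto simp: nsets_def)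
      have "inj_on f S" using f S(1) by (rule inj_on_subset)
      then have "card T = j" using S by (simp add: card_image)
      moreover have "pairwise A T"
        unfolding pairwise_def
      proof (intro ballI impI)
        fix a b assume "a \<in> T" "b \<in> T" "a \<noteq> b"
        then obtain u v where "u \<in> S" "v \<in> S" "u \<noteq> v" "a = f u" "b = f v" unfolding S(4) by blast
        then show "A a b" using A_iff S(1,3) unfolding clique_def by blast
      qed
      ultimately show "T \<in> cliques_of A j U" using S unfolding cliques_of_def U_def by blast
    qed
    have inj: "inj_on ((`) f) ?C"
    proof (rule inj_on_subset)
      show "inj_on ((`) f) (Pow V)" using f by (rule inj_on_image_Pow)
    qed (auto simp: nsets_def)
    have "clique_sum A x j U = (\<Sum>S\<in>cliques_of A j U. (1 / real (card V)) ^ j)"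
      unfolding clique_sum_def x_def by (intro sum.cong refl) (simp add: cliques_of_def)
    also have "\<dots> = real (card ?C) * (1 / real (card V)) ^ j"
      unfolding C using card_image[OF inj] by simp
    finally show ?thesis by (simp add: clique_density_def clique_count_def power_divide)
  qed
  moreover have "sum x U = 1" unfolding x_def using n cU by simp
  ultimately show ?thesis using that G by blast
qed

lemma clique_density_le_turan:
  assumes "simple_graph V E"
  shows "clique_density s V E \<le> real (card V choose s) * (1 / real (card V)) ^ s"
proof -
  have V: "finite V" using assms by (simp add: simple_graph_def)
  have "clique_count s V E \<le> card V choose s"
    unfolding clique_count_def card_nsets[symmetric]
    using V by (intro card_mono finite_imp_finite_nsets) auto
  then show ?thesis unfolding clique_density_def by (simp add: power_divide divide_right_mono)
qed

text \<open>
  The profile belonging to the parameters \<open>q\<close> and \<open>\<alpha>\<close> has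
  \<open>z = (1 + \<alpha>) / (q + 1)\<close> and \<open>w = (1 - q \<alpha>) / (q + 1)\<close>.
\<close>

lemma profile_count_eq_clique_F:
  assumes "1 \<le> j" "edge_density_params \<gamma> q \<alpha>"
  defines "z \<equiv> (1 + \<alpha>) / (real q + 1)"
  shows "clique_F j \<gamma> = profile_count j q z (1 - real q * z)"
proof -
  have q: "1 \<le> q" using assms(2) by (simp add: edge_density_params_def)
  have "0 \<le> (real q - 1) / (2 * real q)" using q by simp
  then have "\<gamma> \<noteq> 0" using edge_density_params_bounds(1)[OF assms(2)] by linarith
  then have F: "clique_F j \<gamma> = real ((q + 1) choose j) / (real q + 1) ^ j * (1 + \<alpha>) ^ (j - 1) * (1 - (real j - 1) * \<alpha>)"
    using clique_F_eq assms(2) by blast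
  obtain i where j: "j = Suc i" using assms(1) by (cases j) auto
  have q1: "0 < real q + 1" by simp
  have \<alpha>: "1 + \<alpha> = (real q + 1) * z" by (simp add: z_def)
  have b1: "real (Suc i) * real ((q + 1) choose Suc i) = (real q + 1) * real (q choose i)"
    using arg_cong[OF Suc_times_binomial[of i q], of real] by (simp only: of_nat_mult of_nat_Suc Suc_eq_plus1 of_nat_add of_nat_1)
  have b2: "real (Suc i) * real (q choose Suc i) = (real q - real i) * real (q choose i)"
    by (rule binomial_Suc_real)
  define a where "a = real ((q + 1) choose Suc i) / (real q + 1) * (1 - real i * \<alpha>)"
  have "real (Suc i) * a = real (q choose i) * (1 - real i * \<alpha>)"
  proof -
    have "real (Suc i) * (real ((q + 1) choose Suc i) / (real q + 1) * (1 - real i * \<alpha>))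
      = (real (Suc i) * real ((q + 1) choose Suc i)) / (real q + 1) * (1 - real i * \<alpha>)" by simp
    then show ?thesis unfolding b1 a_def using q1 by simp
  qed
  also have "1 - real i * \<alpha> = (real q - real i) * z + real (Suc i) * (1 - real q * z)"
  proof -
    have e: "\<alpha> = (real q + 1) * z - 1" using \<alpha> by simp
    show ?thesis unfolding e by (simp add: algebra_simps)
  qed
  also have "real (q choose i) * ((real q - real i) * z + real (Suc i) * (1 - real q * z))
     = ((real q - real i) * real (q choose i)) * z + real (Suc i) * real (q choose i) * (1 - real q * z)"
    by (simp only: algebra_simps)
  also have "\<dots> = real (Suc i) * (real (q choose Suc i) * z + real (q choose i) * (1 - real q * z))"
    unfolding b2[symmetric] by (simp only: algebra_simps)
  finally have key: "real ((q + 1) choose Suc i) / (real q + 1) * (1 - real i * \<alpha>)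
     = real (q choose Suc i) * z + real (q choose i) * (1 - real q * z)"
    unfolding a_def[symmetric] by (simp del: of_nat_Suc)
  have "clique_F j \<gamma> = real ((q + 1) choose Suc i) / (real q + 1) ^ Suc i * (1 + \<alpha>) ^ i * (1 - real i * \<alpha>)"
    using F by (simp add: j)
  also have "\<dots> = z ^ i * (real ((q + 1) choose Suc i) / (real q + 1) * (1 - real i * \<alpha>))"
    unfolding \<alpha> power_mult_distrib using q1 by simp
  also have "\<dots> = profile_count j q z (1 - real q * z)" unfolding key j profile_count_Suc by (simp add: algebra_simps)
  finally show ?thesis .
qed

lemma turan_value_mono:
  assumes "1 \<le> m" "m \<le> n"
  shows "real (m choose Suc j) * (1 / real m) ^ Suc j \<le> real (n choose Suc j) * (1 / real n) ^ Suc j"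
  using assms(2)
proof (induction n rule: dec_induct)
  case (step n)
  have n: "1 \<le> n" using step assms by simp
  have "profile_curve n (Suc j) (1 / real n) \<le> profile_curve n (Suc j) (1 / real (Suc n))"
    using n by (intro profile_curve_antimono) (auto simp: divide_le_cancel frac_le)
  moreover have "profile_curve n (Suc j) (1 / real n) = real (n choose Suc j) * (1 / real n) ^ Suc j"
    using n by (simp add: profile_curve_def profile_count_0_right del: power_Suc)
  moreover have "profile_curve n (Suc j) (1 / real (Suc n)) = real (Suc n choose Suc j) * (1 / real (Suc n)) ^ Suc j"
  proof -
    have "1 - real n * (1 / real (Suc n)) = 1 / real (Suc n)" by (simp add: field_simps)
    then show ?thesis unfolding profile_curve_def by (simp only: profile_count_same)
  qed
  ultimately show ?case using step.IH by linarith
qed simp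

text \<open>
  The clique counts increase strictly along each piece, and the pieces follow each other in the
  order of \<open>q\<close>.
\<close>

lemma profile_curve_unique:
  assumes s: "2 \<le> s" and q: "s - 1 \<le> q" "s - 1 \<le> q'"
    and z: "1 / real (Suc q) \<le> z" "z < 1 / real q" and z': "1 / real (Suc q') \<le> z'" "z' < 1 / real q'"
    and eq: "profile_curve q s z = profile_curve q' s z'"
  shows "q = q' \<and> z = z'"
proof -
  obtain i where i: "s = Suc (Suc i)" using s by (metis add_2_eq_Suc le_Suc_ex)
  have strict: "profile_curve q s z2 < profile_curve q s z1"
    if "s - 1 \<le> q" "1 / real (Suc q) \<le> z1" "z1 < z2" for q z1 z2
  proof -
    have "q \<noteq> 0" using that(1) s by auto
    then obtain m where m: "q = Suc m" by (cases q) auto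
    have "0 \<le> z1" using that(2) by (meson divide_nonneg_nonneg of_nat_0_le_iff order_trans zero_le_one)
    moreover have "1 - real q * z1 \<le> z1" using that(2) by (simp add: field_simps)
    ultimately show ?thesis
      using profile_count_strict_antimono[of z1 z2 1 m i] that s unfolding profile_curve_def i m by simp
  qed
  have less: False if "q < q'" "s - 1 \<le> q" "s - 1 \<le> q'" "1 / real (Suc q) \<le> z" "1 / real (Suc q') \<le> z'" "z' < 1 / real q'"
    "profile_curve q s z = profile_curve q' s z'" for q q' z z'
  proof -
    have q1: "1 \<le> q" using that s by simp
    have "profile_curve q s z \<le> profile_curve q s (1 / real (Suc q))"
      unfolding i using that q1 by (intro profile_curve_antimono) auto
    also have "\<dots> = real (Suc q choose s) * (1 / real (Suc q)) ^ s"
    proof -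
      have "1 - real q * (1 / real (Suc q)) = 1 / real (Suc q)" by (simp add: field_simps)
      then show ?thesis unfolding profile_curve_def by (simp only: profile_count_same)
    qed
    also have "\<dots> \<le> real (q' choose s) * (1 / real q') ^ s"
      unfolding i using that by (intro turan_value_mono) auto
    also have "\<dots> = profile_curve q' s (1 / real q')"
      using that q1 by (simp add: profile_curve_def profile_count_0_right)
    also have "\<dots> < profile_curve q' s z'" using that by (intro strict) auto
    finally show False using that by simp
  qed
  have "q = q'"
    using less[of q q' z z'] less[of q' q z' z] q z z' eq by (metis linorder_neqE_nat)
  moreover have "z = z'"
    using strict[of q z z'] strict[of q z' z] q z z' eq \<open>q = q'\<close> by (metis less_irrefl linorder_neqE_linordered_idom)
  ultimately show ?thesis by simp
qed

lemma clique_F_inv_eq: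
  assumes s: "2 \<le> s" and q: "s - 1 \<le> q" and z: "1 / real (Suc q) \<le> z" "z < 1 / real q" and c: "profile_curve q s z = c" "0 < c"
  obtains \<gamma> where "clique_F_inv s c = \<gamma>" "\<And>j. 1 \<le> j \<Longrightarrow> clique_F j \<gamma> = profile_curve q j z"
proof -
  have q1: "1 \<le> q" using s q by simp
  define \<alpha> where "\<alpha> = (real q + 1) * z - 1"
  define \<gamma> where "\<gamma> = real q / (2 * (real q + 1)) * (1 - \<alpha>\<^sup>2)"
  have z\<alpha>: "(1 + \<alpha>) / (real q + 1) = z" by (simp add: \<alpha>_def)
  have P: "edge_density_params \<gamma> q \<alpha>"
    unfolding edge_density_params_def
  proof (intro conjI)
    show "0 \<le> \<alpha>" using z(1) by (simp add: \<alpha>_def field_simps)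
    have "(real q + 1) * z < (real q + 1) * (1 / real q)" using z(2) by (intro mult_strict_left_mono) auto
    then show "\<alpha> < 1 / real q" using q1 by (simp add: \<alpha>_def field_simps)
  qed (use q1 \<gamma>_def in auto)
  have F: "clique_F j \<gamma> = profile_curve q j z" if "1 \<le> j" for j
    using profile_count_eq_clique_F[OF that P] unfolding z\<alpha> profile_curve_def .
  have sq: "real s - 1 \<le> real q" "1 \<le> real s - 1" using s q by auto
  have "(THE \<gamma>. (real s - 2) / (2 * (real s - 1)) < \<gamma> \<and> \<gamma> < 1/2 \<and> clique_F s \<gamma> = c) = \<gamma>"
  proof (rule the_equality)
    have "(real s - 2) / (2 * (real s - 1)) \<le> (real q - 1) / (2 * real q)"
      using sq by (simp add: divide_simps) (simp add: algebra_simps)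
    then have "(real s - 2) / (2 * (real s - 1)) < \<gamma>"
      using edge_density_params_bounds(1)[OF P] by linarith
    moreover have "real q / (2 * (real q + 1)) < 1 / 2" by (simp add: divide_simps)
    then have "\<gamma> < 1 / 2" using edge_density_params_bounds(2)[OF P] by linarith
    ultimately show "(real s - 2) / (2 * (real s - 1)) < \<gamma> \<and> \<gamma> < 1/2 \<and> clique_F s \<gamma> = c"
      using F[of s] s c by simp
  next
    fix \<gamma>' assume \<gamma>': "(real s - 2) / (2 * (real s - 1)) < \<gamma>' \<and> \<gamma>' < 1/2 \<and> clique_F s \<gamma>' = c"
    have "0 \<le> (real s - 2) / (2 * (real s - 1))" using s by simp
    then have "0 < \<gamma>'" using \<gamma>' by linarith
    then obtain q' \<alpha>' where P': "edge_density_params \<gamma>' q' \<alpha>'" using edge_density_params_exist \<gamma>' by blast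
    have q1': "1 \<le> q'" "0 \<le> \<alpha>'" "\<alpha>' < 1 / real q'" using P' by (auto simp: edge_density_params_def)
    define z' where "z' = (1 + \<alpha>') / (real q' + 1)"
    have c': "profile_curve q' s z' = c" using profile_count_eq_clique_F[OF _ P', of s] \<gamma>' s unfolding z'_def profile_curve_def by simp
    have qs': "s - 1 \<le> q'"
    proof (rule ccontr)
      assume "\<not> ?thesis"
      then have "real q' + 1 \<le> real s - 1" by linarith
      then have "real q' / (2 * (real q' + 1)) \<le> (real s - 2) / (2 * (real s - 1))"
        using sq by (simp add: divide_simps) (simp add: algebra_simps)
      then show False using edge_density_params_bounds(2)[OF P'] \<gamma>' by linarith
    qed
    have zl: "1 / real (Suc q') \<le> z'" using q1' by (simp add: z'_def divide_right_mono add.commute)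
    have zu: "z' < 1 / real q'" using q1' by (simp add: z'_def field_simps)
    have "q = q' \<and> z = z'" using profile_curve_unique[OF s q qs' z zl zu] c(1) c' by simp
    then have "q' = q" "\<alpha>' = \<alpha>" unfolding z'_def \<alpha>_def by auto
    then show "\<gamma>' = \<gamma>" using P' unfolding edge_density_params_def \<gamma>_def by simp
  qed
  then have "clique_F_inv s c = \<gamma>" using c(2) by (simp add: clique_F_inv_def)
  then show ?thesis using that F by blast
qed

theorem theorem1p2:
  fixes s t :: nat and V :: "'a set" and E :: "'a set set"
  assumes "2 \<le> s" "s < t" and "simple_graph V E"
  shows "clique_density t V E \<ge> clique_F t (clique_F_inv s (clique_density s V E))"
proof (cases "clique_density s V E = 0")
  case True
  have "0 \<le> clique_density t V E" by (simp add: clique_density_def)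
  moreover have "clique_F t (clique_F_inv s 0) = 0"
  proof (cases "s = 2")
    case True
    then show ?thesis by (simp add: clique_F_inv_def clique_F_def)
  next
    case False
    then have s: "2 < s" using assms(1) by simp
    define \<gamma> where "\<gamma> = (real s - 2) / (2 * (real s - 1))"
    have \<gamma>: "\<gamma> \<noteq> 0" using s by (simp add: \<gamma>_def)
    have P: "edge_density_params \<gamma> (s - 2) 0"
      using s by (simp add: edge_density_params_def \<gamma>_def of_nat_diff)
    have "s - 2 + 1 < t" using assms(2) s by arith
    then have "clique_F t \<gamma> = 0" using clique_F_eq[OF \<gamma> P, of t] by (simp add: binomial_eq_0)
    then show ?thesis by (simp add: clique_F_inv_def \<gamma>_def)
  qed
  ultimately show ?thesis using True by simp
next
  case False
  define c where "c = clique_density s V E"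
  have c: "0 < c" using False by (simp add: c_def clique_density_def)
  obtain q z where qz: "s - 1 \<le> q" "1 / real (Suc q) \<le> z" "z < 1 / real q" "profile_count s q z (1 - real q * z) = c"
    using profile_count_exists[of 1 s c "card V"] assms(1) c clique_density_le_turan[OF assms(3), of s]
    unfolding c_def[symmetric] by (metis zero_less_one)
  have q1: "1 \<le> q" using qz assms(1) by simp
  obtain \<gamma> where \<gamma>: "clique_F_inv s c = \<gamma>" "\<And>j. 1 \<le> j \<Longrightarrow> clique_F j \<gamma> = profile_curve q j z"
    using clique_F_inv_eq[OF assms(1) qz(1-3) _ c] qz(4) unfolding profile_curve_def by metis
  obtain A :: "nat \<Rightarrow> nat \<Rightarrow> bool" and x U where G: "weighted_graph A x U" "sum x U = 1"
    and K: "\<And>j. clique_sum A x j U = clique_density j V E"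
    using clique_density_weighted[OF assms(3)] by metis
  have w: "0 \<le> 1 - real q * z" "1 - real q * z \<le> z"
    using profile_bounds[of q 1 z] q1 qz by auto
  have "profile_count t q z (1 - real q * z) \<le> clique_sum A x t U"
    using less_imp_le[OF assms(2)]
  proof (induction t rule: dec_induct)
    case base
    then show ?case using qz(4) K[of s] by (simp add: c_def)
  next
    case (step j)
    obtain k where "j = k + 2" using step.hyps(1) assms(1) by (metis add.commute le_Suc_ex order_trans)
    then show ?case using extension_boundD[OF extension_bound_all[of k q] G(1) w] G(2) step.IH by simp
  qed
  then show ?thesis using \<gamma>(2)[of t] assms K[of t] unfolding c_def[symmetric] \<gamma>(1) profile_curve_def by simp
qed

end
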